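(* Let $(M^{2n},\omega)$ be a compact symplectic manifold with smooth boundary $\partial M$, and let $(\omega,J,g)$ be a compatible triple on $M$. For every $\eta\in\Omega^k$: $$\eta\in D\Rightarrow d\eta\in D,\qquad \eta\in N\Rightarrow d^*\eta\in N,$$ $$\eta\in JD\Rightarrow d^{\Lambda*}\eta\in JD,\qquad \eta\in JN\Rightarrow d^\Lambda\eta\in JN.$$ For every primitive form $\eta\in P^k$: $$\eta\in D_+\Rightarrow \partial_+\eta\in D_+,\qquad \eta\in N_+\Rightarrow\partial_+^*\eta\in N_+,$$ $$\eta\in D_-\Rightarrow \partial_-\eta\in D_-,\qquad \eta\in N_-\Rightarrow\partial_-^*\eta\in N_-.$$
   Context: $\Omega^k$ is the space of smooth $k$-forms on $M$. $L\eta=\omega\wedge\eta$ is the Lefschetz operator and $\Lambda$ its dual, normalized so that $[\Lambda,L]=H$, where $H$ acts on $k$-forms as multiplication by $n-k$. $d^\Lambda=d\Lambda-\Lambda d$. $P^k=\{\eta\in\Omega^k:\Lambda\eta=0\}$, $0\le k\le n$, is the space of primitive $k$-forms. For $B\in P^k$ one has uniquely $dB=B_{k+1}+L B_{k-1}$ with $B_{k+1}\in P^{k+1}$, $B_{k-1}\in P^{k-1}$ (with $B_{k+1}=0$ if $k=n$); define $\partial_+B=B_{k+1}$, $\partial_-B=B_{k-1}$, so $d=\partial_++L\partial_-$. A superscript $*$ denotes the formal adjoint with respect to the $L^2$ inner product of $g$ (for $\partial_\pm$, as operators between spaces of primitive forms). Let $\rho$ be a boundary defining function: $\rho<0$ on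 the interior of $M$, $\rho=0$ exactly on $\partial M$, $|\nabla\rho|=1$ on $\partial M$. Boundary conditions: $\eta\in D$ iff $d(\rho\eta)|_{\partial M}=0$; $\eta\in N$ iff $d^*(\rho\eta)|_{\partial M}=0$; $\eta\in JD$ iff $d^{\Lambda*}(\rho\eta)|_{\partial M}=0$; $\eta\in JN$ iff $d^{\Lambda}(\rho\eta)|_{\partial M}=0$; $\eta\in D_\pm$ iff $\partial_\pm(\rho\eta)|_{\partial M}=0$; $\eta\in N_\pm$ iff $\partial_\pm^*(\rho\eta)|_{\partial M}=0$. Here $|_{\partial M}$ means evaluating the form at points of $\partial M$ (not pulling it back). *)

theory Defs
  imports "HOL-Analysis.Analysis"
begin

section \<open>Smooth maps and manifolds with boundary\<close>

text \<open>\<open>C\<^sup>k\<close> maps on an open set: all iterated directional derivatives up to order \<open>k\<close> exist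
  (as Frechet derivatives) and are continuous.\<close>

primrec Ck_on :: "nat \<Rightarrow> ('v::euclidean_space \<Rightarrow> 'w::real_normed_vector) \<Rightarrow> 'v set \<Rightarrow> bool" where
  "Ck_on 0 f W \<longleftrightarrow> continuous_on W f"
| "Ck_on (Suc k) f W \<longleftrightarrow>
     (\<forall>x\<in>W. f differentiable (at x)) \<and> (\<forall>v. Ck_on k (\<lambda>x. frechet_derivative f (at x) v) W)"

text \<open>On an arbitrary set (below: a relatively open subset of a half-space) smoothness means
  local extendability to a \<open>C\<^sup>\<infinity>\<close> map on an open set.\<close>

definition smooth_on :: "('v::euclidean_space \<Rightarrow> 'w::real_normed_vector) \<Rightarrow> 'v set \<Rightarrow> bool" where
  "smooth_on f S \<longleftrightarrow>
     (\<forall>x\<in>S. \<exists>W h. open W \<and> x \<in> W \<and> (\<forall>k. Ck_on k h W) \<and> (\<forall>y\<in>S \<inter> W. h y = f y))"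

definition bdry_index :: "'m::finite" where
  "bdry_index = (SOME i. True)"

definition half_space :: "(real ^ 'm::finite) set" where
  "half_space = {x. 0 \<le> x $ bdry_index}"

text \<open>A chart is a pair of its domain and its coordinate map; the values of the coordinate map
  outside the domain are irrelevant.\<close>

type_synonym ('a, 'm) chart = "'a set \<times> ('a \<Rightarrow> real ^ 'm)"

definition coord_rep :: "('a, 'm::finite) chart \<Rightarrow> ('a \<Rightarrow> 'w) \<Rightarrow> real ^ 'm \<Rightarrow> 'w" where
  "coord_rep c f = f \<circ> inv_into (fst c) (snd c)"

definition coord_image :: "('a, 'm::finite) chart \<Rightarrow> (real ^ 'm) set" where
  "coord_image c = snd c ` fst c"

definition smooth_in_chart ::
  "('a, 'm::finite) chart \<Rightarrow> ('a \<Rightarrow> 'w::real_normed_vector) \<Rightarrow> bool" where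
  "smooth_in_chart c f \<longleftrightarrow> smooth_on (coord_rep c f) (coord_image c)"

text \<open>The derivative at \<open>p\<close>, in the coordinates \<open>c\<close>, in direction \<open>v\<close>. It is one-sided if \<open>p\<close> is
  a boundary point; it is unique since \<open>coord_image c\<close> is relatively open in a half-space.\<close>

definition chart_deriv ::
  "('a, 'm::finite) chart \<Rightarrow> ('a \<Rightarrow> 'w::real_normed_vector) \<Rightarrow> 'a \<Rightarrow> real ^ 'm \<Rightarrow> 'w" where
  "chart_deriv c f p v = frechet_derivative (coord_rep c f) (at (snd c p) within coord_image c) v"

definition smooth_manifold_with_boundary ::
  "'a topology \<Rightarrow> ('a, 'm::finite) chart set \<Rightarrow> bool" where
  "smooth_manifold_with_boundary X A \<longleftrightarrow>
     Hausdorff_space X \<and> second_countable X \<and>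
     topspace X = (\<Union>c\<in>A. fst c) \<and>
     (\<forall>c\<in>A. openin X (fst c) \<and>
        openin (top_of_set half_space) (coord_image c) \<and>
        homeomorphic_map (subtopology X (fst c)) (top_of_set (coord_image c)) (snd c)) \<and>
     (\<forall>c\<in>A. \<forall>c'\<in>A. smooth_on (coord_rep c (snd c')) (snd c ` (fst c \<inter> fst c')))"

definition boundary :: "('a, 'm::finite) chart set \<Rightarrow> 'a set" where
  "boundary A = {p. \<exists>c\<in>A. p \<in> fst c \<and> snd c p $ bdry_index = 0}"

definition smooth_function ::
  "('a, 'm::finite) chart set \<Rightarrow> ('a \<Rightarrow> real) \<Rightarrow> bool" where
  "smooth_function A f \<longleftrightarrow> (\<forall>c\<in>A. smooth_in_chart c f)"


section \<open>Differential forms\<close>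

text \<open>A chart \<open>c\<close> around \<open>p\<close> identifies the tangent space at \<open>p\<close> with \<open>real ^ 'm\<close>. Tensor fields
  are given by their values with respect to all these identifications: for a form \<open>\<eta>\<close>,
  \<open>\<eta> c p [v\<^sub>1,\<dots>,v\<^sub>k]\<close> is the value of \<open>\<eta>\<close> at \<open>p\<close> on the tangent vectors whose coordinates with
  respect to \<open>c\<close> are \<open>v\<^sub>1,\<dots>,v\<^sub>k\<close>. The change of identification from \<open>c\<close> to \<open>c'\<close> at \<open>p\<close> is the
  derivative \<open>chart_deriv c (snd c') p\<close> of the transition map. All values without a geometric meaning
  are required to be \<open>0\<close>, so that equality of forms is equality of functions.\<close>

type_synonym ('a, 'm) mform = "('a, 'm) chart \<Rightarrow> 'a \<Rightarrow> (real ^ 'm) list \<Rightarrow> real"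

definition alternating_multilinear :: "('v::real_vector list \<Rightarrow> real) \<Rightarrow> bool" where
  "alternating_multilinear \<alpha> \<longleftrightarrow>
     (\<forall>vs. \<forall>i<length vs. linear (\<lambda>v. \<alpha> (vs[i := v]))) \<and>
     (\<forall>vs. \<forall>j<length vs. \<forall>i<j. vs ! i = vs ! j \<longrightarrow> \<alpha> vs = 0)"

text \<open>The space of smooth \<open>k\<close>-forms. The degree is an integer, so that the forms of negative
  degree are exactly the zero form.\<close>

definition forms :: "('a, 'm::finite) chart set \<Rightarrow> int \<Rightarrow> ('a, 'm) mform set" where
  "forms A k = {\<eta>.
     (\<forall>c p vs. c \<notin> A \<or> p \<notin> fst c \<or> int (length vs) \<noteq> k \<longrightarrow> \<eta> c p vs = 0) \<and>
     (\<forall>c\<in>A. \<forall>p\<in>fst c. alternating_multilinear (\<eta> c p)) \<and>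
     (\<forall>c\<in>A. \<forall>vs. smooth_in_chart c (\<lambda>p. \<eta> c p vs)) \<and>
     (\<forall>c\<in>A. \<forall>c'\<in>A. \<forall>p\<in>fst c \<inter> fst c'. \<forall>vs.
        \<eta> c p vs = \<eta> c' p (map (chart_deriv c (snd c') p) vs))}"

definition form_scale :: "('a \<Rightarrow> real) \<Rightarrow> ('a, 'm) mform \<Rightarrow> ('a, 'm) mform" where
  "form_scale f \<eta> = (\<lambda>c p vs. f p * \<eta> c p vs)"

definition form_add :: "('a, 'm) mform \<Rightarrow> ('a, 'm) mform \<Rightarrow> ('a, 'm) mform" where
  "form_add \<alpha> \<beta> = (\<lambda>c p vs. \<alpha> c p vs + \<beta> c p vs)"

definition form_diff :: "('a, 'm) mform \<Rightarrow> ('a, 'm) mform \<Rightarrow> ('a, 'm) mform" where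
  "form_diff \<alpha> \<beta> = (\<lambda>c p vs. \<alpha> c p vs - \<beta> c p vs)"

text \<open>\<open>d\<eta>(v\<^sub>0,\<dots>,v\<^sub>k) = \<Sum>\<^sub>i (-1)\<^sup>i v\<^sub>i(\<eta>(v\<^sub>0,\<dots>,v\<^sub>k without v\<^sub>i))\<close> for coordinate-constant \<open>v\<^sub>i\<close>.\<close>

definition ext_d :: "('a, 'm::finite) chart set \<Rightarrow> ('a, 'm) mform \<Rightarrow> ('a, 'm) mform" where
  "ext_d A \<eta> = (\<lambda>c p vs. if c \<in> A \<and> p \<in> fst c
     then \<Sum>i<length vs. (-1) ^ i *
            chart_deriv c (\<lambda>q. \<eta> c q (take i vs @ drop (Suc i) vs)) p (vs ! i)
     else 0)"

text \<open>The wedge product as a sum over shuffles. \<open>I\<close> is the set of positions fed to \<open>\<alpha>\<close>, and the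
  sign is that of the shuffle listing \<open>I\<close> before its complement. If \<open>\<alpha>\<close> has degree \<open>p\<close>, only sets
  \<open>I\<close> with \<open>p\<close> elements contribute.\<close>

definition wedge :: "('v list \<Rightarrow> real) \<Rightarrow> ('v list \<Rightarrow> real) \<Rightarrow> 'v list \<Rightarrow> real" where
  "wedge \<alpha> \<beta> vs =
     (\<Sum>I\<in>Pow {..<length vs}.
        (-1) ^ card {(i, j). i \<in> I \<and> j \<in> {..<length vs} - I \<and> j < i} *
        \<alpha> (nths vs I) * \<beta> (nths vs ({..<length vs} - I)))"

definition vanishes_on_boundary :: "('a, 'm::finite) chart set \<Rightarrow> ('a, 'm) mform \<Rightarrow> bool" where
  "vanishes_on_boundary A \<eta> \<longleftrightarrow> (\<forall>c\<in>A. \<forall>p\<in>fst c \<inter> boundary A. \<forall>vs. \<eta> c p vs = 0)"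


section \<open>Symplectic and compatible Riemannian structures\<close>

text \<open>\<open>dual_vec B f\<close> is the vector corresponding to the covector \<open>f\<close> under a nondegenerate bilinear
  form \<open>B\<close>.\<close>

definition dual_vec :: "('v \<Rightarrow> 'v \<Rightarrow> real) \<Rightarrow> ('v \<Rightarrow> real) \<Rightarrow> 'v" where
  "dual_vec B f = (THE x. \<forall>v. B x v = f v)"

definition symplectic_form :: "('a, 'm::finite) chart set \<Rightarrow> ('a, 'm) mform \<Rightarrow> bool" where
  "symplectic_form A \<omega> \<longleftrightarrow>
     \<omega> \<in> forms A 2 \<and> ext_d A \<omega> = (\<lambda>c p vs. 0) \<and>
     (\<forall>c\<in>A. \<forall>p\<in>fst c. \<forall>u. (\<forall>v. \<omega> c p [u, v] = 0) \<longrightarrow> u = 0)"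

type_synonym ('a, 'm) metric = "('a, 'm) chart \<Rightarrow> 'a \<Rightarrow> real ^ 'm \<Rightarrow> real ^ 'm \<Rightarrow> real"

type_synonym ('a, 'm) endomorphism_field = "('a, 'm) chart \<Rightarrow> 'a \<Rightarrow> real ^ 'm \<Rightarrow> real ^ 'm"

definition riemannian_metric :: "('a, 'm::finite) chart set \<Rightarrow> ('a, 'm) metric \<Rightarrow> bool" where
  "riemannian_metric A g \<longleftrightarrow>
     (\<forall>c\<in>A. \<forall>p\<in>fst c. bilinear (g c p) \<and>
        (\<forall>u v. g c p u v = g c p v u) \<and> (\<forall>v. v \<noteq> 0 \<longrightarrow> 0 < g c p v v)) \<and>
     (\<forall>c\<in>A. \<forall>u v. smooth_in_chart c (\<lambda>p. g c p u v)) \<and>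
     (\<forall>c\<in>A. \<forall>c'\<in>A. \<forall>p\<in>fst c \<inter> fst c'. \<forall>u v.
        g c p u v = g c' p (chart_deriv c (snd c') p u) (chart_deriv c (snd c') p v))"

definition almost_complex_structure ::
  "('a, 'm::finite) chart set \<Rightarrow> ('a, 'm) endomorphism_field \<Rightarrow> bool" where
  "almost_complex_structure A J \<longleftrightarrow>
     (\<forall>c\<in>A. \<forall>p\<in>fst c. linear (J c p) \<and> (\<forall>v. J c p (J c p v) = - v)) \<and>
     (\<forall>c\<in>A. \<forall>v. smooth_in_chart c (\<lambda>p. J c p v)) \<and>
     (\<forall>c\<in>A. \<forall>c'\<in>A. \<forall>p\<in>fst c \<inter> fst c'. \<forall>v.
        chart_deriv c (snd c') p (J c p v) = J c' p (chart_deriv c (snd c') p v))"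

definition compatible_triple ::
  "('a, 'm::finite) chart set \<Rightarrow> ('a, 'm) mform \<Rightarrow> ('a, 'm) endomorphism_field \<Rightarrow>
   ('a, 'm) metric \<Rightarrow> bool" where
  "compatible_triple A \<omega> J g \<longleftrightarrow>
     symplectic_form A \<omega> \<and> almost_complex_structure A J \<and> riemannian_metric A g \<and>
     (\<forall>c\<in>A. \<forall>p\<in>fst c. \<forall>u v. \<omega> c p [J c p u, J c p v] = \<omega> c p [u, v]) \<and>
     (\<forall>c\<in>A. \<forall>p\<in>fst c. \<forall>u v. g c p u v = \<omega> c p [u, J c p v])"

definition gradient ::
  "('a, 'm::finite) metric \<Rightarrow> ('a \<Rightarrow> real) \<Rightarrow> ('a, 'm) chart \<Rightarrow> 'a \<Rightarrow> real ^ 'm" where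
  "gradient g f c p = dual_vec (g c p) (chart_deriv c f p)"

definition boundary_defining_function ::
  "'a topology \<Rightarrow> ('a, 'm::finite) chart set \<Rightarrow> ('a, 'm) metric \<Rightarrow> ('a \<Rightarrow> real) \<Rightarrow> bool" where
  "boundary_defining_function X A g \<rho> \<longleftrightarrow>
     smooth_function A \<rho> \<and>
     (\<forall>p\<in>topspace X - boundary A. \<rho> p < 0) \<and>
     (\<forall>p\<in>boundary A. \<rho> p = 0) \<and>
     (\<forall>c\<in>A. \<forall>p\<in>fst c \<inter> boundary A. sqrt (g c p (gradient g \<rho> c p) (gradient g \<rho> c p)) = 1)"


section \<open>Lefschetz operators and primitive forms\<close>

definition lefschetz_L :: "('a, 'm) mform \<Rightarrow> ('a, 'm) mform \<Rightarrow> ('a, 'm) mform" where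
  "lefschetz_L \<omega> \<eta> = (\<lambda>c p. wedge (\<omega> c p) (\<eta> c p))"

text \<open>\<open>\<Lambda>\<eta> = (1/2) \<Sum>\<^sub>i \<iota>(e\<^sub>i) \<iota>(x\<^sub>i) \<eta>\<close>, where \<open>e\<^sub>i\<close> is the coordinate frame and
  \<open>\<omega>(x\<^sub>i, v) = v\<^sub>i\<close>, that is, half the contraction with the inverse of \<open>\<omega>\<close>. In a Darboux frame with
  \<open>\<omega> = \<Sum>\<^sub>j a\<^sup>j \<and> b\<^sup>j\<close> it is \<open>\<Sum>\<^sub>j \<iota>(b\<^sub>j) \<iota>(a\<^sub>j)\<close>, the adjoint of \<open>L\<close> for any compatible
  metric. The sign is the one giving \<open>[\<Lambda>, L] = n - k\<close> on \<open>k\<close>-forms; e.g. \<open>\<Lambda>\<omega> = n\<close>.\<close>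

definition lefschetz_Lambda ::
  "('a, 'm::finite) mform \<Rightarrow> ('a, 'm) mform \<Rightarrow> ('a, 'm) mform" where
  "lefschetz_Lambda \<omega> \<eta> = (\<lambda>c p vs.
     (1 / 2) * (\<Sum>i\<in>UNIV.
        \<eta> c p (dual_vec (\<lambda>u v. \<omega> c p [u, v]) (\<lambda>v. v $ i) # axis i 1 # vs)))"

definition d_Lambda ::
  "('a, 'm::finite) chart set \<Rightarrow> ('a, 'm) mform \<Rightarrow> ('a, 'm) mform \<Rightarrow> ('a, 'm) mform" where
  "d_Lambda A \<omega> \<eta> =
     form_diff (ext_d A (lefschetz_Lambda \<omega> \<eta>)) (lefschetz_Lambda \<omega> (ext_d A \<eta>))"

text \<open>\<open>n\<close> is half the dimension; the space is zero in degrees outside \<open>0..n\<close>.\<close>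

definition primitive_forms ::
  "('a, 'm::finite) chart set \<Rightarrow> nat \<Rightarrow> ('a, 'm) mform \<Rightarrow> int \<Rightarrow> ('a, 'm) mform set" where
  "primitive_forms A n \<omega> k =
     (if 0 \<le> k \<and> k \<le> int n
      then {\<eta> \<in> forms A k. lefschetz_Lambda \<omega> \<eta> = (\<lambda>c p vs. 0)}
      else {\<lambda>c p vs. 0})"

definition del_decomposition ::
  "('a, 'm::finite) chart set \<Rightarrow> nat \<Rightarrow> ('a, 'm) mform \<Rightarrow>
   ('a, 'm) mform \<Rightarrow> ('a, 'm) mform \<Rightarrow> ('a, 'm) mform \<Rightarrow> bool" where
  "del_decomposition A n \<omega> B B' B'' \<longleftrightarrow>
     (\<exists>k. 0 \<le> k \<and> k \<le> int n \<and> B \<in> primitive_forms A n \<omega> k \<and>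
        B' \<in> primitive_forms A n \<omega> (k + 1) \<and> B'' \<in> primitive_forms A n \<omega> (k - 1) \<and>
        ext_d A B = form_add B' (lefschetz_L \<omega> B''))"

definition del_plus ::
  "('a, 'm::finite) chart set \<Rightarrow> nat \<Rightarrow> ('a, 'm) mform \<Rightarrow> ('a, 'm) mform \<Rightarrow> ('a, 'm) mform" where
  "del_plus A n \<omega> B = (THE B'. \<exists>B''. del_decomposition A n \<omega> B B' B'')"

definition del_minus ::
  "('a, 'm::finite) chart set \<Rightarrow> nat \<Rightarrow> ('a, 'm) mform \<Rightarrow> ('a, 'm) mform \<Rightarrow> ('a, 'm) mform" where
  "del_minus A n \<omega> B = (THE B''. \<exists>B'. del_decomposition A n \<omega> B B' B'')"


section \<open>The inner product of forms and formal adjoints\<close>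

text \<open>The Borel measure which in each chart has density \<open>sqrt (det (g\<^sub>i\<^sub>j))\<close> with respect to
  Lebesgue measure.\<close>

definition riemannian_measure ::
  "'a topology \<Rightarrow> ('a, 'm::finite) chart set \<Rightarrow> ('a, 'm) metric \<Rightarrow> 'a measure \<Rightarrow> bool" where
  "riemannian_measure X A g \<mu> \<longleftrightarrow>
     sets \<mu> = sigma_sets (topspace X) {U. openin X U} \<and>
     (\<forall>c\<in>A. \<forall>S\<in>sets \<mu>. S \<subseteq> fst c \<longrightarrow>
        emeasure \<mu> S =
          (\<integral>\<^sup>+ x. ennreal (sqrt (det (\<chi> i j. coord_rep c (\<lambda>p. g c p (axis i 1) (axis j 1)) x)))
                  * indicator (snd c ` S) x \<partial>lborel))"

text \<open>The inner product on alternating forms for which the increasing wedge products of an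
  orthonormal coframe are orthonormal: on \<open>k\<close>-forms,
  \<open>\<langle>\<alpha>,\<beta>\<rangle> = 1/k! \<Sum> g\<^bsup>i\<^sub>1j\<^sub>1\<^esup>\<dots>g\<^bsup>i\<^sub>kj\<^sub>k\<^esup> \<alpha>\<^bsub>i\<^sub>1\<dots>i\<^sub>k\<^esub> \<beta>\<^bsub>j\<^sub>1\<dots>j\<^sub>k\<^esub>\<close>.
  The summand of length \<open>k\<close> vanishes unless \<open>\<alpha>\<close> has degree \<open>k\<close>.\<close>

definition alt_inner ::
  "(real ^ 'm \<Rightarrow> real ^ 'm \<Rightarrow> real) \<Rightarrow> ((real ^ 'm) list \<Rightarrow> real) \<Rightarrow>
   ((real ^ 'm) list \<Rightarrow> real) \<Rightarrow> real" where
  "alt_inner B \<alpha> \<beta> =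
     (\<Sum>is\<in>{is :: 'm::finite list. length is \<le> CARD('m)}.
        \<alpha> (map (\<lambda>i. axis i 1) is) * \<beta> (map (\<lambda>i. dual_vec B (\<lambda>v. v $ i)) is) / fact (length is))"

text \<open>The value is independent of the chart chosen around \<open>p\<close>.\<close>

definition form_inner ::
  "('a, 'm::finite) chart set \<Rightarrow> ('a, 'm) metric \<Rightarrow> ('a, 'm) mform \<Rightarrow> ('a, 'm) mform \<Rightarrow> 'a \<Rightarrow> real"
  where
  "form_inner A g \<alpha> \<beta> p =
     (let c = (SOME c. c \<in> A \<and> p \<in> fst c) in alt_inner (g c p) (\<alpha> c p) (\<beta> c p))"

definition L2_inner ::
  "('a, 'm::finite) chart set \<Rightarrow> ('a, 'm) metric \<Rightarrow> 'a measure \<Rightarrow>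
   ('a, 'm) mform \<Rightarrow> ('a, 'm) mform \<Rightarrow> real" where
  "L2_inner A g \<mu> \<alpha> \<beta> = (\<integral>p. form_inner A g \<alpha> \<beta> p \<partial>\<mu>)"

definition compactly_supported_in_interior ::
  "'a topology \<Rightarrow> ('a, 'm::finite) chart set \<Rightarrow> ('a, 'm) mform \<Rightarrow> bool" where
  "compactly_supported_in_interior X A \<alpha> \<longleftrightarrow>
     (let S = X closure_of {p \<in> topspace X. \<exists>c\<in>A. p \<in> fst c \<and> (\<exists>vs. \<alpha> c p vs \<noteq> 0)}
      in compactin X S \<and> S \<inter> boundary A = {})"

text \<open>\<open>T'\<close> is the formal adjoint of \<open>T\<close>, an operator from \<open>E\<close> to \<open>F\<close>. Since only the forms in
  \<open>E\<close> need to have compact support in the interior, there are no boundary terms, and this determines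
  \<open>T'\<close> on all of \<open>F\<close>.\<close>

definition formal_adjoint ::
  "'a topology \<Rightarrow> ('a, 'm::finite) chart set \<Rightarrow> ('a, 'm) metric \<Rightarrow> 'a measure \<Rightarrow>
   ('a, 'm) mform set \<Rightarrow> ('a, 'm) mform set \<Rightarrow>
   (('a, 'm) mform \<Rightarrow> ('a, 'm) mform) \<Rightarrow> (('a, 'm) mform \<Rightarrow> ('a, 'm) mform) \<Rightarrow> bool" where
  "formal_adjoint X A g \<mu> E F T T' \<longleftrightarrow>
     (\<forall>\<beta>\<in>F. T' \<beta> \<in> E \<and>
        (\<forall>\<alpha>\<in>E. compactly_supported_in_interior X A \<alpha> \<longrightarrow>
           L2_inner A g \<mu> (T \<alpha>) \<beta> = L2_inner A g \<mu> \<alpha> (T' \<beta>)))"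


section \<open>Boundary conditions\<close>

text \<open>The boundary condition associated with a first-order operator \<open>T\<close>: it is \<open>D\<close>, \<open>N\<close>, \<open>JD\<close>,
  \<open>JN\<close>, \<open>D\<^sub>\<plusminus>\<close>, \<open>N\<^sub>\<plusminus>\<close> for \<open>T = d\<close>, \<open>d\<^sup>*\<close>, \<open>d\<^sup>\<Lambda>\<^sup>*\<close>, \<open>d\<^sup>\<Lambda>\<close>, \<open>\<partial>\<^sub>\<plusminus>\<close>, \<open>\<partial>\<^sub>\<plusminus>\<^sup>*\<close>, respectively.\<close>

definition bdry_cond ::
  "('a, 'm::finite) chart set \<Rightarrow> ('a \<Rightarrow> real) \<Rightarrow> (('a, 'm) mform \<Rightarrow> ('a, 'm) mform) \<Rightarrow>
   ('a, 'm) mform set" where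
  "bdry_cond A \<rho> T = {\<eta>. vanishes_on_boundary A (T (form_scale \<rho> \<eta>))}"

end

theory Submission
  imports Defs "HOL-Library.Function_Algebras"
begin

text \<open>Each of the operators \<open>T\<close> is of first order, which is used in the form \<open>[[T, f], h] = 0\<close> for functions
  \<open>f\<close> and \<open>h\<close>, and satisfies \<open>T\<^sup>2 = 0\<close>. A form \<open>\<eta>\<close> satisfies the boundary condition of \<open>T\<close> iff \<open>[T, \<rho>] \<eta>\<close> vanishes on
  the boundary; by Hadamard's lemma it is then a multiple \<open>\<rho> \<xi>\<close>, and \<open>T\<^sup>2 (\<rho> \<eta>) = 0\<close> and \<open>T\<^sup>2 (\<rho>\<^sup>2 \<eta>) = 0\<close> give
  \<open>T (\<rho> T \<eta>) = - \<rho> T \<xi>\<close>, which vanishes on the boundary.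

  For \<open>d\<^sup>\<Lambda>\<close> the equation \<open>T\<^sup>2 = 0\<close> follows from \<open>[\<Lambda>, [\<Lambda>, d]] = 0\<close>, which is a weight argument for \<open>sl\<^sub>2\<close> because
  \<open>[L, d] = 0\<close>; for \<open>\<partial>\<^sub>\<plusminus>\<close> it is read off from \<open>d\<^sup>2 = 0\<close>, where \<open>\<partial>\<^sub>-\<close> on \<open>P\<^sup>k\<close> is \<open>\<Lambda> d / (n - k + 1)\<close>. A formal
  adjoint inherits both properties, since the \<open>L\<^sup>2\<close> inner product with test forms is nondegenerate.\<close>

section \<open>Functions of class \<open>C\<^sup>k\<close>\<close>

text \<open>The adjoints shape the proof: they are known only through the pairing with forms
  supported in the interior, so no coordinate formula for them is at hand. The double commutator
  identity expresses order at most one without coordinates and is invariant under transposition,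
  which is why first order is encoded in that way. To exploit the pairing, smooth forms must have
  finite inner products (compactness makes the measure finite) and nonempty open sets must have
  positive measure. Operators must also be local: T then maps test forms to test forms, and the
  adjoint relation can be used twice in a row.

  A second obstacle is that \<xi> must be a smooth form up to the boundary. Smoothness in a chart
  means local extendability from the half-space, so the division is carried out by the normal
  coordinate first, on an extension. The algebraic properties of \<xi> follow by cancelling \<rho>,
  because interior points are dense.

  All forms and primitive forms are treated alike as modules over the smooth functions in which
  division by \<rho> is possible.\<close>

lemma Ck_on_subset: "Ck_on k f W \<Longrightarrow> W' \<subseteq> W \<Longrightarrow> Ck_on k f W'"
  by (induction k arbitrary: f) (auto intro: continuous_on_subset)

lemma Ck_on_cong:
  assumes "open W" "Ck_on k f W" "\<And>x. x \<in> W \<Longrightarrow> f x = g x"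
  shows "Ck_on k g W"
  using assms(2,3)
proof (induction k arbitrary: f g)
  case 0
  then show ?case by (simp cong: continuous_on_cong)
next
  case (Suc k)
  have d: "f differentiable (at x)" if "x \<in> W" for x
    using Suc that by simp
  have D: "frechet_derivative f (at x) = frechet_derivative g (at x)" if "x \<in> W" for x
    using frechet_derivative_transform_within_open[OF d assms(1)] that Suc.prems(2) by blast
  have "g differentiable (at x)" if "x \<in> W" for x
    using d[OF that] has_derivative_transform_within_open[OF _ assms(1) that, of f _ UNIV g] Suc.prems(2)
    unfolding differentiable_def by blast
  moreover have "Ck_on k (\<lambda>x. frechet_derivative g (at x) v) W" for v
    by (rule Suc.IH[of "\<lambda>x. frechet_derivative f (at x) v"]) (use Suc.prems D in auto)
  ultimately show ?case by simp
qed

text \<open>Any explicit formula \<open>f'\<close> for the derivative may replace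
  \<open>frechet_derivative\<close>. Smoothness of sums, products and compositions then follows by
  induction on \<open>k\<close> from the differentiation rules.\<close>

lemma Ck_on_SucI:
  assumes "open W" "\<And>x. x \<in> W \<Longrightarrow> (f has_derivative f' x) (at x)"
    and "\<And>v. Ck_on k (\<lambda>x. f' x v) W"
  shows "Ck_on (Suc k) f W"
proof -
  have D: "frechet_derivative f (at x) = f' x" if "x \<in> W" for x
    using frechet_derivative_at assms(2) that by metis
  have "Ck_on k (\<lambda>x. frechet_derivative f (at x) v) W" for v
    by (rule Ck_on_cong[OF assms(1) assms(3)[of v]]) (simp add: D)
  then show ?thesis
    using assms(2) by (auto simp: differentiable_def)
qed

lemma Ck_on_Suc_has_derivative:
  "Ck_on (Suc k) f W \<Longrightarrow> x \<in> W \<Longrightarrow> (f has_derivative frechet_derivative f (at x)) (at x)"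
  by (simp add: frechet_derivative_works)

lemma Ck_on_SucD: "Ck_on (Suc k) f W \<Longrightarrow> Ck_on k f W"
proof (induction k arbitrary: f)
  case 0
  then show ?case
    by (auto intro!: continuous_at_imp_continuous_on differentiable_imp_continuous_within)
next
  case (Suc k)
  then show ?case by (metis Ck_on.simps(2))
qed

lemma Ck_on_continuous: "Ck_on k f W \<Longrightarrow> continuous_on W f"
  by (induction k) (auto dest: Ck_on_SucD simp del: Ck_on.simps(2))

lemma Ck_on_const: "open W \<Longrightarrow> Ck_on k (\<lambda>x. a) W"
  by (induction k arbitrary: a) (auto intro: Ck_on_SucI[where f'="\<lambda>_ _. 0"] simp del: Ck_on.simps(2))

lemma Ck_on_bounded_linear:
  assumes "open W" "bounded_linear l"
  shows "Ck_on k l W"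
proof (cases k)
  case 0
  then show ?thesis using assms by (simp add: linear_continuous_on)
next
  case (Suc j)
  show ?thesis unfolding Suc
    by (rule Ck_on_SucI[OF assms(1), where f'="\<lambda>_. l"])
      (auto intro: bounded_linear_imp_has_derivative assms Ck_on_const)
qed

lemma Ck_on_linear_comp:
  assumes "open W" "bounded_linear l" "Ck_on k f W"
  shows "Ck_on k (\<lambda>x. l (f x)) W"
  using assms(3)
proof (induction k arbitrary: f)
  case 0
  then show ?case by (simp add: bounded_linear.continuous_on[OF assms(2)])
next
  case (Suc k)
  show ?case
    by (rule Ck_on_SucI[OF assms(1) bounded_linear.has_derivative[OF assms(2) Ck_on_Suc_has_derivative]])
      (use Suc in auto)
qed

lemma Ck_on_add:
  assumes "open W" "Ck_on k f W" "Ck_on k g W"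
  shows "Ck_on k (\<lambda>x. f x + g x) W"
  using assms(2,3)
proof (induction k arbitrary: f g)
  case 0
  then show ?case by (simp add: continuous_on_add)
next
  case (Suc k)
  show ?case
    by (rule Ck_on_SucI[OF assms(1) has_derivative_add[OF Ck_on_Suc_has_derivative Ck_on_Suc_has_derivative]])
      (use Suc in auto)
qed

lemma Ck_on_scaleR:
  fixes f :: "_ \<Rightarrow> real"
  assumes "open W" "Ck_on k f W" "Ck_on k g W"
  shows "Ck_on k (\<lambda>x. f x *\<^sub>R g x) W"
  using assms(2,3)
proof (induction k arbitrary: f g)
  case 0
  then show ?case by (simp add: continuous_on_scaleR)
next
  case (Suc k)
  note k = Suc.prems[THEN Ck_on_SucD]
  show ?case
    by (rule Ck_on_SucI[OF assms(1) has_derivative_scaleR[OF Ck_on_Suc_has_derivative Ck_on_Suc_has_derivative]])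
      (use Suc k in \<open>auto intro!: Ck_on_add assms(1)\<close>)
qed

lemma Ck_on_mult:
  fixes f :: "_ \<Rightarrow> real"
  assumes "open W" "Ck_on k f W" "Ck_on k g W"
  shows "Ck_on k (\<lambda>x. f x * g x) W"
  using Ck_on_scaleR[OF assms] by simp

lemma Ck_on_sum:
  assumes "open W" "\<And>i. i \<in> I \<Longrightarrow> Ck_on k (f i) W"
  shows "Ck_on k (\<lambda>x. \<Sum>i\<in>I. f i x) W"
  using assms(2)
  by (induction I rule: infinite_finite_induct) (auto intro: Ck_on_const Ck_on_add assms(1))

text \<open>With \<open>f\<close> fixed the induction closes, because the derivative of 1/f is a
  product of two copies of 1/f and a derivative of \<open>f\<close>.\<close>

lemma Ck_on_inverse:
  fixes f :: "_ \<Rightarrow> real"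
  assumes "open W" "Ck_on k f W" "\<And>x. x \<in> W \<Longrightarrow> f x \<noteq> 0"
  shows "Ck_on k (\<lambda>x. inverse (f x)) W"
  using assms(2)
proof (induction k)
  case 0
  then show ?case using assms(3) by (auto intro: continuous_on_inverse)
next
  case (Suc k)
  have "Ck_on k (\<lambda>x. -1 * (inverse (f x) * frechet_derivative f (at x) v * inverse (f x))) W" for v
    using Suc Ck_on_SucD[OF Suc.prems] by (intro Ck_on_mult Ck_on_const assms(1)) auto
  moreover have "((\<lambda>x. inverse (f x)) has_derivative
      (\<lambda>v. -1 * (inverse (f x) * frechet_derivative f (at x) v * inverse (f x)))) (at x)" if "x \<in> W" for x
    using Deriv.has_derivative_inverse[OF assms(3)[OF that] Ck_on_Suc_has_derivative[OF Suc.prems that]]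
    by simp
  ultimately show ?case by (rule Ck_on_SucI[OF assms(1), rotated])
qed

lemma Ck_on_compose:
  fixes g :: "'a::euclidean_space \<Rightarrow> 'b::euclidean_space" and f :: "'b \<Rightarrow> 'c::real_normed_vector"
  assumes "open W" "open W'" "Ck_on k f W'" "Ck_on k g W" "g ` W \<subseteq> W'"
  shows "Ck_on k (\<lambda>x. f (g x)) W"
  using assms(3,4)
proof (induction k arbitrary: f)
  case 0
  then show ?case using continuous_on_compose2[of W' f W g] assms(5) by simp
next
  case (Suc k)
  \<comment> \<open>The direction in which \<open>f\<close> is differentiated depends on x.
    Expanding it in \<open>Basis\<close> leaves derivatives of \<open>f\<close> in fixed directions,
    to which the induction hypothesis applies.\<close>
  let ?f' = "\<lambda>x v. \<Sum>b\<in>Basis. (frechet_derivative g (at x) v \<bullet> b) *\<^sub>R frechet_derivative f (at (g x)) b"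
  have "((\<lambda>x. f (g x)) has_derivative ?f' x) (at x)" if x: "x \<in> W" for x
  proof -
    have fd: "(f has_derivative frechet_derivative f (at (g x))) (at (g x))"
      using Ck_on_Suc_has_derivative[OF Suc.prems(1)] assms(5) x by blast
    interpret bounded_linear "frechet_derivative f (at (g x))"
      using fd by (rule has_derivative_bounded_linear)
    have "frechet_derivative f (at (g x)) u = (\<Sum>b\<in>Basis. (u \<bullet> b) *\<^sub>R frechet_derivative f (at (g x)) b)" for u
      by (subst euclidean_representation[of u, symmetric], subst sum, subst scaleR) simp
    then have "?f' x = (\<lambda>v. frechet_derivative f (at (g x)) (frechet_derivative g (at x) v))"
      by metis
    then show ?thesis
      using diff_chain_at[OF Ck_on_Suc_has_derivative[OF Suc.prems(2) x] fd] by (simp add: o_def)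
  qed
  moreover have "Ck_on k (\<lambda>x. ?f' x v) W" for v
  proof (intro Ck_on_sum Ck_on_scaleR assms(1))
    fix b :: 'b
    show "Ck_on k (\<lambda>x. frechet_derivative g (at x) v \<bullet> b) W"
      using Suc.prems(2) by (intro Ck_on_linear_comp[OF assms(1) bounded_linear_inner_left]) simp
    show "Ck_on k (\<lambda>x. frechet_derivative f (at (g x)) b) W"
      using Suc.IH[of "\<lambda>y. frechet_derivative f (at y) b"] Suc.prems Ck_on_SucD by auto
  qed
  ultimately show ?case by (rule Ck_on_SucI[OF assms(1)])
qed

section \<open>Hadamard's lemma and bump functions\<close>

lemma symmetric_second_derivative:
  fixes f :: "'a::euclidean_space \<Rightarrow> real"
  assumes W: "open W" "x \<in> W" and C2: "Ck_on (Suc (Suc 0)) f W"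
  shows "frechet_derivative (\<lambda>y. frechet_derivative f (at y) v) (at x) w =
         frechet_derivative (\<lambda>y. frechet_derivative f (at y) w) (at x) v"
proof -
  define D where "D = (\<lambda>u y. frechet_derivative f (at y) u)"
  define DD where "DD = (\<lambda>u u' y. frechet_derivative (D u) (at y) u')"
  have f': "(f has_derivative (\<lambda>u. D u y)) (at y)" if "y \<in> W" for y
    using Ck_on_Suc_has_derivative[OF C2 that] by (simp add: D_def)
  have D': "(D u has_derivative (\<lambda>u'. DD u u' y)) (at y)" if "y \<in> W" for y u
    using C2 that by (auto simp: DD_def D_def frechet_derivative_works[symmetric])
  have DDc: "continuous_on W (DD u u')" for u u'
    using C2 by (auto simp: DD_def D_def)
  text \<open>The mean value theorem, applied twice to the second difference quotient.\<close>
  have mvt: "\<exists>a b. 0 < a \<and> a < s \<and> 0 < b \<and> b < s \<and>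
      f (x + s *\<^sub>R u + s *\<^sub>R u') - f (x + s *\<^sub>R u) - f (x + s *\<^sub>R u') + f x
        = s * s * DD u u' (x + a *\<^sub>R u + b *\<^sub>R u')"
    if s: "0 < s" and in_W: "\<And>a b. 0 \<le> a \<Longrightarrow> a \<le> s \<Longrightarrow> 0 \<le> b \<Longrightarrow> b \<le> s \<Longrightarrow> x + a *\<^sub>R u + b *\<^sub>R u' \<in> W"
    for s u u'
  proof -
    let ?\<phi> = "\<lambda>a. f (x + a *\<^sub>R u + s *\<^sub>R u') - f (x + a *\<^sub>R u)"
    have lin: "linear (\<lambda>u. D u y)" "linear (\<lambda>u'. DD u u' y)" if "y \<in> W" for y u
      using f'[OF that] D'[OF that] has_derivative_linear by blast+
    have \<phi>': "(?\<phi> has_real_derivative D u (x + a *\<^sub>R u + s *\<^sub>R u') - D u (x + a *\<^sub>R u)) (at a)"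
      if "0 \<le> a" "a \<le> s" for a
    proof -
      have m: "x + a *\<^sub>R u + s *\<^sub>R u' \<in> W" "x + a *\<^sub>R u \<in> W"
        using in_W[of a s] in_W[of a 0] that s by auto
      show ?thesis
        unfolding has_field_derivative_def
        by (rule derivative_eq_intros has_derivative_compose[OF _ f'] refl m)+
          (auto simp: linear_scale[OF lin(1)[OF m(1)]] linear_scale[OF lin(1)[OF m(2)]] right_diff_distrib left_diff_distrib mult.commute fun_eq_iff)
    qed
    obtain a where a: "0 < a" "a < s"
      and a_eq: "?\<phi> s - ?\<phi> 0 = (s - 0) * (D u (x + a *\<^sub>R u + s *\<^sub>R u') - D u (x + a *\<^sub>R u))"
      using MVT2[OF s \<phi>'] by blast
    let ?\<psi> = "\<lambda>b. D u (x + a *\<^sub>R u + b *\<^sub>R u')"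
    have \<psi>': "(?\<psi> has_real_derivative DD u u' (x + a *\<^sub>R u + b *\<^sub>R u')) (at b)"
      if "0 \<le> b" "b \<le> s" for b
    proof -
      have m: "x + a *\<^sub>R u + b *\<^sub>R u' \<in> W"
        using in_W[of a b] that a by auto
      have "((\<lambda>b. x + a *\<^sub>R u + b *\<^sub>R u') has_derivative (\<lambda>h. h *\<^sub>R u')) (at b)"
        by (auto intro!: derivative_eq_intros)
      from has_derivative_compose[OF this D'[OF m]] show ?thesis
        unfolding has_field_derivative_def
        by (rule has_derivative_eq_rhs) (simp add: linear_scale[OF lin(2)[OF m]] mult.commute fun_eq_iff)
    qed
    obtain b where "0 < b" "b < s" "?\<psi> s - ?\<psi> 0 = (s - 0) * DD u u' (x + a *\<^sub>R u + b *\<^sub>R u')"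
      using MVT2[OF s \<psi>'] by blast
    with a a_eq show ?thesis
      by (intro exI[of _ a] exI[of _ b]) (auto simp: algebra_simps)
  qed
  \<comment> \<open>The second difference is symmetric in the two directions, so
    \<open>DD v w\<close> and \<open>DD w v\<close> take a common value at two points near x.
    Continuity brings both points to x.\<close>
  have "\<bar>DD v w x - DD w v x\<bar> < e" if "0 < e" for e
  proof -
    have "\<exists>d>0. ball x d \<subseteq> W \<and> (\<forall>y\<in>ball x d. \<bar>DD u u' y - DD u u' x\<bar> < e / 2)" for u u'
    proof -
      have "isCont (DD u u') x"
        using DDc W continuous_on_eq_continuous_at by blast
      then obtain d1 where "d1 > 0" "\<forall>y. dist y x < d1 \<longrightarrow> dist (DD u u' y) (DD u u' x) < e / 2"
        using \<open>0 < e\<close> unfolding continuous_at_eps_delta by (meson half_gt_zero)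
      moreover obtain d2 where "d2 > 0" "ball x d2 \<subseteq> W"
        using W open_contains_ball by blast
      ultimately show ?thesis
        by (intro exI[of _ "min d1 d2"]) (auto simp: dist_real_def dist_commute)
    qed
    then obtain d1 d2 where d: "d1 > 0" "ball x d1 \<subseteq> W" "\<forall>y\<in>ball x d1. \<bar>DD v w y - DD v w x\<bar> < e / 2"
      "d2 > 0" "ball x d2 \<subseteq> W" "\<forall>y\<in>ball x d2. \<bar>DD w v y - DD w v x\<bar> < e / 2" by metis
    define d where "d = min d1 d2"
    \<comment> \<open>Every point reached with coefficients at most \<open>s\<close> has distance
      less than \<open>d\<close> from x. The summand 1 keeps the denominator positive when v = w =
      0.\<close>
    define s where "s = d / (2 * (norm v + norm w + 1))"
    have "s > 0" using d by (auto simp: s_def d_def intro!: divide_pos_pos add_nonneg_pos)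
    have near: "x + a *\<^sub>R u + b *\<^sub>R u' \<in> ball x d"
      if "0 \<le> a" "a \<le> s" "0 \<le> b" "b \<le> s" "norm u + norm u' = norm v + norm w" for a b u u'
    proof -
      have "norm (a *\<^sub>R u + b *\<^sub>R u') \<le> a * norm u + b * norm u'"
        using norm_triangle_ineq[of "a *\<^sub>R u" "b *\<^sub>R u'"] that by simp
      also have "\<dots> \<le> s * norm u + s * norm u'"
        using that by (intro add_mono mult_right_mono) auto
      also have "\<dots> = s * (norm v + norm w)" using that(5) by (metis distrib_left)
      also have "\<dots> \<le> s * (norm v + norm w + 1)" using \<open>s > 0\<close> by simp
      also have "\<dots> = d / 2"
      proof -
        have "norm v + norm w + 1 \<noteq> 0" using norm_ge_zero[of v] norm_ge_zero[of w] by linarith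
        moreover have "d / (2 * c) * c = d / 2" if "c \<noteq> 0" for c using that by simp
        ultimately show ?thesis unfolding s_def by blast
      qed
      also have "\<dots> < d" using d by (simp add: d_def min_def)
      finally have "norm (a *\<^sub>R u + b *\<^sub>R u') < d" .
      moreover have "x - (x + a *\<^sub>R u + b *\<^sub>R u') = - (a *\<^sub>R u + b *\<^sub>R u')" by simp
      ultimately show ?thesis by (simp only: mem_ball dist_norm norm_minus_cancel)
    qed
    obtain a b where ab: "0 < a" "a < s" "0 < b" "b < s"
      and e1: "f (x + s *\<^sub>R v + s *\<^sub>R w) - f (x + s *\<^sub>R v) - f (x + s *\<^sub>R w) + f x
        = s * s * DD v w (x + a *\<^sub>R v + b *\<^sub>R w)"
      using mvt[OF \<open>s > 0\<close>, of v w] near[of _ _ v w] d(2) unfolding d_def by (smt (verit, best) mem_ball subset_iff)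
    obtain a' b' where ab': "0 < a'" "a' < s" "0 < b'" "b' < s"
      and e2: "f (x + s *\<^sub>R w + s *\<^sub>R v) - f (x + s *\<^sub>R w) - f (x + s *\<^sub>R v) + f x
        = s * s * DD w v (x + a' *\<^sub>R w + b' *\<^sub>R v)"
      using mvt[OF \<open>s > 0\<close>, of w v] near[of _ _ w v] d(2) unfolding d_def by (smt (verit, best) mem_ball subset_iff)
    have "s * s * DD v w (x + a *\<^sub>R v + b *\<^sub>R w) = s * s * DD w v (x + a' *\<^sub>R w + b' *\<^sub>R v)"
      using e1 e2 by (simp add: algebra_simps)
    then have eq: "DD v w (x + a *\<^sub>R v + b *\<^sub>R w) = DD w v (x + a' *\<^sub>R w + b' *\<^sub>R v)"
      using \<open>s > 0\<close> by simp
    have "\<bar>DD v w (x + a *\<^sub>R v + b *\<^sub>R w) - DD v w x\<bar> < e / 2"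
      using d(3) near[of a b v w] ab by (auto simp: d_def)
    moreover have "\<bar>DD w v (x + a' *\<^sub>R w + b' *\<^sub>R v) - DD w v x\<bar> < e / 2"
      using d(6) near[of a' b' w v] ab' by (auto simp: d_def)
    ultimately show ?thesis using eq by linarith
  qed
  then have "DD v w x = DD w v x"
    by (metis eq_iff_diff_eq_0 less_irrefl zero_less_abs_iff)
  then show ?thesis by (simp add: DD_def D_def)
qed

text \<open>The quotient in Hadamard's lemma is the integral over \<open>t \<in> [0, 1]\<close> of the derivative in direction \<open>e\<close> at
  \<open>squeeze e t x\<close>.\<close>

definition squeeze :: "'a::euclidean_space \<Rightarrow> real \<Rightarrow> 'a \<Rightarrow> 'a" where
  "squeeze e t x = x + ((t - 1) * (x \<bullet> e)) *\<^sub>R e"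

text \<open>After subtraction of \<open>x0\<close> the point is a convex combination of
  \<open>x - x0\<close> and its projection orthogonal to \<open>e\<close>, which is no longer than
  \<open>x - x0\<close>.\<close>

lemma squeeze_in_ball:
  assumes "e \<in> Basis" "x0 \<bullet> e = 0" "x \<in> ball x0 r" "0 \<le> t" "t \<le> 1"
  shows "squeeze e t x \<in> ball x0 r"
proof -
  have "squeeze e t x - x0 = t *\<^sub>R (x - x0) + (1 - t) *\<^sub>R ((x - x0) - ((x - x0) \<bullet> e) *\<^sub>R e)"
    by (simp add: squeeze_def assms inner_diff_left algebra_simps)
  also have "norm \<dots> \<le> t * norm (x - x0) + (1 - t) * norm ((x - x0) - ((x - x0) \<bullet> e) *\<^sub>R e)"
    by (rule order_trans[OF norm_triangle_ineq]) (use assms in auto)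
  also have "norm ((x - x0) - ((x - x0) \<bullet> e) *\<^sub>R e) \<le> norm (x - x0)"
  proof -
    have "(norm ((x - x0) - ((x - x0) \<bullet> e) *\<^sub>R e))\<^sup>2 = (norm (x - x0))\<^sup>2 - ((x - x0) \<bullet> e)\<^sup>2"
      unfolding power2_norm_eq_inner
      using assms(1) by (simp add: inner_diff_left inner_diff_right inner_commute power2_eq_square algebra_simps)
    also have "\<dots> \<le> (norm (x - x0))\<^sup>2" by simp
    finally show ?thesis by (simp add: power2_le_iff_abs_le)
  qed
  then have "t * norm (x - x0) + (1 - t) * norm ((x - x0) - ((x - x0) \<bullet> e) *\<^sub>R e)
      \<le> t * norm (x - x0) + (1 - t) * norm (x - x0)"
    using assms by (intro add_left_mono mult_left_mono) auto
  finally show ?thesis using assms(3) by (simp add: dist_norm norm_minus_commute algebra_simps)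
qed

lemma continuous_on_squeeze_compose:
  assumes "e \<in> Basis" "x0 \<bullet> e = 0" "continuous_on (ball x0 r) f"
  shows "continuous_on (ball x0 r \<times> {0..1}) (\<lambda>z. f (squeeze e (snd z) (fst z)))"
  by (rule continuous_on_compose2[OF assms(3)])
    (use squeeze_in_ball[OF assms(1,2)] in \<open>auto simp: squeeze_def intro!: continuous_intros\<close>)

lemma has_derivative_squeeze: "(squeeze e t has_derivative squeeze e t) (at x within S)"
  unfolding squeeze_def by (auto intro!: derivative_eq_intros)

lemma squeeze_split: "e \<in> Basis \<Longrightarrow> squeeze e t v = (v - (v \<bullet> e) *\<^sub>R e) + (t * (v \<bullet> e)) *\<^sub>R e"
  by (simp add: squeeze_def algebra_simps)

text \<open>Differentiation under the integral sign. The component of the direction along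
  \<open>e\<close> produces a factor t, so the induction runs over all weights \<open>t ^ j\<close>
  at once.\<close>

lemma Ck_on_integral_squeeze:
  fixes f :: "'a::euclidean_space \<Rightarrow> real"
  assumes e: "e \<in> Basis" "x0 \<bullet> e = 0" and "Ck_on k f (ball x0 r)"
  shows "Ck_on k (\<lambda>x. integral {0..1} (\<lambda>t. t ^ j * f (squeeze e t x))) (ball x0 r)"
  using assms(3)
proof (induction k arbitrary: f j)
  case 0
  have "continuous_on (ball x0 r \<times> cbox 0 1) (\<lambda>(x, t::real). t ^ j * f (squeeze e t x))"
    using continuous_on_squeeze_compose[OF e] 0
    by (auto simp: case_prod_beta intro!: continuous_intros)
  from integral_continuous_on_param[OF this] show ?case by simp
next
  case (Suc k)
  let ?U = "ball x0 r"
  define D where "D = (\<lambda>u y. frechet_derivative f (at y) u)"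
  have f': "(f has_derivative (\<lambda>u. D u y)) (at y)" if "y \<in> ?U" for y
    using Ck_on_Suc_has_derivative[OF Suc.prems that] by (simp add: D_def)
  have DC: "Ck_on k (D u) ?U" for u using Suc.prems by (simp add: D_def)
  have bl: "bounded_linear (\<lambda>u. D u y)" if "y \<in> ?U" for y
    using f'[OF that] by (rule has_derivative_bounded_linear)
  have D_squeeze: "D (squeeze e t v) y = D (v - (v \<bullet> e) *\<^sub>R e) y + t * (v \<bullet> e) * D e y" if "y \<in> ?U" for y t v
    by (simp add: squeeze_split[OF e(1)] linear_add[OF bounded_linear.linear[OF bl[OF that]]]
        linear_scale[OF bounded_linear.linear[OF bl[OF that]]])
  have in_U: "squeeze e t x \<in> ?U" if "x \<in> ?U" "t \<in> {0..1}" for x t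
    using squeeze_in_ball[OF e that(1)] that(2) by auto
  \<comment> \<open>The derivative of the integrand is packaged as a bounded linear map, the shape
    in which the Leibniz rule for parameter integrals takes it.\<close>
  define F where "F = (\<lambda>x t. Blinfun (\<lambda>v. t ^ j * D (squeeze e t v) (squeeze e t x)))"
  have blF: "bounded_linear (\<lambda>v. t ^ j * D (squeeze e t v) (squeeze e t x))"
    if "x \<in> ?U" "t \<in> {0..1}" for x t
    by (intro bounded_linear_const_mult bounded_linear_compose[OF bl[OF in_U[OF that]]]
        has_derivative_bounded_linear[OF has_derivative_squeeze])
  have F: "blinfun_apply (F x t) = (\<lambda>v. t ^ j * D (squeeze e t v) (squeeze e t x))"
    if "x \<in> ?U" "t \<in> {0..1}" for x t
    unfolding F_def by (rule bounded_linear_Blinfun_apply[OF blF[OF that]])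
  have cont: "continuous_on (?U \<times> cbox 0 1) (\<lambda>(x, t). F x t)"
  proof (rule continuous_on_blinfun_componentwise)
    fix i :: 'a
    have "continuous_on (?U \<times> {0..1}) (\<lambda>z. snd z ^ j * (D (i - (i \<bullet> e) *\<^sub>R e) (squeeze e (snd z) (fst z))
       + snd z * (i \<bullet> e) * D e (squeeze e (snd z) (fst z))))"
      by (intro continuous_intros continuous_on_squeeze_compose[OF e] Ck_on_continuous[OF DC])
    then have "continuous_on (?U \<times> {0..1}) (\<lambda>z. blinfun_apply (case z of (x, t) \<Rightarrow> F x t) i)"
      by (rule continuous_on_eq) (auto simp: F D_squeeze[OF in_U])
    then show "continuous_on (?U \<times> cbox 0 1) (\<lambda>z. blinfun_apply (case z of (x, t) \<Rightarrow> F x t) i)"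
      by simp
  qed
  have cont_f: "continuous_on {0..1} (\<lambda>t. t ^ m * g (squeeze e t x))"
    if "x \<in> ?U" "continuous_on ?U g" for x m and g :: "'a \<Rightarrow> real"
    using continuous_on_compose2[OF continuous_on_squeeze_compose[OF e that(2)], of "{0..1}" "\<lambda>t. (x, t)"] that(1)
    by (auto intro!: continuous_intros simp: continuous_on_Pair image_subset_iff)
  have int: "(\<lambda>t. t ^ m * g (squeeze e t x)) integrable_on {0..1}"
    if "x \<in> ?U" "continuous_on ?U g" for x m and g :: "'a \<Rightarrow> real"
    using integrable_continuous_interval[OF cont_f[OF that]] .
  let ?I = "\<lambda>m g x. integral {0..1} (\<lambda>t. t ^ m * g (squeeze e t x))"
  have der: "(?I j f has_derivative (\<lambda>v. ?I j (D (v - (v \<bullet> e) *\<^sub>R e)) x + (v \<bullet> e) * ?I (Suc j) (D e) x)) (at x)"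
    if x: "x \<in> ?U" for x
  proof -
    have fx: "((\<lambda>x. t ^ j * f (squeeze e t x)) has_derivative blinfun_apply (F x t)) (at x within ?U)"
      if "x \<in> ?U" "t \<in> cbox 0 1" for x t
      using that by (auto simp: F intro!: derivative_eq_intros
        has_derivative_compose[OF has_derivative_squeeze f'[OF in_U]])
    have c: "continuous_on {0..1} (F x)"
      using continuous_on_compose2[OF cont, of "{0..1}" "\<lambda>t. (x, t)"] x
      by (auto intro!: continuous_intros simp: continuous_on_Pair image_subset_iff)
    have "blinfun_apply (integral {0..1} (F x)) v = ?I j (D (v - (v \<bullet> e) *\<^sub>R e)) x + (v \<bullet> e) * ?I (Suc j) (D e) x" for v
    proof -
      have "blinfun_apply (integral {0..1} (F x)) v = integral {0..1} (\<lambda>t. blinfun_apply (F x t) v)"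
        using blinfun_apply_integral[of "F x" "{0..1}" v] integrable_continuous_interval[OF c] by simp
      also have "\<dots> = integral {0..1} (\<lambda>t. t ^ j * D (v - (v \<bullet> e) *\<^sub>R e) (squeeze e t x)
            + (v \<bullet> e) * (t ^ Suc j * D e (squeeze e t x)))"
        by (rule integral_cong) (use x in \<open>simp add: F D_squeeze[OF in_U] algebra_simps\<close>)
      also have "\<dots> = ?I j (D (v - (v \<bullet> e) *\<^sub>R e)) x + (v \<bullet> e) * ?I (Suc j) (D e) x"
        by (subst integral_add)
          (auto intro!: int integrable_on_mult_right x Ck_on_continuous[OF DC] simp del: power_Suc)
      finally show ?thesis .
    qed
    then have "blinfun_apply (integral {0..1} (F x)) = (\<lambda>v. ?I j (D (v - (v \<bullet> e) *\<^sub>R e)) x + (v \<bullet> e) * ?I (Suc j) (D e) x)"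
      by (rule ext)
    moreover have "(?I j f has_derivative blinfun_apply (integral {0..1} (F x))) (at x within ?U)"
      using leibniz_rule[OF fx _ cont x convex_ball] int[OF _ Ck_on_continuous[OF Suc.prems]]
      unfolding cbox_interval by blast
    ultimately show ?thesis by (simp only: at_within_open[OF x open_ball])
  qed
  show ?case
    by (rule Ck_on_SucI[OF open_ball der]) (auto intro!: Ck_on_add Ck_on_mult Ck_on_const Suc.IH DC simp del: power_Suc)
qed

text \<open>The fundamental theorem of calculus on the segment from the projection of x onto the
  hyperplane, where \<open>f\<close> is zero, to x itself.\<close>

lemma hadamard:
  fixes f :: "'a::euclidean_space \<Rightarrow> real"
  assumes e: "e \<in> Basis" "x0 \<bullet> e = 0" and f: "\<And>k. Ck_on k f (ball x0 r)"
    and zero: "\<And>x. x \<in> ball x0 r \<Longrightarrow> x \<bullet> e = 0 \<Longrightarrow> f x = 0"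
  obtains g where "\<And>k. Ck_on k g (ball x0 r)" "\<And>x. x \<in> ball x0 r \<Longrightarrow> f x = (x \<bullet> e) * g x"
proof -
  define D where "D = (\<lambda>u y. frechet_derivative f (at y) u)"
  have f': "(f has_derivative (\<lambda>u. D u y)) (at y)" if "y \<in> ball x0 r" for y
    using Ck_on_Suc_has_derivative[OF f that] by (simp add: D_def)
  let ?g = "\<lambda>x. integral {0..1} (\<lambda>t. t ^ 0 * D e (squeeze e t x))"
  have "Ck_on k ?g (ball x0 r)" for k
    using f[of "Suc k"] by (intro Ck_on_integral_squeeze[OF e]) (simp add: D_def)
  moreover have "f x = (x \<bullet> e) * ?g x" if x: "x \<in> ball x0 r" for x
  proof -
    have "((\<lambda>t. f (squeeze e t x)) has_vector_derivative (x \<bullet> e) * D e (squeeze e t x)) (at t within {0..1})"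
      if "t \<in> {0..1}" for t
    proof -
      have m: "squeeze e t x \<in> ball x0 r"
        using squeeze_in_ball[OF e x] that by auto
      have "((\<lambda>t. squeeze e t x) has_derivative (\<lambda>h. (h * (x \<bullet> e)) *\<^sub>R e)) (at t within {0..1})"
        unfolding squeeze_def by (auto intro!: derivative_eq_intros)
      from has_derivative_compose[OF this f'[OF m]] show ?thesis
        by (simp add: has_vector_derivative_def linear_scale[OF has_derivative_linear[OF f'[OF m]]] mult.assoc)
    qed
    from fundamental_theorem_of_calculus[OF _ this]
    have "((\<lambda>t. (x \<bullet> e) * D e (squeeze e t x)) has_integral (f (squeeze e 1 x) - f (squeeze e 0 x))) {0..1}"
      by simp
    from integral_unique[OF this] have "f (squeeze e 1 x) - f (squeeze e 0 x) = (x \<bullet> e) * ?g x"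
      by simp
    moreover have "f (squeeze e 0 x) = 0"
      by (rule zero) (use squeeze_in_ball[OF e x, of 0] e in \<open>auto simp: squeeze_def inner_diff_left inner_add_left\<close>)
    ultimately show ?thesis by (simp add: squeeze_def)
  qed
  ultimately show ?thesis by (rule that)
qed

text \<open>The case \<open>n = 0\<close> is the classical flat function exp(-1/t). The powers of
  1/t make the family closed under differentiation up to linear combinations, so one induction
  proves all members smooth.\<close>

definition flat :: "nat \<Rightarrow> real \<Rightarrow> real" where
  "flat n t = (if t > 0 then (1 / t) ^ n * exp (- (1 / t)) else 0)"

lemma power_le_fact_exp:
  fixes y :: real
  assumes "0 \<le> y"
  shows "y ^ n \<le> fact n * exp y"
proof -
  have "(\<Sum>k\<in>{n}. y ^ k /\<^sub>R fact k) \<le> (\<Sum>k. y ^ k /\<^sub>R fact k)"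
    by (rule sum_le_suminf[OF summable_exp_generic]) (use assms in auto)
  then show ?thesis by (simp add: exp_def field_simps)
qed

text \<open>A quadratic bound is what makes the difference quotient at 0 tend to 0. The factorial
  comes from comparing exp(1/t) with its term of order \<open>n + 2\<close>.\<close>

lemma flat_le: "\<bar>flat n t\<bar> \<le> fact (n + 2) * t\<^sup>2"
proof (cases "t > 0")
  case True
  have "(1 / t) ^ (n + 2) * exp (- (1 / t)) \<le> fact (n + 2)"
    using power_le_fact_exp[of "1 / t" "n + 2"] True by (simp add: exp_minus field_simps)
  then have "(1 / t) ^ (n + 2) * exp (- (1 / t)) * t\<^sup>2 \<le> fact (n + 2) * t\<^sup>2"
    by (rule mult_right_mono) simp
  moreover have "(1 / t) ^ (n + 2) * t\<^sup>2 = (1 / t) ^ n"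
    using True by (simp add: power_add power_divide power2_eq_square)
  ultimately have "(1 / t) ^ n * exp (- (1 / t)) \<le> fact (n + 2) * t\<^sup>2"
    by (metis (no_types, lifting) mult.assoc mult.commute)
  then show ?thesis using True by (simp only: flat_def if_True) simp
qed (simp add: flat_def)

lemma has_derivative_flat:
  "(flat n has_derivative (\<lambda>h. h * (flat (n + 2) t - real n * flat (n + 1) t))) (at t)"
proof -
  consider "t > 0" | "t < 0" | "t = 0" by linarith
  then show ?thesis
  proof cases
    case 1
    have inv: "((\<lambda>t. 1 / t) has_field_derivative - ((1 / t)\<^sup>2)) (at t)"
      using 1 by (auto intro!: derivative_eq_intros simp: power2_eq_square)
    have "((\<lambda>t. (1 / t) ^ n * exp (- (1 / t))) has_field_derivative
        real n * (- ((1 / t)\<^sup>2) * (1 / t) ^ (n - Suc 0)) * exp (- (1 / t))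
        + exp (- (1 / t)) * - (- ((1 / t)\<^sup>2)) * (1 / t) ^ n) (at t)"
      by (intro DERIV_mult DERIV_power DERIV_fun_exp DERIV_minus inv)
    moreover have "real n * (- (y\<^sup>2) * y ^ (n - Suc 0)) * E + E * - (- (y\<^sup>2)) * y ^ n
        = y ^ (n + 2) * E - real n * (y ^ (n + 1) * E)" for y E :: real
      by (cases n) (simp_all add: power2_eq_square algebra_simps)
    ultimately have "((\<lambda>t. (1 / t) ^ n * exp (- (1 / t))) has_field_derivative
        (1 / t) ^ (n + 2) * exp (- (1 / t)) - real n * ((1 / t) ^ (n + 1) * exp (- (1 / t)))) (at t)"
      by (simp only:)
    then have "(flat n has_field_derivative (flat (n + 2) t - real n * flat (n + 1) t)) (at t)"
      using 1 by (rule_tac DERIV_cong_ev[THEN iffD1, rotated 3])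
       (auto simp: flat_def intro!: eventually_nhds_in_open[of "{0<..}", THEN eventually_mono])
    then show ?thesis
      unfolding has_field_derivative_def by (rule has_derivative_eq_rhs) (simp add: mult.commute fun_eq_iff)
  next
    case 2
    have "((\<lambda>t. 0) has_derivative (\<lambda>h. h * (flat (n + 2) t - real n * flat (n + 1) t))) (at t)"
      using 2 by (simp add: flat_def)
    then show ?thesis
      by (rule has_derivative_transform_within_open[of _ _ _ _ "{..<0}"]) (use 2 in \<open>auto simp: flat_def\<close>)
  next
    case 3
    have "((\<lambda>h. flat n h / h) \<longlongrightarrow> 0) (at 0)"
    proof (rule Lim_null_comparison)
      show "\<forall>\<^sub>F h in at 0. norm (flat n h / h) \<le> fact (n + 2) * \<bar>h\<bar>"
      proof (rule eventuallyI)
        fix h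
        show "norm (flat n h / h) \<le> fact (n + 2) * \<bar>h\<bar>"
          using flat_le[of n h] by (cases "h = 0") (auto simp: abs_divide divide_le_eq power2_eq_square mult.assoc)
      qed
      show "((\<lambda>h. fact (n + 2) * \<bar>h\<bar>) \<longlongrightarrow> (0::real)) (at 0)"
        by (auto intro!: tendsto_eq_intros)
    qed
    then have "(flat n has_field_derivative 0) (at 0)"
      unfolding DERIV_def by (simp add: flat_def)
    then show ?thesis unfolding has_field_derivative_def using 3
      by (auto simp: flat_def elim!: has_derivative_eq_rhs)
  qed
qed

lemma Ck_on_flat: "Ck_on k (flat n) UNIV"
proof (induction k arbitrary: n)
  case 0
  then show ?case
    using has_derivative_continuous[OF has_derivative_flat] by (auto intro!: continuous_at_imp_continuous_on)
next
  case (Suc k)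
  have "Ck_on k (\<lambda>t. h * (flat (n + 2) t + (- real n) * flat (n + 1) t)) UNIV" for h
    by (intro Ck_on_mult Ck_on_add Ck_on_const Suc.IH open_UNIV)
  then show ?case
    by (intro Ck_on_SucI[OF open_UNIV has_derivative_flat]) (auto simp: algebra_simps)
qed

text \<open>The squared distance is polynomial, hence smooth at the centre as well.\<close>

definition bump :: "'a::euclidean_space \<Rightarrow> real \<Rightarrow> 'a \<Rightarrow> real" where
  "bump x0 r x = flat 0 (r\<^sup>2 - (x - x0) \<bullet> (x - x0))"

lemma bump_pos_iff: "0 < r \<Longrightarrow> 0 < bump x0 r x \<longleftrightarrow> x \<in> ball x0 r"
proof -
  assume "0 < r"
  have "(x - x0) \<bullet> (x - x0) < r\<^sup>2 \<longleftrightarrow> norm (x - x0) < r"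
    unfolding power2_norm_eq_inner[symmetric] using \<open>0 < r\<close>
    by (metis less_eq_real_def norm_ge_zero power2_less_imp_less power_strict_mono zero_less_numeral)
  then show ?thesis by (simp add: bump_def flat_def dist_norm norm_minus_commute)
qed

lemma bump_nonneg: "0 \<le> bump x0 r x"
  by (simp add: bump_def flat_def)

lemma Ck_on_inner_self: "Ck_on k (\<lambda>x::'a::euclidean_space. (x - x0) \<bullet> (x - x0)) UNIV"
proof -
  have "Ck_on k (\<lambda>x. \<Sum>b\<in>Basis. (x \<bullet> b + - (x0 \<bullet> b)) * (x \<bullet> b + - (x0 \<bullet> b))) UNIV"
    by (intro Ck_on_sum Ck_on_mult Ck_on_add Ck_on_const Ck_on_bounded_linear bounded_linear_inner_left open_UNIV)
  then show ?thesis
    by (subst euclidean_inner) (simp add: inner_diff_left)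
qed

lemma Ck_on_bump: "Ck_on k (bump x0 r) UNIV"
proof -
  have "Ck_on k (\<lambda>x. r\<^sup>2 + -1 * ((x - x0) \<bullet> (x - x0))) UNIV"
    by (intro Ck_on_add Ck_on_mult Ck_on_const Ck_on_inner_self open_UNIV)
  from Ck_on_compose[OF open_UNIV open_UNIV Ck_on_flat this] show ?thesis
    by (simp add: bump_def[abs_def])
qed

section \<open>Smooth maps on subsets of a half-space\<close>

lemma smooth_onI:
  "(\<And>x. x \<in> S \<Longrightarrow> \<exists>W h. open W \<and> x \<in> W \<and> (\<forall>k. Ck_on k h W) \<and> (\<forall>y\<in>S \<inter> W. h y = f y)) \<Longrightarrow> smooth_on f S"
  by (simp add: smooth_on_def)

lemma smooth_onE:
  assumes "smooth_on f S" "x \<in> S"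
  obtains W h where "open W" "x \<in> W" "\<And>k. Ck_on k h W" "\<And>y. y \<in> S \<Longrightarrow> y \<in> W \<Longrightarrow> h y = f y"
proof -
  from assms have "\<exists>W h. open W \<and> x \<in> W \<and> (\<forall>k. Ck_on k h W) \<and> (\<forall>y\<in>S \<inter> W. h y = f y)"
    by (simp add: smooth_on_def)
  then obtain W h where "open W \<and> x \<in> W \<and> (\<forall>k. Ck_on k h W) \<and> (\<forall>y\<in>S \<inter> W. h y = f y)"
    by (elim exE)
  then show thesis by (intro that[of W h]) simp_all
qed

lemma smooth_on_subset:
  assumes "smooth_on f S" "T \<subseteq> S"
  shows "smooth_on f T"
proof (rule smooth_onI)
  fix x assume "x \<in> T"
  with assms obtain W h where "open W" "x \<in> W" "\<And>k. Ck_on k h W" "\<And>y. y \<in> S \<Longrightarrow> y \<in> W \<Longrightarrow> h y = f y"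
    using smooth_onE[OF assms(1), of x] by (metis subsetD)
  with assms(2) show "\<exists>W h. open W \<and> x \<in> W \<and> (\<forall>k. Ck_on k h W) \<and> (\<forall>y\<in>T \<inter> W. h y = f y)"
    by (intro exI[of _ W] exI[of _ h]) auto
qed

lemma smooth_on_cong:
  assumes "smooth_on f S" "\<And>x. x \<in> S \<Longrightarrow> f x = g x"
  shows "smooth_on g S"
  using assms by (simp add: smooth_on_def)

lemma smooth_on_locally:
  assumes "\<And>x. x \<in> S \<Longrightarrow> \<exists>U. open U \<and> x \<in> U \<and> smooth_on f (S \<inter> U)"
  shows "smooth_on f S"
proof (rule smooth_onI)
  fix x assume "x \<in> S"
  with assms obtain U where U: "open U" "x \<in> U" "smooth_on f (S \<inter> U)" by blast
  then obtain W h where "open W" "x \<in> W" "\<And>k. Ck_on k h W" "\<And>y. y \<in> S \<inter> U \<Longrightarrow> y \<in> W \<Longrightarrow> h y = f y"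
    using \<open>x \<in> S\<close> by (elim smooth_onE[of f "S \<inter> U" x]) auto
  with U show "\<exists>W h. open W \<and> x \<in> W \<and> (\<forall>k. Ck_on k h W) \<and> (\<forall>y\<in>S \<inter> W. h y = f y)"
    by (intro exI[of _ "W \<inter> U"] exI[of _ h]) (auto intro: Ck_on_subset)
qed

lemma smooth_on_of_Ck: "open W \<Longrightarrow> (\<And>k. Ck_on k f W) \<Longrightarrow> S \<subseteq> W \<Longrightarrow> smooth_on f S"
  by (rule smooth_onI) blast

lemma smooth_on_const: "smooth_on (\<lambda>x. a) S"
  by (rule smooth_on_of_Ck[of UNIV]) (auto intro: Ck_on_const)

lemma smooth_on_bounded_linear: "bounded_linear l \<Longrightarrow> smooth_on l S"
  by (rule smooth_on_of_Ck[of UNIV]) (auto intro: Ck_on_bounded_linear)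

lemma smooth_on_linear_comp:
  assumes "bounded_linear l" "smooth_on f S"
  shows "smooth_on (\<lambda>x. l (f x)) S"
proof (rule smooth_onI)
  fix x assume "x \<in> S"
  then obtain W h where "open W" "x \<in> W" "\<And>k. Ck_on k h W" "\<And>y. y \<in> S \<Longrightarrow> y \<in> W \<Longrightarrow> h y = f y"
    using smooth_onE[OF assms(2)] by blast
  then show "\<exists>W h. open W \<and> x \<in> W \<and> (\<forall>k. Ck_on k h W) \<and> (\<forall>y\<in>S \<inter> W. h y = l (f y))"
    by (intro exI[of _ W] exI[of _ "\<lambda>x. l (h x)"]) (auto intro: Ck_on_linear_comp assms(1))
qed

lemma smooth_on_binop:
  fixes f :: "'a::euclidean_space \<Rightarrow> 'b::real_normed_vector" and g :: "'a \<Rightarrow> 'c::real_normed_vector"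
    and F :: "'b \<Rightarrow> 'c \<Rightarrow> 'd::real_normed_vector"
  assumes "smooth_on f S" "smooth_on g S"
    and op: "\<And>W k (u :: 'a \<Rightarrow> 'b) (v :: 'a \<Rightarrow> 'c). open W \<Longrightarrow> Ck_on k u W \<Longrightarrow> Ck_on k v W \<Longrightarrow> Ck_on k (\<lambda>x. F (u x) (v x)) W"
  shows "smooth_on (\<lambda>x. F (f x) (g x)) S"
proof (rule smooth_onI)
  fix x assume "x \<in> S"
  obtain W h where W: "open W" "x \<in> W" "\<And>k. Ck_on k h W" "\<And>y. y \<in> S \<Longrightarrow> y \<in> W \<Longrightarrow> h y = f y"
    using smooth_onE[OF assms(1) \<open>x \<in> S\<close>] by blast
  obtain W' h' where W': "open W'" "x \<in> W'" "\<And>k. Ck_on k h' W'" "\<And>y. y \<in> S \<Longrightarrow> y \<in> W' \<Longrightarrow> h' y = g y"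
    using smooth_onE[OF assms(2) \<open>x \<in> S\<close>] by blast
  have "Ck_on k (\<lambda>x. F (h x) (h' x)) (W \<inter> W')" for k
    by (rule op[of "W \<inter> W'" k h h']) (use W W' in \<open>auto intro: Ck_on_subset\<close>)
  with W W' show "\<exists>W h. open W \<and> x \<in> W \<and> (\<forall>k. Ck_on k h W) \<and> (\<forall>y\<in>S \<inter> W. h y = F (f y) (g y))"
    by (intro exI[of _ "W \<inter> W'"] exI[of _ "\<lambda>x. F (h x) (h' x)"]) auto
qed

lemma smooth_on_add: "smooth_on f S \<Longrightarrow> smooth_on g S \<Longrightarrow> smooth_on (\<lambda>x. f x + g x) S"
  by (rule smooth_on_binop) (auto intro: Ck_on_add)

lemma smooth_on_mult:
  fixes f :: "_ \<Rightarrow> real"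
  shows "smooth_on f S \<Longrightarrow> smooth_on g S \<Longrightarrow> smooth_on (\<lambda>x. f x * g x) S"
  by (rule smooth_on_binop) (auto intro: Ck_on_mult)

lemma smooth_on_inverse:
  fixes f :: "_ \<Rightarrow> real"
  assumes "smooth_on f S" "\<And>x. x \<in> S \<Longrightarrow> f x \<noteq> 0"
  shows "smooth_on (\<lambda>x. inverse (f x)) S"
proof (rule smooth_onI)
  fix x assume x: "x \<in> S"
  obtain W h where W: "open W" "x \<in> W" "\<And>k. Ck_on k h W" "\<And>y. y \<in> S \<Longrightarrow> y \<in> W \<Longrightarrow> h y = f y"
    using smooth_onE[OF assms(1) x] by blast
  define W' where "W' = W \<inter> h -` (- {0})"
  have W': "open W'" "x \<in> W'"
    using W x assms(2) Ck_on_continuous[OF W(3)] continuous_open_preimage[of W h "- {0}"] by (auto simp: W'_def)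
  have "Ck_on k (\<lambda>x. inverse (h x)) W'" for k
    by (rule Ck_on_inverse) (use W' W in \<open>auto simp: W'_def intro: Ck_on_subset\<close>)
  with W W' show "\<exists>W h. open W \<and> x \<in> W \<and> (\<forall>k. Ck_on k h W) \<and> (\<forall>y\<in>S \<inter> W. h y = inverse (f y))"
    by (intro exI[of _ W'] exI[of _ "\<lambda>x. inverse (h x)"]) (auto simp: W'_def)
qed

lemma smooth_on_compose:
  fixes F :: "'a::euclidean_space \<Rightarrow> 'b::euclidean_space"
  assumes "smooth_on f T" "smooth_on F S" "F ` S \<subseteq> T"
  shows "smooth_on (\<lambda>x. f (F x)) S"
proof (rule smooth_onI)
  fix x assume x: "x \<in> S"
  obtain W H where W: "open W" "x \<in> W" "\<And>k. Ck_on k H W" "\<And>y. y \<in> S \<Longrightarrow> y \<in> W \<Longrightarrow> H y = F y"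
    using smooth_onE[OF assms(2) x] by blast
  have "F x \<in> T" using x assms(3) by blast
  then obtain W' h where W': "open W'" "F x \<in> W'" "\<And>k. Ck_on k h W'" "\<And>y. y \<in> T \<Longrightarrow> y \<in> W' \<Longrightarrow> h y = f y"
    using smooth_onE[OF assms(1)] by blast
  define V where "V = W \<inter> H -` W'"
  have V: "open V" "x \<in> V"
    using W W' x Ck_on_continuous[OF W(3)] continuous_open_preimage[of W H W'] by (auto simp: V_def)
  have "Ck_on k (\<lambda>x. h (H x)) V" for k
    by (rule Ck_on_compose[OF V(1) W'(1) W'(3)]) (use W in \<open>auto simp: V_def intro: Ck_on_subset\<close>)
  with W W' V assms(3) show "\<exists>W h. open W \<and> x \<in> W \<and> (\<forall>k. Ck_on k h W) \<and> (\<forall>y\<in>S \<inter> W. h y = f (F y))"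
    by (intro exI[of _ V] exI[of _ "\<lambda>x. h (H x)"]) (auto simp: V_def)
qed

lemma smooth_on_differentiable:
  assumes "smooth_on f S" "x \<in> S"
  shows "f differentiable (at x within S)"
proof -
  obtain W h where W: "open W" "x \<in> W" "\<And>k. Ck_on k h W" "\<And>y. y \<in> S \<Longrightarrow> y \<in> W \<Longrightarrow> h y = f y"
    using smooth_onE[OF assms] by blast
  have "(h has_derivative frechet_derivative h (at x)) (at x within S)"
    using Ck_on_Suc_has_derivative[OF W(3) W(2)] has_derivative_at_withinI by blast
  then have "(f has_derivative frechet_derivative h (at x)) (at x within S)"
    by (rule has_derivative_transform_eventually)
      (use W assms(2) in \<open>auto simp: eventually_at_topological\<close>)
  then show ?thesis by (auto simp: differentiable_def)
qed

lemma smooth_on_continuous: "smooth_on f S \<Longrightarrow> continuous_on S f"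
  using smooth_on_differentiable differentiable_imp_continuous_within continuous_on_eq_continuous_within by blast

section \<open>One-sided derivatives on relatively open subsets of the half-space\<close>

abbreviation hs_open :: "(real ^ 'm::finite) set \<Rightarrow> bool" where
  "hs_open S \<equiv> openin (top_of_set half_space) S"

definition normal_dir :: "real ^ 'm::finite" where
  "normal_dir = axis bdry_index 1"

lemma hs_open_ball:
  assumes "hs_open S" "x \<in> S"
  obtains r where "0 < r" "\<And>y. y \<in> ball x r \<Longrightarrow> 0 \<le> y $ bdry_index \<Longrightarrow> y \<in> S"
  using assms unfolding openin_contains_ball half_space_def by blast

lemma hs_openD: "hs_open S \<Longrightarrow> x \<in> S \<Longrightarrow> 0 \<le> x $ bdry_index"
  using openin_subset[of "top_of_set half_space" S] by (auto simp: half_space_def)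

text \<open>Basis vectors point into the half-space or along its boundary. Even at a boundary point,
  short positive steps in every basis direction stay in S, and these determine the
  derivative.\<close>

lemma hs_open_frechet_derivative_unique:
  assumes S: "hs_open S" "x \<in> S"
    and f': "(f has_derivative f') (at x within S)"
  shows "frechet_derivative f (at x within S) = f'"
proof (rule frechet_derivative_unique_within[OF _ f'])
  show "(f has_derivative frechet_derivative f (at x within S)) (at x within S)"
    using f' frechet_derivative_works differentiable_def by blast
  fix i :: "real ^ 'a" and e :: real
  assume i: "i \<in> Basis" and e: "0 < e"
  obtain r where r: "0 < r" "\<And>y. y \<in> ball x r \<Longrightarrow> 0 \<le> y $ bdry_index \<Longrightarrow> y \<in> S"
    using hs_open_ball[OF S] by blast
  let ?d = "min (e / 2) (r / 2)"
  have "0 \<le> i $ bdry_index" using i by (auto simp: Basis_vec_def axis_def)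
  then have "0 \<le> (x + ?d *\<^sub>R i) $ bdry_index"
    using hs_openD[OF S] e r by simp
  moreover have "x + ?d *\<^sub>R i \<in> ball x r" using i e r by (simp add: dist_norm)
  ultimately show "\<exists>d. 0 < \<bar>d\<bar> \<and> \<bar>d\<bar> < e \<and> x + d *\<^sub>R i \<in> S"
    using r e by (intro exI[of _ ?d]) auto
qed

text \<open>By uniqueness any smooth extension computes the one-sided derivative. In this way facts
  about open sets, such as the symmetry of second derivatives, pass to the half-space.\<close>

lemma hs_open_frechet_derivative_eq_extension:
  assumes S: "hs_open S" "x \<in> S" and W: "open W" "x \<in> W" "Ck_on (Suc k) h W" "\<And>y. y \<in> S \<Longrightarrow> y \<in> W \<Longrightarrow> h y = f y"
  shows "frechet_derivative f (at x within S) = frechet_derivative h (at x)"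
proof (rule hs_open_frechet_derivative_unique[OF S])
  have "(h has_derivative frechet_derivative h (at x)) (at x within S)"
    using Ck_on_Suc_has_derivative[OF W(3) W(2)] has_derivative_at_withinI by blast
  then show "(f has_derivative frechet_derivative h (at x)) (at x within S)"
    by (rule has_derivative_transform_eventually)
      (use W S(2) in \<open>auto simp: eventually_at_topological\<close>)
qed

lemma smooth_on_frechet_derivative:
  assumes S: "hs_open S" and f: "smooth_on f S"
  shows "smooth_on (\<lambda>x. frechet_derivative f (at x within S) v) S"
proof (rule smooth_onI)
  fix x assume x: "x \<in> S"
  obtain W h where W: "open W" "x \<in> W" "\<And>k. Ck_on k h W" "\<And>y. y \<in> S \<Longrightarrow> y \<in> W \<Longrightarrow> h y = f y"
    using smooth_onE[OF f x] by blast
  have "frechet_derivative h (at y) v = frechet_derivative f (at y within S) v" if "y \<in> S \<inter> W" for y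
    using hs_open_frechet_derivative_eq_extension[OF S _ W(1) _ W(3) W(4)] that by auto
  moreover have "Ck_on k (\<lambda>x. frechet_derivative h (at x) v) W" for k
    using W(3)[of "Suc k"] by simp
  ultimately show "\<exists>W h. open W \<and> x \<in> W \<and> (\<forall>k. Ck_on k h W) \<and> (\<forall>y\<in>S \<inter> W. h y = frechet_derivative f (at y within S) v)"
    using W(1,2) by (intro exI[of _ W] exI[of _ "\<lambda>x. frechet_derivative h (at x) v"]) simp
qed

lemma hs_open_symmetric_second_derivative:
  fixes f :: "real ^ 'm::finite \<Rightarrow> real"
  assumes S: "hs_open S" "x \<in> S" and f: "smooth_on f S"
  shows "frechet_derivative (\<lambda>y. frechet_derivative f (at y within S) v) (at x within S) w =
         frechet_derivative (\<lambda>y. frechet_derivative f (at y within S) w) (at x within S) v"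
proof -
  obtain W h where W: "open W" "x \<in> W" "\<And>k. Ck_on k h W" "\<And>y. y \<in> S \<Longrightarrow> y \<in> W \<Longrightarrow> h y = f y"
    using smooth_onE[OF f S(2)] by blast
  have eq: "frechet_derivative h (at y) v = frechet_derivative f (at y within S) v" if "y \<in> S" "y \<in> W" for y v
    using hs_open_frechet_derivative_eq_extension[OF S(1) _ W(1) _ W(3) W(4)] that by auto
  have "Ck_on (Suc 0) (\<lambda>x. frechet_derivative h (at x) v) W" for v
    using W(3)[of "Suc (Suc 0)"] unfolding Ck_on.simps(2)[of "Suc 0"] by blast
  then have "frechet_derivative (\<lambda>y. frechet_derivative f (at y within S) v) (at x within S) =
      frechet_derivative (\<lambda>y. frechet_derivative h (at y) v) (at x)" for v
    by (rule hs_open_frechet_derivative_eq_extension[OF S W(1,2)]) (simp add: eq)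
  then show ?thesis using symmetric_second_derivative[OF W(1,2) W(3)] by simp
qed

text \<open>Near a common point both sets coincide with the half-space, so the derivative depends
  only on the germ. This compares a chart with its restriction to a smaller domain.\<close>

lemma frechet_derivative_within_local:
  assumes S: "hs_open S" "hs_open T" "x \<in> S" "x \<in> T"
    and eq: "\<And>y. y \<in> S \<Longrightarrow> y \<in> T \<Longrightarrow> f y = g y"
    and f: "f differentiable (at x within S)"
  shows "(g has_derivative frechet_derivative f (at x within S)) (at x within T)"
    and "frechet_derivative g (at x within T) = frechet_derivative f (at x within S)"
proof -
  obtain r where r: "0 < r" "\<And>y. y \<in> ball x r \<Longrightarrow> 0 \<le> y $ bdry_index \<Longrightarrow> y \<in> S"
    using hs_open_ball[OF S(1,3)] by blast
  have sub: "T \<inter> ball x r \<subseteq> S" using r hs_openD[OF S(2)] by auto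
  have "(f has_derivative frechet_derivative f (at x within S)) (at x within T \<inter> ball x r)"
    using f frechet_derivative_works has_derivative_subset[OF _ sub] by blast
  then have "(g has_derivative frechet_derivative f (at x within S)) (at x within T \<inter> ball x r)"
    by (rule has_derivative_transform[rotated 2]) (use S sub r eq in auto)
  then show *: "(g has_derivative frechet_derivative f (at x within S)) (at x within T)"
    using at_within_nhd[of x "ball x r" "T \<inter> ball x r" T] r(1) by auto
  show "frechet_derivative g (at x within T) = frechet_derivative f (at x within S)"
    by (rule hs_open_frechet_derivative_unique[OF S(2,4) *])
qed

section \<open>Calculus in a chart\<close>

text \<open>The calculus in a chart rests on these two properties. Unlike membership in the atlas
  they are inherited by restrictions to smaller open domains.\<close>

definition good_chart :: "('a, 'm::finite) chart \<Rightarrow> bool" where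
  "good_chart c \<longleftrightarrow> inj_on (snd c) (fst c) \<and> hs_open (coord_image c)"

lemma coord_rep_apply [simp]: "good_chart c \<Longrightarrow> p \<in> fst c \<Longrightarrow> coord_rep c f (snd c p) = f p"
  by (simp add: good_chart_def coord_rep_def)

lemma coord_imageI: "p \<in> fst c \<Longrightarrow> snd c p \<in> coord_image c"
  by (simp add: coord_image_def)

lemma coord_rep_cong: "(\<And>p. p \<in> fst c \<Longrightarrow> f p = g p) \<Longrightarrow> x \<in> coord_image c \<Longrightarrow> coord_rep c f x = coord_rep c g x"
  by (simp add: coord_rep_def coord_image_def inv_into_into)

lemma coord_imageE:
  assumes "x \<in> coord_image c"
  obtains p where "p \<in> fst c" "x = snd c p"
  using assms by (auto simp: coord_image_def)

lemma coord_rep_compose: "coord_rep c (\<lambda>p. F (f p)) = (\<lambda>x. F (coord_rep c f x))"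
  by (simp add: coord_rep_def o_def)

lemma smooth_in_chart_cong:
  assumes "smooth_in_chart c f" "\<And>p. p \<in> fst c \<Longrightarrow> f p = g p"
  shows "smooth_in_chart c g"
  using assms(1) unfolding smooth_in_chart_def
  by (rule smooth_on_cong) (rule coord_rep_cong[OF assms(2)])

lemma smooth_in_chart_const: "smooth_in_chart c (\<lambda>p. a)"
  by (simp add: smooth_in_chart_def coord_rep_def o_def smooth_on_const)

lemma smooth_in_chart_add: "smooth_in_chart c f \<Longrightarrow> smooth_in_chart c g \<Longrightarrow> smooth_in_chart c (\<lambda>p. f p + g p)"
  by (simp add: smooth_in_chart_def coord_rep_def o_def smooth_on_add)

lemma smooth_in_chart_mult:
  fixes f :: "_ \<Rightarrow> real"
  shows "smooth_in_chart c f \<Longrightarrow> smooth_in_chart c g \<Longrightarrow> smooth_in_chart c (\<lambda>p. f p * g p)"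
  by (simp add: smooth_in_chart_def coord_rep_def o_def smooth_on_mult)

lemma smooth_in_chart_uminus:
  fixes f :: "_ \<Rightarrow> real"
  shows "smooth_in_chart c f \<Longrightarrow> smooth_in_chart c (\<lambda>p. - f p)"
  using smooth_in_chart_mult[OF smooth_in_chart_const[of c "-1"]] by simp

lemma smooth_in_chart_diff:
  fixes f :: "_ \<Rightarrow> real"
  shows "smooth_in_chart c f \<Longrightarrow> smooth_in_chart c g \<Longrightarrow> smooth_in_chart c (\<lambda>p. f p - g p)"
  using smooth_in_chart_add[OF _ smooth_in_chart_uminus] by simp

lemma smooth_in_chart_sum:
  "(\<And>i. i \<in> I \<Longrightarrow> smooth_in_chart c (f i)) \<Longrightarrow> smooth_in_chart c (\<lambda>p. \<Sum>i\<in>I. f i p)"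
  by (induction I rule: infinite_finite_induct) (auto intro: smooth_in_chart_const smooth_in_chart_add)

lemma smooth_in_chart_prod:
  fixes f :: "_ \<Rightarrow> _ \<Rightarrow> real"
  shows "(\<And>i. i \<in> I \<Longrightarrow> smooth_in_chart c (f i)) \<Longrightarrow> smooth_in_chart c (\<lambda>p. \<Prod>i\<in>I. f i p)"
  by (induction I rule: infinite_finite_induct) (auto intro: smooth_in_chart_const smooth_in_chart_mult)

lemma smooth_in_chart_divide:
  fixes f :: "_ \<Rightarrow> real"
  assumes "smooth_in_chart c f" "smooth_in_chart c g" "\<And>p. p \<in> fst c \<Longrightarrow> g p \<noteq> 0"
  shows "smooth_in_chart c (\<lambda>p. f p / g p)"
proof -
  have "coord_rep c g x \<noteq> 0" if "x \<in> coord_image c" for x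
    using assms(3) that by (auto simp: coord_rep_def coord_image_def inv_into_into)
  then have "smooth_on (\<lambda>x. coord_rep c f x * inverse (coord_rep c g x)) (coord_image c)"
    using assms unfolding smooth_in_chart_def by (intro smooth_on_mult smooth_on_inverse)
  then show ?thesis by (simp add: smooth_in_chart_def coord_rep_def o_def divide_inverse)
qed

lemma smooth_in_chart_linear_comp:
  "bounded_linear l \<Longrightarrow> smooth_in_chart c f \<Longrightarrow> smooth_in_chart c (\<lambda>p. l (f p))"
  unfolding smooth_in_chart_def coord_rep_def o_def by (rule smooth_on_linear_comp)

lemma chart_deriv_has_derivative:
  assumes "smooth_in_chart c f" "p \<in> fst c"
  shows "(coord_rep c f has_derivative chart_deriv c f p) (at (snd c p) within coord_image c)"
  using smooth_on_differentiable[OF assms(1)[unfolded smooth_in_chart_def] coord_imageI[OF assms(2)]]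
  by (simp add: frechet_derivative_works chart_deriv_def[abs_def])

lemma chart_deriv_unique:
  assumes "good_chart c" "p \<in> fst c" "(coord_rep c f has_derivative f') (at (snd c p) within coord_image c)"
  shows "chart_deriv c f p = f'"
  using hs_open_frechet_derivative_unique[OF _ coord_imageI assms(3)] assms(1,2)
  by (simp add: good_chart_def chart_deriv_def[abs_def])

lemma chart_deriv_linear: "smooth_in_chart c f \<Longrightarrow> p \<in> fst c \<Longrightarrow> linear (chart_deriv c f p)"
  by (rule has_derivative_linear[OF chart_deriv_has_derivative])

lemma chart_deriv_const: "good_chart c \<Longrightarrow> p \<in> fst c \<Longrightarrow> chart_deriv c (\<lambda>q. a) p v = 0"
  by (subst chart_deriv_unique[where f'="\<lambda>_. 0"]) (auto simp: coord_rep_def o_def)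

lemma chart_deriv_add:
  assumes "good_chart c" "p \<in> fst c" "smooth_in_chart c f" "smooth_in_chart c g"
  shows "chart_deriv c (\<lambda>q. f q + g q) p v = chart_deriv c f p v + chart_deriv c g p v"
  using chart_deriv_unique[OF assms(1,2), of "\<lambda>q. f q + g q"]
    has_derivative_add[OF chart_deriv_has_derivative[OF assms(3,2)] chart_deriv_has_derivative[OF assms(4,2)]]
  by (simp add: coord_rep_def o_def)

lemma chart_deriv_mult:
  fixes f :: "_ \<Rightarrow> real"
  assumes "good_chart c" "p \<in> fst c" "smooth_in_chart c f" "smooth_in_chart c g"
  shows "chart_deriv c (\<lambda>q. f q * g q) p v = f p * chart_deriv c g p v + chart_deriv c f p v * g p"
  using chart_deriv_unique[OF assms(1,2), of "\<lambda>q. f q * g q"]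
    has_derivative_mult[OF chart_deriv_has_derivative[OF assms(3,2)] chart_deriv_has_derivative[OF assms(4,2)]]
    coord_rep_apply[OF assms(1,2), of f] coord_rep_apply[OF assms(1,2), of g]
  by (simp add: coord_rep_def o_def)

lemma chart_deriv_cmult:
  fixes f :: "_ \<Rightarrow> real"
  assumes "good_chart c" "p \<in> fst c" "smooth_in_chart c f"
  shows "chart_deriv c (\<lambda>q. a * f q) p v = a * chart_deriv c f p v"
  using chart_deriv_mult[OF assms(1,2) smooth_in_chart_const assms(3), of a v] chart_deriv_const[OF assms(1,2), of a v] by simp

lemma chart_deriv_sum:
  fixes f :: "_ \<Rightarrow> _ \<Rightarrow> real"
  assumes "good_chart c" "p \<in> fst c" "\<And>i. i \<in> I \<Longrightarrow> smooth_in_chart c (f i)"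
  shows "chart_deriv c (\<lambda>q. \<Sum>i\<in>I. f i q) p v = (\<Sum>i\<in>I. chart_deriv c (f i) p v)"
  using assms(3)
  by (induction I rule: infinite_finite_induct)
    (auto simp: chart_deriv_const chart_deriv_add smooth_in_chart_sum assms(1,2))

lemma chart_deriv_linear_comp:
  assumes "good_chart c" "p \<in> fst c" "smooth_in_chart c f" "bounded_linear l"
  shows "chart_deriv c (\<lambda>q. l (f q)) p v = l (chart_deriv c f p v)"
  using chart_deriv_unique[OF assms(1,2), of "\<lambda>q. l (f q)"]
    bounded_linear.has_derivative[OF assms(4) chart_deriv_has_derivative[OF assms(3,2)]]
  by (simp add: coord_rep_def o_def)

lemma chart_deriv_cong:
  assumes "\<And>q. q \<in> fst c \<Longrightarrow> f q = g q" "p \<in> fst c"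
  shows "chart_deriv c f p v = chart_deriv c g p v"
proof -
  have "(coord_rep c f has_derivative f') (at (snd c p) within coord_image c) \<longleftrightarrow>
    (coord_rep c g has_derivative f') (at (snd c p) within coord_image c)" for f'
    using coord_rep_cong[of c f g, OF assms(1)] coord_imageI[OF assms(2)]
    by (metis has_derivative_transform)
  then show ?thesis by (simp add: chart_deriv_def frechet_derivative_def)
qed

lemma smooth_in_chart_deriv:
  assumes "good_chart c" "smooth_in_chart c f"
  shows "smooth_in_chart c (\<lambda>p. chart_deriv c f p v)"
  unfolding smooth_in_chart_def
proof (rule smooth_on_cong)
  show "smooth_on (\<lambda>x. frechet_derivative (coord_rep c f) (at x within coord_image c) v) (coord_image c)"
    using assms by (intro smooth_on_frechet_derivative) (auto simp: good_chart_def smooth_in_chart_def)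
  show "frechet_derivative (coord_rep c f) (at x within coord_image c) v = coord_rep c (\<lambda>p. chart_deriv c f p v) x"
    if "x \<in> coord_image c" for x
    using that assms(1) by (auto elim!: coord_imageE simp: chart_deriv_def)
qed

lemma chart_deriv_commute:
  fixes f :: "_ \<Rightarrow> real"
  assumes c: "good_chart c" "p \<in> fst c" and f: "smooth_in_chart c f"
  shows "chart_deriv c (\<lambda>q. chart_deriv c f q v) p w = chart_deriv c (\<lambda>q. chart_deriv c f q w) p v"
proof -
  let ?S = "coord_image c"
  have "chart_deriv c (\<lambda>q. chart_deriv c f q v) p w =
      frechet_derivative (\<lambda>x. frechet_derivative (coord_rep c f) (at x within ?S) v) (at (snd c p) within ?S) w" for v w
  proof -
    have "((\<lambda>x. frechet_derivative (coord_rep c f) (at x within ?S) v) has_derivative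
        frechet_derivative (\<lambda>x. frechet_derivative (coord_rep c f) (at x within ?S) v) (at (snd c p) within ?S)) (at (snd c p) within ?S)"
      unfolding frechet_derivative_works[symmetric]
      by (intro smooth_on_differentiable[OF smooth_on_frechet_derivative] coord_imageI)
        (use c f in \<open>auto simp: good_chart_def smooth_in_chart_def\<close>)
    then have "(coord_rep c (\<lambda>q. chart_deriv c f q v) has_derivative
        frechet_derivative (\<lambda>x. frechet_derivative (coord_rep c f) (at x within ?S) v) (at (snd c p) within ?S)) (at (snd c p) within ?S)"
      by (rule has_derivative_transform[rotated 2]) (use c in \<open>auto elim!: coord_imageE simp: chart_deriv_def coord_imageI\<close>)
    from chart_deriv_unique[OF c this] show ?thesis by simp
  qed
  then show ?thesis
    using hs_open_symmetric_second_derivative[of ?S "snd c p" "coord_rep c f" v w] c f coord_imageI[OF c(2)]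
    by (simp add: good_chart_def smooth_in_chart_def)
qed

section \<open>Restriction and change of charts\<close>

lemma inv_into_restrict:
  assumes "inj_on f S" "T \<subseteq> S" "x \<in> f ` T"
  shows "inv_into T f x = inv_into S f x"
  using assms by (metis imageE inj_on_subset inv_into_f_f subsetD)

lemma coord_rep_restrict: "good_chart c \<Longrightarrow> U \<subseteq> fst c \<Longrightarrow> x \<in> snd c ` U \<Longrightarrow> coord_rep (U, snd c) f x = coord_rep c f x"
  by (simp add: coord_rep_def good_chart_def inv_into_restrict[of "snd c" "fst c" U x])

lemma good_chart_restrict: "good_chart c \<Longrightarrow> U \<subseteq> fst c \<Longrightarrow> hs_open (snd c ` U) \<Longrightarrow> good_chart (U, snd c)"
  by (auto simp: good_chart_def coord_image_def intro: inj_on_subset)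

lemma smooth_in_chart_restrict:
  assumes "good_chart c" "U \<subseteq> fst c" "smooth_in_chart c f"
  shows "smooth_in_chart (U, snd c) f"
proof -
  have "smooth_on (coord_rep c f) (snd c ` U)"
    using smooth_on_subset[OF assms(3)[unfolded smooth_in_chart_def], of "snd c ` U"] assms(2)
    by (auto simp: coord_image_def)
  then show ?thesis
    unfolding smooth_in_chart_def
    by (rule smooth_on_cong[THEN smooth_on_subset]) (auto simp: coord_image_def coord_rep_restrict[OF assms(1,2)])
qed

lemma chart_deriv_restrict:
  assumes c: "good_chart c" "U \<subseteq> fst c" "hs_open (snd c ` U)" and p: "p \<in> U"
    and f: "smooth_in_chart (U, snd c) f" and eq: "\<And>q. q \<in> U \<Longrightarrow> f q = g q"
  shows "chart_deriv c g p = chart_deriv (U, snd c) f p"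
proof -
  have "frechet_derivative (coord_rep c g) (at (snd c p) within coord_image c) =
      frechet_derivative (coord_rep (U, snd c) f) (at (snd c p) within snd c ` U)"
  proof (rule frechet_derivative_within_local(2))
    show "coord_rep (U, snd c) f differentiable at (snd c p) within snd c ` U"
      using smooth_on_differentiable[OF f[unfolded smooth_in_chart_def], of "snd c p"] p by (simp add: coord_image_def)
    show "coord_rep (U, snd c) f y = coord_rep c g y" if "y \<in> snd c ` U" for y
      using that c eq coord_rep_restrict[OF c(1,2) that, of f] by (auto simp: subset_iff)
  qed (use c p in \<open>auto simp: good_chart_def coord_image_def\<close>)
  then show ?thesis by (simp add: chart_deriv_def[abs_def] coord_image_def)
qed

lemma smooth_in_chart_locally:
  assumes c: "good_chart c"
    and loc: "\<And>p. p \<in> fst c \<Longrightarrow> \<exists>U. p \<in> U \<and> U \<subseteq> fst c \<and> hs_open (snd c ` U) \<and> smooth_in_chart (U, snd c) f"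
  shows "smooth_in_chart c f"
  unfolding smooth_in_chart_def
proof (rule smooth_on_locally)
  fix x assume "x \<in> coord_image c"
  then obtain p where p: "p \<in> fst c" "x = snd c p" by (rule coord_imageE)
  then obtain U where U: "p \<in> U" "U \<subseteq> fst c" "hs_open (snd c ` U)" "smooth_in_chart (U, snd c) f"
    using loc by blast
  obtain W where W: "open W" "snd c ` U = half_space \<inter> W"
    using U(3) by (auto simp: openin_open)
  have "coord_image c \<inter> W \<subseteq> snd c ` U"
    using c W(2) hs_openD[of "coord_image c"] by (auto simp: good_chart_def half_space_def)
  then have "smooth_on (coord_rep (U, snd c) f) (coord_image c \<inter> W)"
    using smooth_on_subset U(4) by (auto simp: smooth_in_chart_def coord_image_def)
  then have "smooth_on (coord_rep c f) (coord_image c \<inter> W)"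
    by (rule smooth_on_cong) (use \<open>coord_image c \<inter> W \<subseteq> snd c ` U\<close> coord_rep_restrict[OF c U(2)] in blast)
  moreover have "x \<in> W" using W p U by blast
  ultimately show "\<exists>U. open U \<and> x \<in> U \<and> smooth_on (coord_rep c f) (coord_image c \<inter> U)"
    using W(1) by blast
qed

text \<open>With equal domains the two coordinate representations differ by the transition map
  everywhere, and the chain rule applies on the whole coordinate image. Charts that merely overlap
  are first restricted to this situation.\<close>

lemma chart_change:
  fixes c c' :: "('a, 'm::finite) chart"
  assumes good: "good_chart c" "good_chart c'" "fst c = fst c'"
    and tr: "smooth_in_chart c (snd c')" and f: "smooth_in_chart c' f"
  shows "smooth_in_chart c f"
    and "p \<in> fst c \<Longrightarrow> chart_deriv c f p v = chart_deriv c' f p (chart_deriv c (snd c') p v)"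
proof -
  have img: "coord_rep c (snd c') ` coord_image c \<subseteq> coord_image c'"
    using good by (auto elim!: coord_imageE intro!: coord_imageI)
  have eq: "coord_rep c' f (coord_rep c (snd c') x) = coord_rep c f x" if "x \<in> coord_image c" for x
    using that good by (auto elim!: coord_imageE)
  show "smooth_in_chart c f"
    using smooth_on_cong[OF smooth_on_compose[OF f[unfolded smooth_in_chart_def] tr[unfolded smooth_in_chart_def] img] eq]
    by (simp add: smooth_in_chart_def)
  assume p: "p \<in> fst c"
  have p': "p \<in> fst c'" using p good by simp
  have "coord_rep c (snd c') (snd c p) = snd c' p" using good(1) p by simp
  then have "(coord_rep c' f has_derivative chart_deriv c' f p)
      (at (coord_rep c (snd c') (snd c p)) within coord_rep c (snd c') ` coord_image c)"
    using has_derivative_subset[OF chart_deriv_has_derivative[OF f p'] img] by simp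
  from diff_chain_within[OF chart_deriv_has_derivative[OF tr p] this]
  have "(coord_rep c f has_derivative chart_deriv c' f p \<circ> chart_deriv c (snd c') p) (at (snd c p) within coord_image c)"
    by (rule has_derivative_transform[rotated 2]) (use eq coord_imageI[OF p] in auto)
  from chart_deriv_unique[OF good(1) p this]
  show "chart_deriv c f p v = chart_deriv c' f p (chart_deriv c (snd c') p v)" by simp
qed

lemma chart_deriv_self:
  assumes "good_chart c" "p \<in> fst c"
  shows "chart_deriv c (snd c) p v = v"
proof -
  have "(coord_rep c (snd c) has_derivative (\<lambda>v. v)) (at (snd c p) within coord_image c)"
    by (rule has_derivative_transform[OF _ _ has_derivative_ident])
      (use assms in \<open>auto elim!: coord_imageE intro: coord_imageI\<close>)
  from chart_deriv_unique[OF assms this] show ?thesis by simp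
qed

lemma smooth_in_chart_self: "good_chart c \<Longrightarrow> smooth_in_chart c (snd c)"
  unfolding smooth_in_chart_def
  by (rule smooth_on_cong[OF smooth_on_bounded_linear[OF bounded_linear_ident]]) (auto elim!: coord_imageE)

section \<open>Manifolds with boundary\<close>

locale bordered_manifold =
  fixes X :: "'a topology" and A :: "('a, 'm::finite) chart set"
  assumes manifold: "smooth_manifold_with_boundary X A"
begin

lemma Hausdorff: "Hausdorff_space X"
  and topspace_eq: "topspace X = (\<Union>c\<in>A. fst c)"
  using manifold by (auto simp: smooth_manifold_with_boundary_def)

lemma chart_open: "c \<in> A \<Longrightarrow> openin X (fst c)"
  and chart_image_open: "c \<in> A \<Longrightarrow> hs_open (coord_image c)"
  and chart_homeo: "c \<in> A \<Longrightarrow> homeomorphic_map (subtopology X (fst c)) (top_of_set (coord_image c)) (snd c)"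
  and transition_smooth: "c \<in> A \<Longrightarrow> c' \<in> A \<Longrightarrow> smooth_on (coord_rep c (snd c')) (snd c ` (fst c \<inter> fst c'))"
  using manifold by (auto simp: smooth_manifold_with_boundary_def)

lemma chart_topspace: "c \<in> A \<Longrightarrow> topspace (subtopology X (fst c)) = fst c"
  using openin_subset[OF chart_open] by (simp add: inf.absorb2)

lemma good_chart [simp]: "c \<in> A \<Longrightarrow> good_chart c"
  using chart_image_open homeomorphic_imp_injective_map[OF chart_homeo] chart_topspace
  by (auto simp: good_chart_def)

lemma in_topspace: "c \<in> A \<Longrightarrow> p \<in> fst c \<Longrightarrow> p \<in> topspace X"
  by (auto simp: topspace_eq)

lemma image_of_open:
  assumes "c \<in> A" "openin X V" "V \<subseteq> fst c"
  shows "hs_open (snd c ` V)"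
proof -
  have "openin (subtopology X (fst c)) V"
    using assms openin_subtopology_Int2 by (metis inf.absorb2 openin_subtopology)
  then have "openin (top_of_set (coord_image c)) (snd c ` V)"
    using homeomorphic_imp_open_map[OF chart_homeo[OF assms(1)]] by (simp add: open_map_def)
  then show ?thesis using chart_image_open[OF assms(1)] openin_trans_full by (metis openin_trans)
qed

lemma preimage_of_open:
  assumes "c \<in> A" "open W"
  shows "openin X {p \<in> fst c. snd c p \<in> W}"
proof -
  have "continuous_map (subtopology X (fst c)) euclidean (snd c)"
    using homeomorphic_imp_continuous_map[OF chart_homeo[OF assms(1)]] by (simp add: continuous_map_in_subtopology)
  then have "openin (subtopology X (fst c)) {p \<in> topspace (subtopology X (fst c)). snd c p \<in> W}"
    using assms(2) unfolding continuous_map_def by (auto simp: open_openin[symmetric])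
  then show ?thesis using chart_open[OF assms(1)] chart_topspace[OF assms(1)] by (metis openin_trans_full)
qed

lemma continuous_map_chartwise:
  fixes f :: "'a \<Rightarrow> 'b::real_normed_vector"
  assumes "\<And>c. c \<in> A \<Longrightarrow> smooth_in_chart c f"
  shows "continuous_map X euclidean f"
  unfolding continuous_map_def
proof (intro conjI allI impI)
  fix V :: "'b set" assume "openin euclidean V"
  have "openin X {p \<in> fst c. f p \<in> V}" if c: "c \<in> A" for c
  proof -
    have "continuous_on (coord_image c) (coord_rep c f)"
      using assms[OF c] by (simp add: smooth_in_chart_def smooth_on_continuous)
    then obtain W where W: "open W" "W \<inter> coord_image c = coord_rep c f -` V \<inter> coord_image c"
      using \<open>openin euclidean V\<close> unfolding continuous_on_open_invariant by (metis open_openin)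
    have "{p \<in> fst c. f p \<in> V} = {p \<in> fst c. snd c p \<in> W}"
    proof (rule Collect_cong, rule conj_cong[OF refl])
      fix p assume p: "p \<in> fst c"
      have "snd c p \<in> W \<longleftrightarrow> coord_rep c f (snd c p) \<in> V" using W(2) coord_imageI[OF p] by blast
      then show "f p \<in> V \<longleftrightarrow> snd c p \<in> W" using c p by simp
    qed
    then show ?thesis using preimage_of_open[OF c W(1)] by simp
  qed
  moreover have "{p \<in> topspace X. f p \<in> V} = (\<Union>c\<in>A. {p \<in> fst c. f p \<in> V})"
    by (auto simp: topspace_eq)
  ultimately show "openin X {p \<in> topspace X. f p \<in> V}" by auto
qed auto

section \<open>Overlaps and transition maps\<close>

abbreviation overlap :: "('a, 'm) chart \<Rightarrow> ('a, 'm) chart \<Rightarrow> ('a, 'm) chart" where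
  "overlap c c' \<equiv> (fst c \<inter> fst c', snd c)"

lemma good_overlap [simp]: "c \<in> A \<Longrightarrow> c' \<in> A \<Longrightarrow> good_chart (overlap c c')"
  by (intro good_chart_restrict image_of_open openin_Int chart_open) auto

lemma overlap_open: "c \<in> A \<Longrightarrow> c' \<in> A \<Longrightarrow> hs_open (snd c ` (fst c \<inter> fst c'))"
  by (intro image_of_open openin_Int chart_open) auto

lemma smooth_transition: "c \<in> A \<Longrightarrow> c' \<in> A \<Longrightarrow> smooth_in_chart (overlap c c') (snd c')"
  unfolding smooth_in_chart_def
  by (rule smooth_on_cong[of "coord_rep c (snd c')"])
    (auto simp: coord_image_def transition_smooth coord_rep_restrict[of c "fst c \<inter> fst c'"])

lemma smooth_overlap:
  assumes "c \<in> A" "c' \<in> A" "smooth_in_chart c' f"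
  shows "smooth_in_chart (overlap c c') f"
proof (rule chart_change(1)[of "overlap c c'" "overlap c' c"])
  show "smooth_in_chart (overlap c' c) f" using smooth_in_chart_restrict[OF good_chart[OF assms(2)] _ assms(3)] by simp
  show "smooth_in_chart (overlap c c') (snd (overlap c' c))" using smooth_transition assms by simp
qed (use assms in auto)

lemma chart_deriv_overlap:
  assumes "c \<in> A" "c' \<in> A" "p \<in> fst c" "p \<in> fst c'" "smooth_in_chart (overlap c c') f"
    and "\<And>q. q \<in> fst c \<Longrightarrow> q \<in> fst c' \<Longrightarrow> f q = g q"
  shows "chart_deriv c g p = chart_deriv (overlap c c') f p"
  using chart_deriv_restrict[OF good_chart[OF assms(1)] _ overlap_open[OF assms(1,2)] _ assms(5), of p g] assms
  by simp

lemma chart_deriv_chain: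
  assumes c: "c \<in> A" "c' \<in> A" "p \<in> fst c" "p \<in> fst c'" and f: "smooth_in_chart c' f"
  shows "chart_deriv c f p v = chart_deriv c' f p (chart_deriv c (snd c') p v)"
proof -
  have f': "smooth_in_chart (overlap c' c) f" using smooth_in_chart_restrict[OF good_chart[OF c(2)] _ f] by simp
  have "chart_deriv (overlap c c') f p v = chart_deriv (overlap c' c) f p (chart_deriv (overlap c c') (snd c') p v)"
  proof -
    have "chart_deriv (overlap c c') f p v =
        chart_deriv (overlap c' c) f p (chart_deriv (overlap c c') (snd (overlap c' c)) p v)"
      by (rule chart_change(2)) (use c f' smooth_transition[OF c(1,2)] in auto)
    then show ?thesis by simp
  qed
  then show ?thesis
    using chart_deriv_overlap[OF c smooth_overlap[OF c(1,2) f]] chart_deriv_overlap[OF c smooth_transition[OF c(1,2)]]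
      chart_deriv_overlap[OF c(2,1,4,3) f'] by simp
qed

lemma transition_linear:
  assumes "c \<in> A" "c' \<in> A" "p \<in> fst c" "p \<in> fst c'"
  shows "linear (chart_deriv c (snd c') p)"
  using chart_deriv_linear[OF smooth_transition[OF assms(1,2)], of p] assms
    chart_deriv_overlap[OF assms smooth_transition[OF assms(1,2)]] by simp

lemma transition_inverse:
  assumes c: "c \<in> A" "c' \<in> A" "p \<in> fst c" "p \<in> fst c'"
  shows "chart_deriv c' (snd c) p (chart_deriv c (snd c') p v) = v"
proof -
  have s: "smooth_in_chart (overlap c' c) (snd c)" using smooth_transition[OF c(2,1)] by simp
  have s': "smooth_in_chart (overlap c c') (snd c)"
    using smooth_in_chart_restrict[OF good_chart[OF c(1)] _ smooth_in_chart_self[OF good_chart[OF c(1)]]] by simp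
  have "chart_deriv (overlap c c') (snd c) p v = chart_deriv (overlap c' c) (snd c) p (chart_deriv (overlap c c') (snd c') p v)"
  proof -
    have "chart_deriv (overlap c c') (snd c) p v =
        chart_deriv (overlap c' c) (snd c) p (chart_deriv (overlap c c') (snd (overlap c' c)) p v)"
      by (rule chart_change(2)) (use c s smooth_transition[OF c(1,2)] in auto)
    then show ?thesis by simp
  qed
  then show ?thesis
    using chart_deriv_overlap[OF c s'] chart_deriv_overlap[OF c smooth_transition[OF c(1,2)]]
      chart_deriv_overlap[OF c(2,1,4,3) s] chart_deriv_self[OF good_chart[OF c(1)] c(3)] by simp
qed

lemma transition_surj:
  assumes "c \<in> A" "c' \<in> A" "p \<in> fst c" "p \<in> fst c'"
  shows "surj (chart_deriv c (snd c') p)"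
  by (rule surjI[of _ "chart_deriv c' (snd c) p"]) (use transition_inverse[OF assms(2,1,4,3)] in simp)

text \<open>If the normal coordinate of a transition map vanished at an interior point, it would have a
  minimum there, so the derivative of the transition map would not be surjective.\<close>

lemma boundary_iff:
  assumes c: "c \<in> A" "p \<in> fst c"
  shows "p \<in> boundary A \<longleftrightarrow> snd c p $ bdry_index = 0"
proof
  assume "p \<in> boundary A"
  then obtain c' where c': "c' \<in> A" "p \<in> fst c'" "snd c' p $ bdry_index = 0"
    by (auto simp: boundary_def)
  show "snd c p $ bdry_index = 0"
  proof (rule ccontr)
    assume "snd c p $ bdry_index \<noteq> 0"
    then have pos: "snd c p $ bdry_index > 0"
      using hs_openD[OF chart_image_open[OF c(1)] coord_imageI[OF c(2)]] by simp
    let ?S = "snd c ` (fst c \<inter> fst c')" and ?x = "snd c p" and ?o = "overlap c c'"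
    let ?f = "\<lambda>q. snd c' q $ bdry_index"
    have x: "?x \<in> ?S" using c c' by blast
    have sm: "smooth_in_chart ?o ?f"
      using smooth_in_chart_linear_comp[OF bounded_linear_vec_nth smooth_transition[OF c(1) c'(1)]] .
    have "(coord_rep ?o ?f has_derivative chart_deriv ?o ?f p) (at ?x within ?S)"
      using chart_deriv_has_derivative[OF sm, of p] c c' by (simp add: coord_image_def)
    moreover obtain r where r: "0 < r" "\<And>y. y \<in> ball ?x r \<Longrightarrow> 0 \<le> y $ bdry_index \<Longrightarrow> y \<in> ?S"
      using hs_open_ball[OF overlap_open[OF c(1) c'(1)] x] by blast
    \<comment> \<open>On \<open>V\<close> the normal coordinate of \<open>c\<close> is positive, so
      \<open>V\<close> is open in the full space and the derivative at \<open>?x\<close> is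
      two-sided, as the criterion for extrema requires.\<close>
    define V where "V = ball ?x r \<inter> {y. 0 < y $ bdry_index}"
    have V: "open V" "?x \<in> V" "V \<subseteq> ?S"
      using r pos by (auto simp: V_def intro!: open_Int open_halfspace_component_gt_cart)
    ultimately have D: "(coord_rep ?o ?f has_derivative chart_deriv ?o ?f p) (at ?x)"
      using has_derivative_subset[OF _ V(3)] at_within_open[OF V(2,1)] by metis
    have "coord_rep ?o ?f ?x \<le> coord_rep ?o ?f y" if "y \<in> V" for y
    proof -
      have "y \<in> ?S" using that V by blast
      then obtain q where q: "q \<in> fst c" "q \<in> fst c'" "y = snd c q" by blast
      have "coord_rep ?o ?f (snd ?o p) = ?f p" "coord_rep ?o ?f (snd ?o q) = ?f q"
        using q c c' by (intro coord_rep_apply good_overlap; simp)+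
      then show ?thesis
        using c'(3) q hs_openD[OF chart_image_open[OF c'(1)] coord_imageI[OF q(2)]] by simp
    qed
    then have "chart_deriv ?o ?f p = (\<lambda>v. 0)"
      using differential_zero_maxmin[OF V(2,1) D] by blast
    moreover have "chart_deriv ?o ?f p v = chart_deriv ?o (snd c') p v $ bdry_index" for v
      by (rule chart_deriv_linear_comp[OF good_overlap[OF c(1) c'(1)] _ smooth_transition[OF c(1) c'(1)] bounded_linear_vec_nth])
        (use c c' in simp)
    ultimately have zero: "chart_deriv c (snd c') p v $ bdry_index = 0" for v
      using chart_deriv_overlap[OF c(1) c'(1) c(2) c'(2) smooth_transition[OF c(1) c'(1)]] by simp
    have "chart_deriv c (snd c') p (chart_deriv c' (snd c) p normal_dir) $ bdry_index = 1"
      using transition_inverse[OF c'(1) c(1) c'(2) c(2)] by (simp add: normal_dir_def)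
    then show False using zero by simp
  qed
qed (use c in \<open>auto simp: boundary_def\<close>)

text \<open>Every boundary point is a limit of interior points, reached along the inward normal
  coordinate, and \<open>f\<close> is continuous. An arbitrary open \<open>V\<close> is allowed so
  that overlaps of charts are covered.\<close>

lemma eq_zero_of_interior:
  fixes f :: "'a \<Rightarrow> real"
  assumes c: "c \<in> A" and V: "openin X V" "V \<subseteq> fst c" "p \<in> V" and f: "smooth_in_chart (V, snd c) f"
    and zero: "\<And>q. q \<in> V \<Longrightarrow> q \<notin> boundary A \<Longrightarrow> f q = 0"
  shows "f p = 0"
proof (rule ccontr)
  assume "f p \<noteq> 0"
  let ?x = "snd c p" and ?S = "snd c ` V" and ?f = "coord_rep (V, snd c) f"
  have S: "hs_open ?S" by (rule image_of_open[OF c V(1,2)])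
  have good: "good_chart (V, snd c)" by (rule good_chart_restrict[OF good_chart[OF c] V(2) S])
  have fV: "?f (snd c q) = f q" if "q \<in> V" for q using coord_rep_apply[OF good, of q] that by simp
  have x: "?x \<in> ?S" using V(3) by blast
  have "continuous_on ?S ?f" using smooth_on_continuous[OF f[unfolded smooth_in_chart_def]] by (simp add: coord_image_def)
  then obtain d where d: "0 < d" "\<And>y. y \<in> ?S \<Longrightarrow> dist y ?x < d \<Longrightarrow> dist (?f y) (?f ?x) < \<bar>f p\<bar>"
    using x \<open>f p \<noteq> 0\<close> unfolding continuous_on_iff by (meson zero_less_abs_iff)
  obtain r where r: "0 < r" "\<And>y. y \<in> ball ?x r \<Longrightarrow> 0 \<le> y $ bdry_index \<Longrightarrow> y \<in> ?S"
    using hs_open_ball[OF S x] by blast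
  let ?y = "?x + (min r d / 2) *\<^sub>R normal_dir"
  have pos: "?y $ bdry_index > 0"
    using hs_openD[OF S x] r(1) d(1) by (auto simp: normal_dir_def intro!: add_nonneg_pos)
  have dist: "dist ?y ?x < d" "?y \<in> ball ?x r"
    using r(1) d(1) by (auto simp: dist_norm normal_dir_def)
  then have "?y \<in> ?S" using r(2) pos by simp
  then obtain q where q: "q \<in> V" "?y = snd c q" by blast
  have "q \<notin> boundary A" using boundary_iff[OF c, of q] V(2) q pos by auto
  then have "?f ?y = 0" using zero[OF q(1)] q fV by simp
  then show False using d(2)[OF \<open>?y \<in> ?S\<close> dist(1)] fV[OF V(3)] by simp
qed

lemma smooth_eq_zero_of_interior:
  fixes f :: "'a \<Rightarrow> real"
  assumes "c \<in> A" "p \<in> fst c" "smooth_in_chart c f" "\<And>q. q \<in> fst c \<Longrightarrow> q \<notin> boundary A \<Longrightarrow> f q = 0"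
  shows "f p = 0"
  using eq_zero_of_interior[OF assms(1) chart_open[OF assms(1)] order_refl assms(2)] assms(3,4) by simp

lemma smooth_function_const: "smooth_function A (\<lambda>p. a)"
  by (simp add: smooth_function_def smooth_in_chart_const)

text \<open>A bump function in coordinates, extended by 0. The set \<open>K\<close> that carries it
  is compact, hence closed because \<open>X\<close> is Hausdorff, so the extension is smooth also in
  charts that leave the domain of \<open>c\<close>.\<close>

lemma bump_function_exists:
  assumes c: "c \<in> A" "p \<in> fst c" and U: "openin X U" "p \<in> U"
  shows "\<exists>\<beta> K. smooth_function A \<beta> \<and> (\<forall>q. 0 \<le> \<beta> q) \<and> 0 < \<beta> p \<and> (\<forall>q. q \<notin> K \<longrightarrow> \<beta> q = 0) \<and>
    K \<subseteq> U \<and> closedin X K"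
proof -
  let ?S = "snd c ` (fst c \<inter> U)" and ?x = "snd c p"
  have "hs_open ?S" using image_of_open[OF c(1), of "fst c \<inter> U"] chart_open[OF c(1)] U(1) by auto
  then obtain r where r: "0 < r" "\<And>y. y \<in> ball ?x r \<Longrightarrow> 0 \<le> y $ bdry_index \<Longrightarrow> y \<in> ?S"
    using hs_open_ball[of ?S ?x] c(2) U(2) by blast
  \<comment> \<open>Half the radius puts the closed ball inside \<open>ball ?x r\<close>, so that
    its part in the half-space is a compact subset of the chart image.\<close>
  define K where "K = {q \<in> fst c. snd c q \<in> cball ?x (r / 2)}"
  define \<beta> where "\<beta> = (\<lambda>q. if q \<in> fst c then bump ?x (r / 2) (snd c q) else 0)"
  have inj: "inj_on (snd c) (fst c)" using good_chart[OF c(1)] by (simp add: good_chart_def)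
  have KU: "K \<subseteq> U"
  proof
    fix q assume q: "q \<in> K"
    then have "snd c q \<in> ?S"
      using r hs_openD[OF chart_image_open[OF c(1)] coord_imageI[of q c]] by (auto simp: K_def)
    then show "q \<in> U" using inj q by (auto simp: K_def inj_on_def)
  qed
  have img: "snd c ` K = cball ?x (r / 2) \<inter> half_space"
  proof
    show "snd c ` K \<subseteq> cball ?x (r / 2) \<inter> half_space"
      using hs_openD[OF chart_image_open[OF c(1)] coord_imageI] by (auto simp: K_def half_space_def)
    show "cball ?x (r / 2) \<inter> half_space \<subseteq> snd c ` K"
    proof
      fix y assume y: "y \<in> cball ?x (r / 2) \<inter> half_space"
      then have "y \<in> ?S" using r by (auto simp: half_space_def)
      then show "y \<in> snd c ` K" using y by (auto simp: K_def)
    qed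
  qed
  have "compact (snd c ` K)" unfolding img half_space_def
    by (intro compact_Int_closed compact_cball closed_halfspace_component_ge_cart)
  then have "compactin (top_of_set (coord_image c)) (snd c ` K)"
    by (auto simp: compactin_subtopology K_def coord_image_def)
  then have "compactin (subtopology X (fst c)) K"
    using homeomorphic_map_compactness_eq[OF chart_homeo[OF c(1)]] chart_topspace[OF c(1)] by (auto simp: K_def)
  then have closed: "closedin X K"
    using Hausdorff compactin_imp_closedin by (auto simp: compactin_subtopology)
  have \<beta>K: "\<beta> q = 0" if "q \<notin> K" for q
    using bump_pos_iff[of "r / 2" ?x "snd c q"] bump_nonneg[of ?x "r / 2" "snd c q"] r(1) that
    by (auto simp: \<beta>_def K_def dest: less_imp_le)
  have sm_c: "smooth_in_chart c (\<lambda>q. bump ?x (r / 2) (snd c q))"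
    using smooth_on_compose[OF smooth_on_of_Ck[OF open_UNIV Ck_on_bump] smooth_in_chart_self[OF good_chart[OF c(1)], unfolded smooth_in_chart_def], of UNIV]
    by (simp add: smooth_in_chart_def coord_rep_def o_def)
  have "smooth_in_chart c' \<beta>" if c': "c' \<in> A" for c'
  proof (rule smooth_in_chart_locally[OF good_chart[OF c']])
    fix q assume q: "q \<in> fst c'"
    show "\<exists>U. q \<in> U \<and> U \<subseteq> fst c' \<and> hs_open (snd c' ` U) \<and> smooth_in_chart (U, snd c') \<beta>"
    proof (cases "q \<in> fst c")
      case True
      have "smooth_in_chart (overlap c' c) \<beta>"
        by (rule smooth_in_chart_cong[OF smooth_overlap[OF c' c(1) sm_c]]) (simp add: \<beta>_def)
      with True q show ?thesis
        using overlap_open[OF c' c(1)] by (intro exI[of _ "fst c' \<inter> fst c"]) auto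
    next
      case False
      have "smooth_in_chart (fst c' - K, snd c') \<beta>"
        by (rule smooth_in_chart_cong[OF smooth_in_chart_const[of _ 0]]) (simp add: \<beta>K)
      moreover have "openin X (fst c' - K)" using closed chart_open[OF c'] by (simp add: openin_diff)
      ultimately show ?thesis
        using image_of_open[OF c', of "fst c' - K"] False q by (intro exI[of _ "fst c' - K"]) (auto simp: K_def)
    qed
  qed
  then have "smooth_function A \<beta>" by (simp add: smooth_function_def)
  moreover have "0 < \<beta> p" using c(2) r(1) bump_pos_iff[of "r / 2" ?x ?x] by (simp add: \<beta>_def)
  moreover have "0 \<le> \<beta> q" for q by (simp add: \<beta>_def bump_nonneg)
  ultimately show ?thesis
    using \<beta>K KU closed by (intro exI[of _ \<beta>] exI[of _ K]) simp
qed

text \<open>Hadamard's lemma for a smooth extension of the coordinate representation. The last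
  conjunct recovers the factor \<open>a\<close> on the boundary from a derivative of
  \<open>f\<close>, hence without reference to the choice of \<open>U\<close> and of the
  extension.\<close>

lemma boundary_factor:
  fixes f :: "'a \<Rightarrow> real"
  assumes c: "c \<in> A" "p \<in> fst c" "p \<in> boundary A" and f: "smooth_in_chart c f"
    and zero: "\<forall>q\<in>fst c \<inter> boundary A. f q = 0"
  shows "\<exists>U a. openin X U \<and> p \<in> U \<and> U \<subseteq> fst c \<and> smooth_in_chart (U, snd c) a \<and>
    (\<forall>q\<in>U. f q = snd c q $ bdry_index * a q) \<and>
    (\<forall>q\<in>U. \<forall>v. q \<in> boundary A \<longrightarrow> chart_deriv c f q v = v $ bdry_index * a q)"
proof -
  let ?x = "snd c p" and ?S = "coord_image c" and ?e = "normal_dir :: real ^ 'm"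
  have e: "?e \<in> Basis" "\<And>y. y \<bullet> ?e = y $ bdry_index"
    by (simp_all add: normal_dir_def inner_axis axis_in_Basis_iff)
  have x0: "?x \<bullet> ?e = 0" using boundary_iff[OF c(1,2)] c(3) e by simp
  obtain W h where W: "open W" "?x \<in> W" "\<And>k. Ck_on k h W" "\<And>y. y \<in> ?S \<Longrightarrow> y \<in> W \<Longrightarrow> h y = coord_rep c f y"
    using smooth_onE[OF f[unfolded smooth_in_chart_def] coord_imageI[OF c(2)]] by blast
  obtain r1 where r1: "0 < r1" "\<And>y. y \<in> ball ?x r1 \<Longrightarrow> 0 \<le> y $ bdry_index \<Longrightarrow> y \<in> ?S"
    using hs_open_ball[OF chart_image_open[OF c(1)] coord_imageI[OF c(2)]] by blast
  obtain r2 where r2: "0 < r2" "ball ?x r2 \<subseteq> W" using W(1,2) open_contains_ball by blast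
  define r where "r = min r1 r2"
  have r: "0 < r" "ball ?x r \<subseteq> W" "\<And>y. y \<in> ball ?x r \<Longrightarrow> 0 \<le> y $ bdry_index \<Longrightarrow> y \<in> ?S"
    using r1 r2 by (auto simp: r_def)
  have "h y = 0" if y: "y \<in> ball ?x r" "y \<bullet> ?e = 0" for y
  proof -
    have yS: "y \<in> ?S" using r(3)[OF y(1)] y(2) e by simp
    then obtain q where q: "q \<in> fst c" "y = snd c q" by (rule coord_imageE)
    have "q \<in> boundary A" using boundary_iff[OF c(1) q(1)] q(2) y(2) e by simp
    then have "coord_rep c f y = 0" using zero q c(1) by simp
    then show ?thesis using W(4)[OF yS] r(2) y(1) by auto
  qed
  then obtain b where b: "\<And>k. Ck_on k b (ball ?x r)" "\<And>y. y \<in> ball ?x r \<Longrightarrow> h y = (y \<bullet> ?e) * b y"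
    using hadamard[OF e(1) x0 Ck_on_subset[OF W(3) r(2)]] by metis
  define U where "U = {q \<in> fst c. snd c q \<in> ball ?x r}"
  have U: "openin X U" "p \<in> U" "U \<subseteq> fst c"
    using preimage_of_open[OF c(1) open_ball] c(2) r(1) by (auto simp: U_def)
  have good: "good_chart (U, snd c)"
    by (rule good_chart_restrict[OF good_chart[OF c(1)] U(3) image_of_open[OF c(1) U(1,3)]])
  let ?a = "\<lambda>q. b (snd c q)" and ?y = "\<lambda>q. snd c q $ bdry_index"
  have a: "smooth_in_chart (U, snd c) ?a"
    unfolding smooth_in_chart_def coord_rep_compose[of "(U, snd c)" b "snd c"]
  proof (rule smooth_on_compose[of b "ball ?x r"])
    show "smooth_on b (ball ?x r)" by (rule smooth_on_of_Ck[OF open_ball b(1) order_refl])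
    show "smooth_on (coord_rep (U, snd c) (snd c)) (coord_image (U, snd c))"
      using smooth_in_chart_self[OF good] by (simp add: smooth_in_chart_def)
    show "coord_rep (U, snd c) (snd c) ` coord_image (U, snd c) \<subseteq> ball ?x r"
      using coord_rep_apply[OF good, of _ "snd c"] by (auto simp: coord_image_def U_def)
  qed
  have ysm: "smooth_in_chart (U, snd c) ?y"
    using smooth_in_chart_linear_comp[OF bounded_linear_vec_nth smooth_in_chart_self[OF good]] by simp
  have fU: "f q = ?y q * ?a q" if "q \<in> U" for q
  proof -
    have q: "q \<in> fst c" "snd c q \<in> ball ?x r" using that by (auto simp: U_def)
    then have "h (snd c q) = coord_rep c f (snd c q)" using W(4) coord_imageI[OF q(1)] r(2) by blast
    then show ?thesis using b(2)[OF q(2)] q(1) c(1) e by simp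
  qed
  have "chart_deriv c f q v = v $ bdry_index * ?a q" if q: "q \<in> U" "q \<in> boundary A" for q v
  proof -
    have qU: "q \<in> fst (U, snd c)" using q by simp
    have "chart_deriv c f q v = chart_deriv (U, snd c) (\<lambda>q. ?y q * ?a q) q v"
      using chart_deriv_restrict[OF good_chart[OF c(1)] U(3) image_of_open[OF c(1) U(1,3)] q(1)
          smooth_in_chart_mult[OF ysm a], of f] fU by simp
    also have "\<dots> = ?y q * chart_deriv (U, snd c) ?a q v + chart_deriv (U, snd c) ?y q v * ?a q"
      by (rule chart_deriv_mult[OF good qU ysm a])
    also have "chart_deriv (U, snd c) ?y q v = v $ bdry_index"
      using chart_deriv_linear_comp[OF good qU smooth_in_chart_self[OF good] bounded_linear_vec_nth, of bdry_index v]
        chart_deriv_self[OF good qU] by simp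
    also have "?y q = 0" using boundary_iff[OF c(1), of q] q U(3) by auto
    finally show ?thesis by simp
  qed
  then show ?thesis using U a fU by (intro exI[of _ U] exI[of _ ?a]) simp
qed

end

section \<open>Alternating multilinear forms\<close>

abbreviation contr :: "'v \<Rightarrow> ('v list \<Rightarrow> real) \<Rightarrow> 'v list \<Rightarrow> real" where
  "contr v \<alpha> \<equiv> (\<lambda>vs. \<alpha> (v # vs))"

text \<open>Fixing the number of arguments admits induction on that number.\<close>

definition alternating_at :: "nat \<Rightarrow> ('v::real_vector list \<Rightarrow> real) \<Rightarrow> bool" where
  "alternating_at N \<alpha> \<longleftrightarrow> (\<forall>vs. length vs = N \<longrightarrow>
     (\<forall>i<N. linear (\<lambda>v. \<alpha> (vs[i := v]))) \<and> (\<forall>j<N. \<forall>i<j. vs ! i = vs ! j \<longrightarrow> \<alpha> vs = 0))"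

lemma alternating_iff: "alternating_multilinear \<alpha> \<longleftrightarrow> (\<forall>N. alternating_at N \<alpha>)"
  by (auto simp: alternating_multilinear_def alternating_at_def)

lemma alternating_linear: "alternating_multilinear \<alpha> \<Longrightarrow> linear (\<lambda>v. \<alpha> (v # vs))"
  unfolding alternating_multilinear_def by (drule conjunct1, drule spec[of _ "0 # vs"], drule spec[of _ 0]) simp

lemma alternating_linear_nth: "alternating_multilinear \<alpha> \<Longrightarrow> i < length vs \<Longrightarrow> linear (\<lambda>v. \<alpha> (vs[i := v]))"
  by (simp add: alternating_multilinear_def)

lemma alternating_repeat: "alternating_multilinear \<alpha> \<Longrightarrow> \<alpha> (v # v # vs) = 0"
  unfolding alternating_multilinear_def
  by (drule conjunct2, drule spec[of _ "v # v # vs"], drule spec[of _ 1]) simp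

lemma alternating_contr: "alternating_multilinear \<alpha> \<Longrightarrow> alternating_multilinear (contr v \<alpha>)"
  unfolding alternating_multilinear_def
proof (intro conjI allI impI)
  assume a: "(\<forall>vs. \<forall>i<length vs. linear (\<lambda>v. \<alpha> (vs[i := v]))) \<and>
    (\<forall>vs. \<forall>j<length vs. \<forall>i<j. vs ! i = vs ! j \<longrightarrow> \<alpha> vs = 0)"
  fix vs
  show "linear (\<lambda>u. \<alpha> (v # vs[i := u]))" if "i < length vs" for i
    using a[THEN conjunct1, rule_format, of "Suc i" "v # vs"] that by simp
  show "\<alpha> (v # vs) = 0" if "j < length vs" "i < j" "vs ! i = vs ! j" for i j
    using a[THEN conjunct2, rule_format, of "Suc j" "v # vs" "Suc i"] that by simp
qed

lemma alternating_swap: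
  assumes lin1: "\<And>u. linear (\<lambda>v. \<alpha> (v # u # vs))" and lin2: "\<And>u. linear (\<lambda>v. \<alpha> (u # v # vs))"
    and rep: "\<And>v. \<alpha> (v # v # vs) = (0::real)"
  shows "\<alpha> (v # w # vs) = - \<alpha> (w # v # vs)"
proof -
  have "\<alpha> ((v + w) # (v + w) # vs) = \<alpha> (v # v # vs) + \<alpha> (v # w # vs) + (\<alpha> (w # v # vs) + \<alpha> (w # w # vs))"
    by (simp only: linear_add[OF lin1] linear_add[OF lin2])
  then show ?thesis by (simp add: rep)
qed

lemma alternating_swap': "alternating_multilinear \<alpha> \<Longrightarrow> \<alpha> (v # w # vs) = - \<alpha> (w # v # vs)"
  by (rule alternating_swap)
    (auto intro: alternating_linear alternating_repeat alternating_linear[OF alternating_contr])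

lemma alternating_at_0: "alternating_at 0 \<alpha>"
  by (simp add: alternating_at_def)

text \<open>The induction step of the alternation proofs below. Conditions that avoid the first slot
  concern a contraction, and an argument equal to the first one but farther on is brought into a
  contraction by a swap of the first two.\<close>

lemma alternating_at_Suc:
  assumes lin: "\<And>vs. length vs = N \<Longrightarrow> linear (\<lambda>v. \<alpha> (v # vs))"
    and rep: "\<And>v vs. Suc (length vs) = N \<Longrightarrow> \<alpha> (v # v # vs) = 0"
    and contr: "\<And>v. alternating_at N (contr v \<alpha>)"
  shows "alternating_at (Suc N) \<alpha>"
  unfolding alternating_at_def
proof (intro allI impI conjI)
  fix vs :: "'a list"
  assume "length vs = Suc N"
  then obtain u us where vs: "vs = u # us" "length us = N" by (cases vs) auto
  show "linear (\<lambda>v. \<alpha> (vs[i := v]))" if "i < Suc N" for i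
    using that vs lin contr[of u] by (cases i) (auto simp: alternating_at_def)
  show "\<alpha> vs = 0" if ij: "j < Suc N" "i < j" and eq: "vs ! i = vs ! j" for i j
  proof (cases i)
    case (Suc i')
    then show ?thesis using ij eq vs contr[of u] by (cases j) (auto simp: alternating_at_def)
  next
    case i: 0
    obtain j' where j: "j = Suc j'" using ij by (cases j) auto
    obtain w ws where us: "us = w # ws" using vs ij j by (cases us) auto
    show ?thesis
    proof (cases j')
      case 0
      then show ?thesis using rep[of ws u] vs us eq i j by auto
    next
      case (Suc j'')
      have swap: "\<alpha> (u # w # ws) = - \<alpha> (w # u # ws)"
      proof (rule alternating_swap)
        show "linear (\<lambda>v. \<alpha> (v # x # ws))" for x using lin[of "x # ws"] vs us by simp
        show "linear (\<lambda>v. \<alpha> (x # v # ws))" for x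
          using contr[of x] vs us unfolding alternating_at_def by (auto dest!: spec[of _ us] spec[of _ 0])
        show "\<alpha> (v # v # ws) = 0" for v using rep[of ws v] vs us by simp
      qed
      have "\<forall>j<N. \<forall>i<j. (u # ws) ! i = (u # ws) ! j \<longrightarrow> \<alpha> (w # u # ws) = 0"
        using contr[of w] vs us unfolding alternating_at_def by (metis length_Cons)
      moreover have "j' < N" "0 < j'" "(u # ws) ! 0 = (u # ws) ! j'"
        using vs us eq i j Suc ij by auto
      ultimately have "\<alpha> (w # u # ws) = 0" by blast
      then show ?thesis using swap vs us by simp
    qed
  qed
qed

lemma alternating_cong_at: "alternating_at N \<alpha> \<Longrightarrow> (\<And>vs. length vs = N \<Longrightarrow> \<alpha> vs = \<beta> vs) \<Longrightarrow> alternating_at N \<beta>"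
  by (simp add: alternating_at_def)

lemma linear_const_mult: "linear f \<Longrightarrow> linear (\<lambda>v. (a::real) * f v)"
  unfolding linear_iff by (simp add: algebra_simps)

lemma alternating_at_lincomb:
  assumes "alternating_at N \<alpha>" "alternating_at N \<beta>"
  shows "alternating_at N (\<lambda>vs. a * \<alpha> vs + b * \<beta> vs)"
  using assms unfolding alternating_at_def
  by (auto intro!: linear_compose_add linear_const_mult simp: mult_zero_right)

lemma alternating_lincomb:
  "alternating_multilinear \<alpha> \<Longrightarrow> alternating_multilinear \<beta> \<Longrightarrow> alternating_multilinear (\<lambda>vs. a * \<alpha> vs + b * \<beta> vs)"
  by (simp add: alternating_iff alternating_at_lincomb)

lemma alternating_zero: "alternating_multilinear (\<lambda>vs. 0)"
  by (simp add: alternating_multilinear_def linear_iff)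

lemma alternating_add: "alternating_multilinear \<alpha> \<Longrightarrow> alternating_multilinear \<beta> \<Longrightarrow> alternating_multilinear (\<lambda>vs. \<alpha> vs + \<beta> vs)"
  using alternating_lincomb[of \<alpha> \<beta> 1 1] by simp

lemma alternating_cmult: "alternating_multilinear \<alpha> \<Longrightarrow> alternating_multilinear (\<lambda>vs. a * \<alpha> vs)"
  using alternating_lincomb[of \<alpha> \<alpha> a 0] by simp

lemma alternating_sum: "(\<And>i. i \<in> I \<Longrightarrow> alternating_multilinear (\<alpha> i)) \<Longrightarrow> alternating_multilinear (\<lambda>vs. \<Sum>i\<in>I. \<alpha> i vs)"
  by (induction I rule: infinite_finite_induct) (auto intro: alternating_zero alternating_add)

lemma alternating_map:
  assumes "alternating_multilinear \<alpha>" "linear \<phi>"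
  shows "alternating_multilinear (\<lambda>vs. \<alpha> (map \<phi> vs))"
  unfolding alternating_multilinear_def
proof (intro conjI allI impI)
  fix vs
  show "linear (\<lambda>v. \<alpha> (map \<phi> (vs[i := v])))" if "i < length vs" for i
    using linear_compose[OF assms(2) alternating_linear_nth[OF assms(1), of i "map \<phi> vs"]] that
    by (simp add: map_update o_def)
  show "\<alpha> (map \<phi> vs) = 0" if "j < length vs" "i < j" "vs ! i = vs ! j" for i j
    using assms(1) that unfolding alternating_multilinear_def by (metis length_map less_trans nth_map)
qed

lemma alternating_move_front:
  assumes "alternating_multilinear \<alpha>" "i < length vs"
  shows "\<alpha> (vs[i := w]) = (-1) ^ i * \<alpha> (w # take i vs @ drop (Suc i) vs)"
  using assms
proof (induction i arbitrary: vs \<alpha>)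
  case 0
  then show ?case by (cases vs) auto
next
  case (Suc i)
  obtain u us where vs: "vs = u # us" using Suc.prems by (cases vs) auto
  have "\<alpha> (u # us[i := w]) = (-1) ^ i * \<alpha> (u # w # take i us @ drop (Suc i) us)"
    using Suc.IH[OF alternating_contr[OF Suc.prems(1)], of us u] Suc.prems vs by simp
  then show ?case using vs alternating_swap'[OF Suc.prems(1), of u w] by simp
qed

lemma alternating_expand:
  fixes \<alpha> :: "(real ^ 'm::finite) list \<Rightarrow> real"
  assumes "linear (\<lambda>v. \<alpha> (v # vs))"
  shows "\<alpha> (x # vs) = (\<Sum>i\<in>UNIV. x $ i * \<alpha> (axis i 1 # vs))"
proof -
  have "x = (\<Sum>i\<in>UNIV. x $ i *\<^sub>R axis i 1)" by (simp add: basis_expansion[symmetric] scalar_mult_eq_scaleR[symmetric])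
  then have "\<alpha> (x # vs) = \<alpha> ((\<Sum>i\<in>UNIV. x $ i *\<^sub>R axis i 1) # vs)" by simp
  also have "\<dots> = (\<Sum>i\<in>UNIV. x $ i * \<alpha> (axis i 1 # vs))"
    by (simp add: linear_sum[OF assms] linear_scale[OF assms])
  finally show ?thesis .
qed

lemma alternating_zero_of_basis:
  fixes \<alpha> :: "(real ^ 'm::finite) list \<Rightarrow> real"
  assumes "alternating_multilinear \<alpha>" "\<And>is. length is = length vs \<Longrightarrow> \<alpha> (map (\<lambda>i. axis i 1) is) = 0"
  shows "\<alpha> vs = 0"
  using assms
proof (induction vs arbitrary: \<alpha>)
  case (Cons v vs)
  have "\<alpha> (axis i 1 # vs) = 0" for i
    by (rule Cons.IH[OF alternating_contr[OF Cons.prems(1)]]) (use Cons.prems(2)[of "i # _"] in simp)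
  then show ?case
    using alternating_expand[of \<alpha> vs v, OF alternating_linear[OF Cons.prems(1)]] by simp
qed simp

text \<open>Multilinearity reduces to basis vectors, and among more than \<open>CARD('m)\<close> of
  them one occurs twice.\<close>

lemma alternating_zero_of_length:
  fixes \<alpha> :: "(real ^ 'm::finite) list \<Rightarrow> real"
  assumes "alternating_multilinear \<alpha>" "length vs > CARD('m)"
  shows "\<alpha> vs = 0"
proof (rule alternating_zero_of_basis[OF assms(1)])
  fix "is" :: "'m list" assume len: "length is = length vs"
  have "\<not> distinct is"
    using card_mono[of UNIV "set is"] assms(2) len by (auto dest!: distinct_card)
  then obtain i j where "i < j" "j < length is" "is ! i = is ! j"
    unfolding distinct_conv_nth by (metis linorder_neqE_nat)
  then show "\<alpha> (map (\<lambda>i. axis i 1) is) = 0"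
    using assms(1) unfolding alternating_multilinear_def by (auto dest!: spec[of _ "map (\<lambda>i. axis i 1) is"])
qed

text \<open>The common shape of an exterior derivative and of the wedge product with a one-form:
  each argument in turn is singled out, with alternating sign.\<close>

definition alt_sum :: "('v \<Rightarrow> 'v list \<Rightarrow> real) \<Rightarrow> 'v list \<Rightarrow> real" where
  "alt_sum G vs = (\<Sum>i<length vs. (-1) ^ i * G (vs ! i) (take i vs @ drop (Suc i) vs))"

lemma alt_sum_Nil [simp]: "alt_sum G [] = 0"
  by (simp add: alt_sum_def)

lemma alt_sum_Cons: "alt_sum G (v # vs) = G v vs - alt_sum (\<lambda>w ws. G w (v # ws)) vs"
  by (simp add: alt_sum_def sum.lessThan_Suc_shift sum_negf del: sum.lessThan_Suc)

lemma alt_sum_cong: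
  "(\<And>w ws. w \<in> set vs \<Longrightarrow> Suc (length ws) = length vs \<Longrightarrow> G w ws = H w ws) \<Longrightarrow> alt_sum G vs = alt_sum H vs"
  unfolding alt_sum_def by (intro sum.cong refl) auto

lemma alt_sum_lincomb: "alt_sum (\<lambda>w ws. a * G w ws + b * H w ws) vs = a * alt_sum G vs + b * alt_sum H vs"
  by (simp add: alt_sum_def sum.distrib sum_distrib_left algebra_simps)

lemma alt_sum_add: "alt_sum (\<lambda>w ws. G w ws + H w ws) vs = alt_sum G vs + alt_sum H vs"
  using alt_sum_lincomb[of 1 G 1 H] by simp

lemma alt_sum_sum: "alt_sum (\<lambda>w ws. \<Sum>i\<in>I. G i w ws) vs = (\<Sum>i\<in>I. alt_sum (G i) vs)"
  unfolding alt_sum_def by (subst sum.swap) (simp add: sum_distrib_left)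

lemma alternating_alt_sum:
  assumes "\<And>v. alternating_multilinear (G v)" "\<And>vs. linear (\<lambda>v. G v vs)"
  shows "alternating_multilinear (alt_sum G)"
proof -
  have "alternating_at N (alt_sum G)" for N
    using assms
  proof (induction N arbitrary: G)
    case 0
    show ?case by (rule alternating_at_0)
  next
    case (Suc N)
    have H: "alternating_at N (alt_sum (\<lambda>w ws. G w (v # ws)))" for v
      by (rule Suc.IH) (use Suc.prems in \<open>auto intro: alternating_contr\<close>)
    show ?case
    proof (rule alternating_at_Suc)
      show "linear (\<lambda>v. alt_sum G (v # vs))" for vs
        unfolding alt_sum_Cons unfolding alt_sum_def
        by (intro linear_compose_sub linear_compose_sum linear_const_mult ballI Suc.prems(2) alternating_linear[OF Suc.prems(1)])
      show "alt_sum G (v # v # vs) = 0" for v vs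
        by (simp add: alt_sum_Cons alternating_repeat[OF Suc.prems(1)]) (simp add: alt_sum_def)
      show "alternating_at N (contr v (alt_sum G))" for v
        using alternating_at_lincomb[OF _ H[of v], of "G v" 1 "-1"] Suc.prems(1)[of v]
        by (simp add: alt_sum_Cons alternating_iff)
    qed
  qed
  then show ?thesis by (simp add: alternating_iff)
qed

text \<open>Moving the distinguished argument back to its place costs exactly the sign in the sum,
  so all summands are equal.\<close>

lemma alt_sum_contr:
  assumes "alternating_multilinear \<alpha>"
  shows "alt_sum (\<lambda>v ws. \<alpha> (v # ws)) vs = real (length vs) * \<alpha> vs"
proof -
  have "(-1) ^ i * \<alpha> (vs ! i # take i vs @ drop (Suc i) vs) = \<alpha> vs" if "i < length vs" for i
    using alternating_move_front[OF assms that, of "vs ! i"] by simp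
  then show ?thesis by (simp add: alt_sum_def)
qed

section \<open>The wedge product\<close>

definition graded_sign :: "('v list \<Rightarrow> real) \<Rightarrow> 'v list \<Rightarrow> real" where
  "graded_sign \<alpha> vs = (-1) ^ length vs * \<alpha> vs"

lemma wedge_Nil: "wedge \<alpha> \<beta> [] = \<alpha> [] * \<beta> []"
  by (simp add: wedge_def)

lemma sum_Pow_Suc:
  "(\<Sum>I\<in>Pow {..<Suc m}. f I) = (\<Sum>I\<in>Pow {..<m}. f (insert 0 (Suc ` I))) + (\<Sum>I\<in>Pow {..<m}. f (Suc ` I))"
proof -
  let ?P = "Pow {..<m}"
  have inj: "inj_on ((`) Suc) ?P" by (simp add: inj_on_def inj_image_eq_iff)
  have inj': "inj_on (insert 0) ((`) Suc ` ?P)"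
    by (auto simp: inj_on_def insert_eq_iff)
  have eq: "Pow {..<Suc m} = (insert 0) ` ((`) Suc ` ?P) \<union> (`) Suc ` ?P"
    unfolding lessThan_Suc_eq_insert_0 Pow_insert image_Pow_surj[OF refl, symmetric] by (auto simp: image_Pow_surj)
  have "(\<Sum>I\<in>Pow {..<Suc m}. f I) = (\<Sum>I\<in>(insert 0) ` ((`) Suc ` ?P). f I) + (\<Sum>I\<in>(`) Suc ` ?P. f I)"
    unfolding eq by (rule sum.union_disjoint) auto
  then show ?thesis
    by (simp add: sum.reindex[OF inj'] sum.reindex[OF inj] o_def)
qed

text \<open>Contraction with v is an antiderivation. The shuffles are split according to whether
  position 0 goes to \<alpha> or to \<beta>. In the second case it forms an inversion with each
  element of I, and \<open>graded_sign\<close> records the resulting sign without reference to a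
  degree. Most later facts on wedge products are inductions along this recursion.\<close>

lemma wedge_Cons:
  "wedge \<alpha> \<beta> (v # vs) = wedge (contr v \<alpha>) \<beta> vs + wedge (graded_sign \<alpha>) (contr v \<beta>) vs"
proof -
  let ?m = "length vs"
  let ?inv = "\<lambda>m I. {(i, j). i \<in> I \<and> j \<in> {..<m} - I \<and> j < i}"
  have fin: "finite (?inv m I)" if "I \<subseteq> {..<m}" for m :: nat and I
    by (rule finite_subset[of _ "{..<m} \<times> {..<m}"]) (use that in auto)
  have compl: "{..<Suc ?m} - insert 0 (Suc ` I) = Suc ` ({..<?m} - I)"
    "{..<Suc ?m} - Suc ` I = insert 0 (Suc ` ({..<?m} - I))" for I
    by (auto simp: lessThan_Suc_eq_insert_0)
  have nths: "nths (v # vs) (insert 0 (Suc ` I)) = v # nths vs I" "nths (v # vs) (Suc ` I) = nths vs I" for I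
    by (simp_all add: nths_Cons image_iff)
  have card1: "card (?inv (Suc ?m) (insert 0 (Suc ` I))) = card (?inv ?m I)" for I
  proof -
    have "?inv (Suc ?m) (insert 0 (Suc ` I)) = map_prod Suc Suc ` ?inv ?m I"
      unfolding compl by (auto simp: image_iff)
    then show ?thesis by (simp add: card_image inj_on_def)
  qed
  have card2: "card (?inv (Suc ?m) (Suc ` I)) = card (?inv ?m I) + card I" if I: "I \<subseteq> {..<?m}" for I
  proof -
    have eq: "?inv (Suc ?m) (Suc ` I) = map_prod Suc Suc ` ?inv ?m I \<union> (\<lambda>i. (Suc i, 0)) ` I"
      unfolding compl by (auto simp: image_iff)
    have "card (?inv (Suc ?m) (Suc ` I)) = card (map_prod Suc Suc ` ?inv ?m I) + card ((\<lambda>i. (Suc i, 0::nat)) ` I)"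
      unfolding eq by (rule card_Un_disjoint) (use fin[OF I] I in \<open>auto intro: finite_subset\<close>)
    then show ?thesis by (simp add: card_image inj_on_def)
  qed
  have len: "length (nths vs I) = card I" if "I \<subseteq> {..<?m}" for I
    using that by (auto simp: length_nths intro!: arg_cong[of _ _ card])
  let ?t = "\<lambda>\<alpha> \<beta> vs I. (-1) ^ card (?inv (length vs) I) * \<alpha> (nths vs I) * \<beta> (nths vs ({..<length vs} - I))"
  have "?t \<alpha> \<beta> (v # vs) (insert 0 (Suc ` I)) = ?t (contr v \<alpha>) \<beta> vs I" for I
    unfolding length_Cons by (subst card1) (simp only: nths compl)
  moreover have "?t \<alpha> \<beta> (v # vs) (Suc ` I) = ?t (graded_sign \<alpha>) (contr v \<beta>) vs I" if "I \<subseteq> {..<?m}" for I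
    unfolding length_Cons by (subst card2[OF that]) (simp only: nths compl graded_sign_def len[OF that] power_add mult.assoc)
  ultimately show ?thesis
    unfolding wedge_def length_Cons sum_Pow_Suc by (intro arg_cong2[where f="(+)"] sum.cong) auto
qed

lemma wedge_map: "wedge \<alpha> \<beta> (map \<phi> vs) = wedge (\<lambda>ws. \<alpha> (map \<phi> ws)) (\<lambda>ws. \<beta> (map \<phi> ws)) vs"
  by (simp add: wedge_def nths_map)

lemma wedge_lincomb_left: "wedge (\<lambda>vs. a * \<alpha> vs + b * \<alpha>' vs) \<beta> vs = a * wedge \<alpha> \<beta> vs + b * wedge \<alpha>' \<beta> vs"
  by (simp add: wedge_def sum.distrib sum_distrib_left algebra_simps)

lemma wedge_lincomb_right: "wedge \<alpha> (\<lambda>vs. a * \<beta> vs + b * \<beta>' vs) vs = a * wedge \<alpha> \<beta> vs + b * wedge \<alpha> \<beta>' vs"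
  by (simp add: wedge_def sum.distrib sum_distrib_left algebra_simps)

lemma wedge_sum_right: "wedge \<alpha> (\<lambda>vs. \<Sum>i\<in>I. \<beta> i vs) vs = (\<Sum>i\<in>I. wedge \<alpha> (\<beta> i) vs)"
  unfolding wedge_def by (subst sum.swap) (simp add: sum_distrib_left)

lemma wedge_zero_left: "wedge (\<lambda>vs. 0) \<beta> vs = 0"
  and wedge_zero_right: "wedge \<alpha> (\<lambda>vs. 0) vs = 0"
  by (simp_all add: wedge_def)

lemma graded_sign_graded_sign [simp]: "graded_sign (graded_sign \<alpha>) = \<alpha>"
  by (simp add: graded_sign_def fun_eq_iff power_add[symmetric] flip: mult.assoc)

lemma contr_graded_sign: "contr v (graded_sign \<alpha>) = (\<lambda>vs. - graded_sign (contr v \<alpha>) vs)"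
  by (simp add: graded_sign_def fun_eq_iff)

lemma wedge_minus_left: "wedge (\<lambda>vs. - \<alpha> vs) \<beta> vs = - wedge \<alpha> \<beta> vs"
  using wedge_lincomb_left[of "-1" \<alpha> 0 \<alpha> \<beta> vs] by simp

lemma alternating_graded_sign: "alternating_multilinear \<alpha> \<Longrightarrow> alternating_multilinear (graded_sign \<alpha>)"
  unfolding alternating_iff
proof
  fix N assume "\<forall>N. alternating_at N \<alpha>"
  then have "alternating_at N (\<lambda>vs. (-1) ^ N * \<alpha> vs + 0 * \<alpha> vs)" by (intro alternating_at_lincomb) auto
  then show "alternating_at N (graded_sign \<alpha>)" by (rule alternating_cong_at) (simp add: graded_sign_def)
qed

lemma alternating_wedge:
  assumes "alternating_multilinear \<alpha>" "alternating_multilinear \<beta>"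
  shows "alternating_multilinear (wedge \<alpha> \<beta>)"
proof -
  have "alternating_at N (wedge \<alpha> \<beta>)" for N
    using assms
  proof (induction N arbitrary: \<alpha> \<beta>)
    case 0
    show ?case by (rule alternating_at_0)
  next
    case (Suc N)
    note alt = Suc.prems Suc.prems[THEN alternating_contr] alternating_graded_sign[OF Suc.prems(1)]
    show ?case
    proof (rule alternating_at_Suc)
      have "linear (\<lambda>v. wedge (contr v \<alpha>) \<beta> vs)" for vs
        unfolding wedge_def
        by (intro linear_compose_sum ballI linear_const_mult linear_compose[OF _ bounded_linear.linear[OF bounded_linear_mult_left], unfolded o_def]
            alternating_linear alt)
      moreover have "linear (\<lambda>v. wedge (graded_sign \<alpha>) (contr v \<beta>) vs)" for vs
        unfolding wedge_def by (intro linear_compose_sum ballI linear_const_mult alternating_linear alt)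
      ultimately show "linear (\<lambda>v. wedge \<alpha> \<beta> (v # vs))" for vs
        unfolding wedge_Cons by (rule linear_compose_add)
      \<comment> \<open>The two terms with one v in each factor differ by the sign from
        \<open>contr_graded_sign\<close> and cancel.\<close>
      show "wedge \<alpha> \<beta> (v # v # vs) = 0" for v vs
        by (simp add: wedge_Cons alternating_repeat[OF alt(1)] alternating_repeat[OF alt(2)]
            contr_graded_sign wedge_minus_left wedge_zero_left wedge_zero_right)
      show "alternating_at N (contr v (wedge \<alpha> \<beta>))" for v
        using alternating_at_lincomb[OF Suc.IH[OF alt(3)[of v] alt(2)] Suc.IH[OF alt(5) alt(4)[of v]], of 1 1]
        by (simp add: wedge_Cons)
    qed
  qed
  then show ?thesis by (simp add: alternating_iff)
qed

definition supported_at :: "nat \<Rightarrow> ('v list \<Rightarrow> real) \<Rightarrow> bool" where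
  "supported_at k \<alpha> \<longleftrightarrow> (\<forall>vs. length vs \<noteq> k \<longrightarrow> \<alpha> vs = 0)"

lemma supported_at_contr: "supported_at (Suc k) \<alpha> \<Longrightarrow> supported_at k (contr v \<alpha>)"
  by (simp add: supported_at_def)

lemma supported_at_graded_sign: "supported_at k \<alpha> \<Longrightarrow> graded_sign \<alpha> = (\<lambda>vs. (-1) ^ k * \<alpha> vs)"
  by (auto simp: graded_sign_def supported_at_def fun_eq_iff)

lemma supported_at_wedge:
  assumes "supported_at k \<alpha>" "supported_at l \<beta>"
  shows "supported_at (k + l) (wedge \<alpha> \<beta>)"
  unfolding supported_at_def
proof (intro allI impI)
  fix vs :: "'a list" assume len: "length vs \<noteq> k + l"
  have "\<alpha> (nths vs I) * \<beta> (nths vs ({..<length vs} - I)) = 0" if "I \<subseteq> {..<length vs}" for I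
  proof -
    have "length (nths vs I) = card I" "length (nths vs ({..<length vs} - I)) = card ({..<length vs} - I)"
      using that by (auto simp: length_nths intro!: arg_cong[of _ _ card])
    moreover have "card I + card ({..<length vs} - I) = length vs"
      using card_Diff_subset[OF finite_subset[OF that] that] card_mono[OF _ that] by simp
    ultimately have "length (nths vs I) \<noteq> k \<or> length (nths vs ({..<length vs} - I)) \<noteq> l"
      using len by linarith
    then show ?thesis using assms unfolding supported_at_def by (metis mult_eq_0_iff)
  qed
  then show "wedge \<alpha> \<beta> vs = 0" unfolding wedge_def by (intro sum.neutral) (auto simp: mult.assoc)
qed

lemma wedge_0_left: "supported_at 0 \<alpha> \<Longrightarrow> wedge \<alpha> \<beta> vs = \<alpha> [] * \<beta> vs"
proof (induction vs arbitrary: \<beta>)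
  case (Cons v vs)
  have "contr v \<alpha> = (\<lambda>vs. 0)" "graded_sign \<alpha> = \<alpha>"
    using Cons.prems by (auto simp: supported_at_def graded_sign_def fun_eq_iff) (metis length_0_conv power_0 mult_1 mult_zero_right)
  then show ?case using Cons.IH[OF Cons.prems, of "contr v \<beta>"] by (simp add: wedge_Cons wedge_zero_left)
qed (simp add: wedge_Nil)

lemma wedge_1_left:
  assumes "supported_at (Suc 0) \<theta>"
  shows "wedge \<theta> \<beta> vs = alt_sum (\<lambda>v ws. \<theta> [v] * \<beta> ws) vs"
proof (induction vs arbitrary: \<beta>)
  case Nil
  then show ?case using assms by (simp add: wedge_Nil supported_at_def)
next
  case (Cons v vs)
  then show ?case
    using supported_at_graded_sign[OF assms] wedge_0_left[OF supported_at_contr[OF assms]]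
    by (simp add: wedge_Cons alt_sum_Cons wedge_minus_left)
qed

section \<open>Dual bases, contractions and inner products\<close>

definition nondegenerate :: "('v::real_vector \<Rightarrow> 'v \<Rightarrow> real) \<Rightarrow> bool" where
  "nondegenerate B \<longleftrightarrow> bilinear B \<and> (\<forall>u. (\<forall>v. B u v = 0) \<longrightarrow> u = 0)"

abbreviation dual_basis :: "(real ^ 'm \<Rightarrow> real ^ 'm \<Rightarrow> real) \<Rightarrow> 'm::finite \<Rightarrow> real ^ 'm" where
  "dual_basis B i \<equiv> dual_vec B (\<lambda>v. v $ i)"

lemma bilinear_linear_left: "bilinear B \<Longrightarrow> linear (\<lambda>u. B u v)"
  and bilinear_linear_right: "bilinear B \<Longrightarrow> linear (\<lambda>v. B u v)"
  by (auto simp: bilinear_def)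

lemma vec_eq_sum_axis: "(\<Sum>i\<in>UNIV. x $ i *\<^sub>R axis i 1) = (x :: real ^ 'm::finite)"
  by (simp only: basis_expansion scalar_mult_eq_scaleR[symmetric])

lemma linear_expand: "linear f \<Longrightarrow> f x = (\<Sum>i\<in>UNIV. x $ i *\<^sub>R f (axis i 1))" for x :: "real ^ 'm::finite"
  by (subst vec_eq_sum_axis[symmetric, of x]) (simp add: linear_sum linear_scale)

lemma nondegenerate_represents:
  fixes B :: "real ^ 'm::finite \<Rightarrow> real ^ 'm \<Rightarrow> real"
  assumes "nondegenerate B" "linear f"
  shows "\<exists>!x. \<forall>v. B x v = f v"
proof -
  have bil: "bilinear B" using assms by (simp add: nondegenerate_def)
  let ?T = "\<lambda>x. \<chi> i. B x (axis i 1)"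
  have lin: "linear ?T"
    by (rule linearI) (simp_all add: vec_eq_iff bilinear_ladd[OF bil] bilinear_lmul[OF bil])
  have eqI: "\<forall>v. B x v = h v" if "?T x = (\<chi> i. h (axis i 1))" "linear h" for x h
  proof
    fix v
    have "B x (axis i 1) = h (axis i 1)" for i using that(1) by (simp add: vec_eq_iff)
    then show "B x v = h v"
      using linear_expand[OF bilinear_linear_right[OF bil], of x v] linear_expand[OF that(2), of v] by simp
  qed
  have "x = 0" if "?T x = 0" for x
    using eqI[of x "\<lambda>_. 0"] that assms(1) by (simp add: nondegenerate_def linear_iff vec_eq_iff)
  then have "inj ?T" using linear_injective_0[OF lin] by blast
  then have "surj ?T" using linear_injective_imp_surjective[OF lin] by simp
  then obtain x where "?T x = (\<chi> i. f (axis i 1))" using surjD[of ?T "\<chi> i. f (axis i 1)"] by auto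
  then have x: "\<forall>v. B x v = f v" using eqI assms(2) by blast
  moreover have "y = x" if "\<forall>v. B y v = f v" for y
  proof -
    have "B (y - x) v = 0" for v using that x by (simp add: bilinear_lsub[OF bil])
    then have "y - x = 0" using assms(1) unfolding nondegenerate_def by blast
    then show "y = x" by simp
  qed
  ultimately show ?thesis by blast
qed

lemma dual_vec_works:
  fixes B :: "real ^ 'm::finite \<Rightarrow> real ^ 'm \<Rightarrow> real"
  assumes "nondegenerate B" "linear f"
  shows "B (dual_vec B f) v = f v"
  using theI'[OF nondegenerate_represents[OF assms]] by (simp add: dual_vec_def)

lemma dual_vec_eqI:
  fixes B :: "real ^ 'm::finite \<Rightarrow> real ^ 'm \<Rightarrow> real"
  assumes "nondegenerate B" "\<And>v. B x v = f v"
  shows "dual_vec B f = x"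
proof -
  have "linear f" using bilinear_linear_right[of B x] assms by (simp add: nondegenerate_def)
  from the1_equality[OF nondegenerate_represents[OF assms(1) this]] show ?thesis
    using assms(2) by (simp add: dual_vec_def)
qed

lemma linear_vec_nth: "linear (\<lambda>v::real ^ 'm::finite. v $ i)"
  by (rule bounded_linear.linear[OF bounded_linear_vec_nth])

lemma dual_basis_works: "nondegenerate B \<Longrightarrow> B (dual_basis B i) v = v $ i"
  by (rule dual_vec_works[OF _ linear_vec_nth])

lemma dual_basis_sum:
  assumes "nondegenerate B" "linear f"
  shows "(\<Sum>i\<in>UNIV. f (axis i 1) *\<^sub>R dual_basis B i) = dual_vec B f"
proof (rule dual_vec_eqI[OF assms(1), symmetric])
  have bil: "bilinear B" using assms by (simp add: nondegenerate_def)
  show "B (\<Sum>i\<in>UNIV. f (axis i 1) *\<^sub>R dual_basis B i) v = f v" for v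
    using linear_expand[OF assms(2), of v]
    by (simp add: linear_sum[OF bilinear_linear_left[OF bil]] bilinear_lmul[OF bil] dual_basis_works[OF assms(1)] mult.commute)
qed

text \<open>Cramer's rule exhibits the dual vector as a rational function of the coefficients of B,
  which yields its smooth dependence on the point. The indices in \<open>M\<close> are transposed
  because the unknown vector sits in the first slot of B.\<close>

lemma dual_vec_component:
  fixes B :: "real ^ 'm::finite \<Rightarrow> real ^ 'm \<Rightarrow> real"
  assumes "nondegenerate B" "linear f"
  defines "M \<equiv> \<chi> i j. B (axis j 1) (axis i 1)"
  shows "det M \<noteq> 0"
    and "dual_vec B f $ k = det (\<chi> i j. if j = k then f (axis i 1) else B (axis j 1) (axis i 1)) / det M"
proof -
  have bil: "bilinear B" using assms by (simp add: nondegenerate_def)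
  have M: "M *v x = (\<chi> i. B x (axis i 1))" for x
    using linear_expand[OF bilinear_linear_left[OF bil], of x]
    by (simp add: M_def matrix_vector_mult_def vec_eq_iff mult.commute)
  have "x = 0" if "M *v x = 0" for x
  proof -
    have "B x (axis i 1) = 0" for i using that by (simp add: M vec_eq_iff)
    then have "B x v = 0" for v using linear_expand[OF bilinear_linear_right[OF bil], of x v] by simp
    then show "x = 0" using assms(1) by (simp add: nondegenerate_def)
  qed
  then have "invertible M" using matrix_left_invertible_ker invertible_left_inverse by blast
  then show *: "det M \<noteq> 0" by (simp add: invertible_det_nz)
  have "M *v dual_vec B f = (\<chi> i. f (axis i 1))"
    by (simp add: M dual_vec_works[OF assms(1,2)])
  then show "dual_vec B f $ k = det (\<chi> i j. if j = k then f (axis i 1) else B (axis j 1) (axis i 1)) / det M"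
    using cramer[OF *] by (simp add: M_def cong: if_cong)
qed

text \<open>The sum is the trace of \<open>b\<close> against the inverse of B, and \<phi> carries
  one dual pair of bases to another. This is the source of the chart independence of \<Lambda> and
  of the inner product of forms.\<close>

lemma dual_basis_change:
  fixes b :: "real ^ 'm::finite \<Rightarrow> real ^ 'm \<Rightarrow> real"
  assumes B: "nondegenerate B" "nondegenerate B'" and \<phi>: "linear \<phi>" "surj \<phi>"
    and eq: "\<And>u v. B' (\<phi> u) (\<phi> v) = B u v" and b: "bilinear b"
  shows "(\<Sum>i\<in>UNIV. b (dual_basis B' i) (axis i 1)) = (\<Sum>i\<in>UNIV. b (\<phi> (dual_basis B i)) (\<phi> (axis i 1)))"
proof -
  have bil: "bilinear B'" using B by (simp add: nondegenerate_def)
  have dual: "dual_basis B' j = (\<Sum>i\<in>UNIV. \<phi> (axis i 1) $ j *\<^sub>R \<phi> (dual_basis B i))" for j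
  proof (rule dual_vec_eqI[OF B(2)])
    fix v
    obtain w where v: "v = \<phi> w" using \<phi>(2) by (metis surjD)
    have "B' (\<Sum>i\<in>UNIV. \<phi> (axis i 1) $ j *\<^sub>R \<phi> (dual_basis B i)) v = (\<Sum>i\<in>UNIV. w $ i * \<phi> (axis i 1) $ j)"
      by (simp add: v linear_sum[OF bilinear_linear_left[OF bil]] bilinear_lmul[OF bil] eq dual_basis_works[OF B(1)] mult.commute)
    then show "B' (\<Sum>i\<in>UNIV. \<phi> (axis i 1) $ j *\<^sub>R \<phi> (dual_basis B i)) v = v $ j"
      using linear_expand[OF linear_compose[OF \<phi>(1) linear_vec_nth[of j]], of w] v by (simp add: o_def)
  qed
  have "b (\<phi> (dual_basis B i)) (\<phi> (axis i 1)) = (\<Sum>j\<in>UNIV. \<phi> (axis i 1) $ j * b (\<phi> (dual_basis B i)) (axis j 1))" for i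
    using linear_expand[OF bilinear_linear_right[OF b], of "\<phi> (dual_basis B i)" "\<phi> (axis i 1)"] by simp
  moreover have "b (dual_basis B' j) (axis j 1) = (\<Sum>i\<in>UNIV. \<phi> (axis i 1) $ j * b (\<phi> (dual_basis B i)) (axis j 1))" for j
    by (simp add: dual linear_sum[OF bilinear_linear_left[OF b]] bilinear_lmul[OF b])
  ultimately show ?thesis by (simp only:) (rule sum.swap)
qed

lemma alternating_bilinear: "alternating_multilinear \<alpha> \<Longrightarrow> bilinear (\<lambda>u v. \<alpha> (u # v # vs))"
  by (simp add: bilinear_def alternating_linear alternating_linear[OF alternating_contr])

text \<open>This is \<open>lefschetz_Lambda\<close> at a single point.\<close>

definition contract :: "(real ^ 'm \<Rightarrow> real ^ 'm \<Rightarrow> real) \<Rightarrow> ((real ^ 'm) list \<Rightarrow> real) \<Rightarrow> (real ^ 'm::finite) list \<Rightarrow> real" where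
  "contract B \<alpha> vs = 1 / 2 * (\<Sum>i\<in>UNIV. \<alpha> (dual_basis B i # axis i 1 # vs))"

lemma alternating_contract: "alternating_multilinear \<alpha> \<Longrightarrow> alternating_multilinear (contract B \<alpha>)"
  unfolding contract_def[abs_def] by (intro alternating_cmult alternating_sum alternating_contr)

lemma contract_map:
  assumes "nondegenerate B" "nondegenerate B'" "linear \<phi>" "surj \<phi>" "\<And>u v. B' (\<phi> u) (\<phi> v) = B u v"
    and "alternating_multilinear \<alpha>"
  shows "contract B' \<alpha> (map \<phi> vs) = contract B (\<lambda>ws. \<alpha> (map \<phi> ws)) vs"
  using dual_basis_change[OF assms(1-5) alternating_bilinear[OF assms(6)], of "map \<phi> vs"]
  by (simp add: contract_def)

text \<open>The relation [\<Lambda>, L] = n - k at a point. A double contraction spreads over the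
  product in four ways: both on \<open>w\<close> gives the dimension, one on each factor gives -k in
  either order, and both on \<alpha> gives twice the first term on the right. The factor 1/2 in
  \<open>contract\<close> then accounts for the coefficient.\<close>

lemma contract_wedge:
  fixes w :: "(real ^ 'm::finite) list \<Rightarrow> real"
  assumes w: "alternating_multilinear w" "supported_at 2 w" and B: "nondegenerate B" "\<And>u v. B u v = w [u, v]"
    and \<alpha>: "alternating_multilinear \<alpha>"
  shows "contract B (wedge w \<alpha>) vs = wedge w (contract B \<alpha>) vs + (real CARD('m) / 2 - real (length vs)) * \<alpha> vs"
proof -
  let ?X = "dual_basis B" and ?e = "\<lambda>i::'m. axis i 1 :: real ^ 'm"
  have sgn: "graded_sign w = w" using supported_at_graded_sign[OF w(2)] by simp
  have w1: "supported_at (Suc 0) (contr v w)" for v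
    using w(2) by (intro supported_at_contr) (simp add: numeral_2_eq_2)
  have sgn1: "graded_sign (contr v w) = (\<lambda>vs. - contr v w vs)" for v
    using supported_at_graded_sign[OF w1] by simp
  have "wedge w \<alpha> (x # e # vs) = w [x, e] * \<alpha> vs - wedge (contr x w) (contr e \<alpha>) vs
      + wedge (contr e w) (contr x \<alpha>) vs + wedge w (\<lambda>vs. \<alpha> (x # e # vs)) vs" for x e
    by (simp add: wedge_Cons sgn sgn1 wedge_minus_left wedge_0_left[OF supported_at_contr[OF w1]])
  then have "(\<Sum>i\<in>UNIV. wedge w \<alpha> (?X i # ?e i # vs)) = (\<Sum>i\<in>UNIV. w [?X i, ?e i]) * \<alpha> vs
      - (\<Sum>i\<in>UNIV. wedge (contr (?X i) w) (contr (?e i) \<alpha>) vs)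
      + (\<Sum>i\<in>UNIV. wedge (contr (?e i) w) (contr (?X i) \<alpha>) vs)
      + (\<Sum>i\<in>UNIV. wedge w (\<lambda>vs. \<alpha> (?X i # ?e i # vs)) vs)"
    by (simp add: sum.distrib sum_subtractf sum_distrib_right)
  moreover have "(\<Sum>i\<in>UNIV. w [?X i, ?e i]) = real CARD('m)"
    by (simp add: B(2)[symmetric] dual_basis_works[OF B(1)])
  moreover have "(\<Sum>i\<in>UNIV. wedge (contr (?X i) w) (contr (?e i) \<alpha>) vs) = real (length vs) * \<alpha> vs"
  proof -
    have "(\<Sum>i\<in>UNIV. wedge (contr (?X i) w) (contr (?e i) \<alpha>) vs) = alt_sum (\<lambda>v ws. \<Sum>i\<in>UNIV. v $ i * \<alpha> (?e i # ws)) vs"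
      by (simp add: wedge_1_left[OF w1] alt_sum_sum B(2)[symmetric] dual_basis_works[OF B(1)])
    also have "\<dots> = alt_sum (\<lambda>v ws. \<alpha> (v # ws)) vs"
      by (simp add: alternating_expand[OF alternating_linear[OF \<alpha>], symmetric])
    finally show ?thesis by (simp add: alt_sum_contr[OF \<alpha>])
  qed
  moreover have "(\<Sum>i\<in>UNIV. wedge (contr (?e i) w) (contr (?X i) \<alpha>) vs) = - (real (length vs) * \<alpha> vs)"
  proof -
    \<comment> \<open>The dual basis refers to the first slot of \<open>w\<close>, whereas v stands
      in the second one here; antisymmetry accounts for the minus sign.\<close>
    have "(\<Sum>i\<in>UNIV. w [?e i, v] * \<alpha> (?X i # ws)) = - \<alpha> (v # ws)" for v ws
    proof -
      have lin: "linear (\<lambda>u. w [u, v])" using alternating_linear[OF w(1)] .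
      have "w [- v, u] = w [u, v]" for u
        using alternating_swap'[OF w(1), of u v "[]"] linear_neg[OF alternating_linear[OF w(1)], of v "[u]"] by simp
      then have "dual_vec B (\<lambda>u. w [u, v]) = - v"
        by (intro dual_vec_eqI[OF B(1)]) (simp add: B(2))
      then have "(\<Sum>i\<in>UNIV. w [?e i, v] *\<^sub>R ?X i) = - v"
        using dual_basis_sum[OF B(1) lin] by simp
      moreover have "\<alpha> ((\<Sum>i\<in>UNIV. w [?e i, v] *\<^sub>R ?X i) # ws) = (\<Sum>i\<in>UNIV. w [?e i, v] * \<alpha> (?X i # ws))"
        using alternating_linear[OF \<alpha>, of ws] by (simp add: linear_sum[OF alternating_linear[OF \<alpha>]] linear_scale[OF alternating_linear[OF \<alpha>]])
      ultimately show ?thesis using linear_neg[OF alternating_linear[OF \<alpha>]] by simp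
    qed
    then have "(\<Sum>i\<in>UNIV. wedge (contr (?e i) w) (contr (?X i) \<alpha>) vs) = alt_sum (\<lambda>v ws. - \<alpha> (v # ws)) vs"
      by (simp add: wedge_1_left[OF w1] alt_sum_sum[symmetric])
    then show ?thesis using alt_sum_lincomb[of "-1" "\<lambda>v ws. \<alpha> (v # ws)" 0 _ vs] by (simp add: alt_sum_contr[OF \<alpha>])
  qed
  moreover have "(\<Sum>i\<in>UNIV. wedge w (\<lambda>vs. \<alpha> (?X i # ?e i # vs)) vs) = 2 * wedge w (contract B \<alpha>) vs"
    using wedge_lincomb_right[of w "1 / 2" "\<lambda>vs. \<Sum>i\<in>UNIV. \<alpha> (?X i # ?e i # vs)" 0 _ vs]
    by (simp add: contract_def[abs_def] wedge_sum_right)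
  ultimately show ?thesis by (simp add: contract_def[of _ "wedge w \<alpha>"] algebra_simps)
qed

section \<open>Inner products of alternating forms\<close>

definition tensor_inner ::
  "(real ^ 'm::finite \<Rightarrow> real ^ 'm \<Rightarrow> real) \<Rightarrow> nat \<Rightarrow> ((real ^ 'm) list \<Rightarrow> real) \<Rightarrow> ((real ^ 'm) list \<Rightarrow> real) \<Rightarrow> real" where
  "tensor_inner B N \<alpha> \<beta> =
     (\<Sum>is\<in>{is. length is = N}. \<alpha> (map (\<lambda>i. axis i 1) is) * \<beta> (map (dual_basis B) is))"

lemma finite_lists_length: "finite {is :: 'm::finite list. length is = N}"
  using finite_lists_length_eq[of "UNIV :: 'm set" N] by simp

lemma tensor_inner_0: "tensor_inner B 0 \<alpha> \<beta> = \<alpha> [] * \<beta> []"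
  by (simp add: tensor_inner_def)

lemma tensor_inner_Suc:
  "tensor_inner B (Suc N) \<alpha> \<beta> = (\<Sum>i\<in>UNIV. tensor_inner B N (contr (axis i 1) \<alpha>) (contr (dual_basis B i) \<beta>))"
proof -
  have eq: "{is :: 'm list. length is = Suc N} = (\<lambda>(i, is). i # is) ` (UNIV \<times> {is. length is = N})"
    by (auto simp: image_iff length_Suc_conv)
  have inj: "inj_on (\<lambda>(i, is). i # is) (UNIV \<times> {is :: 'm list. length is = N})"
    by (auto simp: inj_on_def)
  show ?thesis
    unfolding tensor_inner_def eq sum.reindex[OF inj]
    by (simp add: o_def case_prod_beta sum.cartesian_product)
qed

lemma alt_inner_eq: "alt_inner B \<alpha> \<beta> = (\<Sum>N\<le>CARD('m). tensor_inner B N \<alpha> \<beta> / fact N)"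
  for B :: "real ^ 'm::finite \<Rightarrow> real ^ 'm \<Rightarrow> real"
proof -
  have "{is :: 'm list. length is \<le> CARD('m)} = (\<Union>N\<in>{..CARD('m)}. {is. length is = N})" by auto
  then show ?thesis
    unfolding alt_inner_def tensor_inner_def
    by (simp only:, subst sum.UNION_disjoint) (auto simp: finite_lists_length sum_divide_distrib intro!: sum.cong)
qed

lemma tensor_inner_lincomb_left:
  "tensor_inner B N (\<lambda>vs. a * \<alpha> vs + b * \<alpha>' vs) \<beta> = a * tensor_inner B N \<alpha> \<beta> + b * tensor_inner B N \<alpha>' \<beta>"
  by (simp add: tensor_inner_def sum.distrib sum_distrib_left algebra_simps)

lemma tensor_inner_lincomb_right:
  "tensor_inner B N \<alpha> (\<lambda>vs. a * \<beta> vs + b * \<beta>' vs) = a * tensor_inner B N \<alpha> \<beta> + b * tensor_inner B N \<alpha> \<beta>'"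
  by (simp add: tensor_inner_def sum.distrib sum_distrib_left algebra_simps)

text \<open>Covariance is obtained one slot at a time: \<open>dual_basis_change\<close> is applied
  to the pairing of the remaining slots, viewed as a bilinear form in the first.\<close>

lemma tensor_inner_map:
  fixes B B' :: "real ^ 'm::finite \<Rightarrow> real ^ 'm \<Rightarrow> real"
  assumes B: "nondegenerate B" "nondegenerate B'" and \<phi>: "linear \<phi>" "surj \<phi>"
    and eq: "\<And>u v. B' (\<phi> u) (\<phi> v) = B u v"
    and "alternating_multilinear \<alpha>" "alternating_multilinear \<beta>"
  shows "tensor_inner B' N \<alpha> \<beta> = tensor_inner B N (\<lambda>vs. \<alpha> (map \<phi> vs)) (\<lambda>vs. \<beta> (map \<phi> vs))"
  using assms(6,7)
proof (induction N arbitrary: \<alpha> \<beta>)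
  case 0
  then show ?case by (simp add: tensor_inner_0)
next
  case (Suc N)
  let ?b = "\<lambda>x y. tensor_inner B N (\<lambda>vs. \<alpha> (y # map \<phi> vs)) (\<lambda>vs. \<beta> (x # map \<phi> vs))"
  have la: "\<alpha> ((a *\<^sub>R x + b *\<^sub>R y) # vs) = a * \<alpha> (x # vs) + b * \<alpha> (y # vs)"
    and lb: "\<beta> ((a *\<^sub>R x + b *\<^sub>R y) # vs) = a * \<beta> (x # vs) + b * \<beta> (y # vs)" for a b x y vs
    by (simp_all add: linear_add[OF alternating_linear[OF Suc.prems(1)]] linear_scale[OF alternating_linear[OF Suc.prems(1)]]
      linear_add[OF alternating_linear[OF Suc.prems(2)]] linear_scale[OF alternating_linear[OF Suc.prems(2)]])
  have linI: "linear f" if "\<And>a b x y. f (a *\<^sub>R x + b *\<^sub>R y) = a * f x + b * f y" for f :: "real ^ 'm \<Rightarrow> real"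
    using that[of 1 _ 1] that[of _ _ 0 0] by (intro linearI) auto
  have b: "bilinear ?b"
    unfolding bilinear_def by (auto intro!: linI simp: la lb tensor_inner_lincomb_left tensor_inner_lincomb_right)
  have "tensor_inner B' (Suc N) \<alpha> \<beta> = (\<Sum>i\<in>UNIV. ?b (dual_basis B' i) (axis i 1))"
    by (simp add: tensor_inner_Suc Suc.IH Suc.prems alternating_contr)
  also have "\<dots> = (\<Sum>i\<in>UNIV. ?b (\<phi> (dual_basis B i)) (\<phi> (axis i 1)))"
    by (rule dual_basis_change[OF B \<phi> eq b])
  also have "\<dots> = tensor_inner B (Suc N) (\<lambda>vs. \<alpha> (map \<phi> vs)) (\<lambda>vs. \<beta> (map \<phi> vs))"
    by (simp add: tensor_inner_Suc)
  finally show ?case .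
qed

lemma alt_inner_map:
  fixes B B' :: "real ^ 'm::finite \<Rightarrow> real ^ 'm \<Rightarrow> real"
  assumes "nondegenerate B" "nondegenerate B'" "linear \<phi>" "surj \<phi>" "\<And>u v. B' (\<phi> u) (\<phi> v) = B u v"
    and "alternating_multilinear \<alpha>" "alternating_multilinear \<beta>"
  shows "alt_inner B' \<alpha> \<beta> = alt_inner B (\<lambda>vs. \<alpha> (map \<phi> vs)) (\<lambda>vs. \<beta> (map \<phi> vs))"
  by (simp add: alt_inner_eq tensor_inner_map[OF assms])

definition inner_product :: "('v::real_vector \<Rightarrow> 'v \<Rightarrow> real) \<Rightarrow> bool" where
  "inner_product B \<longleftrightarrow> bilinear B \<and> (\<forall>u v. B u v = B v u) \<and> (\<forall>v. v \<noteq> 0 \<longrightarrow> 0 < B v v)"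

lemma inner_product_nondegenerate: "inner_product B \<Longrightarrow> nondegenerate B"
  unfolding inner_product_def nondegenerate_def by (metis less_irrefl)

text \<open>Gram-Schmidt for an arbitrary inner product: a vector outside the span of E is made
  orthogonal to E and normalised.\<close>

lemma orthonormal_set_exists:
  fixes B :: "real ^ 'm::finite \<Rightarrow> real ^ 'm \<Rightarrow> real"
  assumes B: "inner_product B"
  shows "k \<le> CARD('m) \<Longrightarrow> \<exists>E. finite E \<and> card E = k \<and> (\<forall>x\<in>E. \<forall>y\<in>E. B x y = (if x = y then 1 else 0))"
proof (induction k)
  case 0
  show ?case by (intro exI[of _ "{}"]) simp
next
  case (Suc k)
  have bil: "bilinear B" and sym: "\<And>u v. B u v = B v u" and pos: "\<And>v. v \<noteq> 0 \<Longrightarrow> 0 < B v v"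
    using B by (auto simp: inner_product_def)
  obtain E where E: "finite E" "card E = k" "\<And>x y. x \<in> E \<Longrightarrow> y \<in> E \<Longrightarrow> B x y = (if x = y then 1 else 0)"
    using Suc by (metis Suc_leD)
  have "span E \<noteq> UNIV"
  proof
    assume "span E = UNIV"
    then have "CARD('m) \<le> card E"
      using dim_le_card[OF _ E(1), of UNIV] by (simp add: dim_UNIV)
    then show False using Suc.prems E(2) by simp
  qed
  then obtain v where v: "v \<notin> span E" by blast
  define w where "w = v - (\<Sum>x\<in>E. B v x *\<^sub>R x)"
  have w0: "w \<noteq> 0"
  proof
    assume "w = 0"
    then have "v = (\<Sum>x\<in>E. B v x *\<^sub>R x)" by (simp add: w_def)
    also have "\<dots> \<in> span E" by (intro span_sum span_mul span_base)
    finally show False using v by simp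
  qed
  have orth: "B w y = 0" if "y \<in> E" for y
  proof -
    have "B (\<Sum>x\<in>E. B v x *\<^sub>R x) y = (\<Sum>x\<in>E. B v x * (if x = y then 1 else 0))"
      using E(3) that by (simp add: linear_sum[OF bilinear_linear_left[OF bil]] bilinear_lmul[OF bil])
    also have "\<dots> = B v y" using E(1) that by (simp add: if_distrib[of "(*) _"] cong: if_cong)
    finally show ?thesis by (simp add: w_def bilinear_lsub[OF bil])
  qed
  define u where "u = (1 / sqrt (B w w)) *\<^sub>R w"
  have "B u u = 1" using pos[OF w0] by (simp add: u_def bilinear_lmul[OF bil] bilinear_rmul[OF bil])
  moreover have ou: "B u y = 0" if "y \<in> E" for y using orth[OF that] by (simp add: u_def bilinear_lmul[OF bil])
  moreover have "u \<notin> E" using ou[of u] \<open>B u u = 1\<close> by auto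
  ultimately show ?case
    using E sym by (intro exI[of _ "insert u E"]) (auto simp: card_insert_if)
qed

lemma orthonormal_frame_exists:
  fixes B :: "real ^ 'm::finite \<Rightarrow> real ^ 'm \<Rightarrow> real"
  assumes B: "inner_product B"
  obtains \<phi> :: "real ^ 'm \<Rightarrow> real ^ 'm" where "linear \<phi>" "surj \<phi>" "\<And>u v. B (\<phi> u) (\<phi> v) = u \<bullet> v"
proof -
  have bil: "bilinear B" using B by (simp add: inner_product_def)
  obtain E where E: "finite E" "card E = CARD('m)" "\<And>x y. x \<in> E \<Longrightarrow> y \<in> E \<Longrightarrow> B x y = (if x = y then 1 else 0)"
    using orthonormal_set_exists[OF B order_refl] by blast
  then obtain e where e: "bij_betw e (UNIV :: 'm set) E"
    using finite_same_card_bij[OF finite_class.finite_UNIV E(1)] by auto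
  have ee: "B (e i) (e j) = (if i = j then 1 else 0)" for i j
    using E(3)[of "e i" "e j"] e by (auto simp: bij_betw_def inj_on_eq_iff)
  define \<phi> where "\<phi> = (\<lambda>x::real ^ 'm. \<Sum>i\<in>UNIV. x $ i *\<^sub>R e i)"
  have lin: "linear \<phi>"
    by (rule linearI) (simp_all add: \<phi>_def scaleR_add_left sum.distrib scaleR_sum_right)
  have iso: "B (\<phi> u) (\<phi> v) = u \<bullet> v" for u v
    by (simp add: \<phi>_def linear_sum[OF bilinear_linear_left[OF bil]] linear_sum[OF bilinear_linear_right[OF bil]]
        bilinear_lmul[OF bil] bilinear_rmul[OF bil] ee inner_vec_def if_distrib sum.delta mult.commute cong: if_cong)
  have "u = 0" if "\<phi> u = 0" for u
    using iso[of u u] that bilinear_lzero[OF bil] by simp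
  then have "surj \<phi>" using linear_injective_imp_surjective[OF lin] linear_injective_0[OF lin] by blast
  from that[OF lin this iso] show thesis .
qed

text \<open>In an orthonormal frame the value is a sum of squares of components, weighted by inverse
  factorials. Argument lists longer than the dimension do not occur in the sum, but \<alpha> is zero
  on them.\<close>

lemma alt_inner_self:
  fixes B :: "real ^ 'm::finite \<Rightarrow> real ^ 'm \<Rightarrow> real"
  assumes B: "inner_product B" and \<alpha>: "alternating_multilinear \<alpha>"
  shows "0 \<le> alt_inner B \<alpha> \<alpha>" and "alt_inner B \<alpha> \<alpha> = 0 \<Longrightarrow> \<alpha> vs = 0"
proof -
  obtain \<phi> :: "real ^ 'm \<Rightarrow> real ^ 'm" where \<phi>: "linear \<phi>" "surj \<phi>" "\<And>u v. B (\<phi> u) (\<phi> v) = u \<bullet> v"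
    using orthonormal_frame_exists[OF B] by blast
  have nd: "nondegenerate ((\<bullet>) :: real ^ 'm \<Rightarrow> _)"
    by (auto simp: nondegenerate_def bilinear_def inner_add_left inner_add_right intro!: linearI)
  have dual: "dual_basis (\<bullet>) i = (axis i 1 :: real ^ 'm)" for i
    by (rule dual_vec_eqI[OF nd]) (simp add: inner_axis')
  let ?\<alpha> = "\<lambda>vs. \<alpha> (map \<phi> vs)"
  let ?t = "\<lambda>N. \<Sum>is\<in>{is. length is = N}. (?\<alpha> (map (\<lambda>i. axis i 1) is))\<^sup>2"
  have eq: "alt_inner B \<alpha> \<alpha> = (\<Sum>N\<le>CARD('m). ?t N / fact N)"
    unfolding alt_inner_map[OF nd inner_product_nondegenerate[OF B] \<phi> \<alpha> \<alpha>]
    by (simp add: alt_inner_eq tensor_inner_def dual power2_eq_square)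
  have nonneg: "0 \<le> ?t N / fact N" for N by (intro divide_nonneg_nonneg sum_nonneg) auto
  then show "0 \<le> alt_inner B \<alpha> \<alpha>" unfolding eq by (rule sum_nonneg)
  assume "alt_inner B \<alpha> \<alpha> = 0"
  then have t0: "?t N / fact N = 0" if "N \<le> CARD('m)" for N
    using sum_nonneg_0[of "{..CARD('m)}" "\<lambda>N. ?t N / fact N" N] nonneg that unfolding eq by simp
  show "\<alpha> vs = 0"
  proof (cases "length vs \<le> CARD('m)")
    case True
    have "(?\<alpha> (map (\<lambda>i. axis i 1) is))\<^sup>2 = 0" if "length is = length vs" for "is"
      using t0[OF True] sum_nonneg_eq_0_iff[OF finite_lists_length, of "length vs" "\<lambda>is. (?\<alpha> (map (\<lambda>i. axis i 1) is))\<^sup>2"] that by auto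
    then have zero: "?\<alpha> ws = 0" if "length ws = length vs" for ws
      using alternating_zero_of_basis[OF alternating_map[OF \<alpha> \<phi>(1)], of ws] that by auto
    have "map \<phi> (map (inv \<phi>) vs) = vs" using \<phi>(2) by (simp add: o_def surj_f_inv_f)
    then show ?thesis using zero[of "map (inv \<phi>) vs"] by simp
  next
    case False
    then show ?thesis using alternating_zero_of_length[OF \<alpha>] by simp
  qed
qed

text \<open>The Gram matrix is the transpose of \<open>P\<close> times \<open>P\<close>, where
  \<open>P\<close> is the matrix of the inverse of an orthonormal frame. This makes the Riemannian
  density positive.\<close>

lemma det_inner_product_pos:
  fixes B :: "real ^ 'm::finite \<Rightarrow> real ^ 'm \<Rightarrow> real"
  assumes B: "inner_product B"
  shows "0 < det (\<chi> i j. B (axis i 1) (axis j 1))"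
proof -
  obtain \<phi> :: "real ^ 'm \<Rightarrow> real ^ 'm" where \<phi>: "linear \<phi>" "surj \<phi>" "\<And>u v. B (\<phi> u) (\<phi> v) = u \<bullet> v"
    using orthonormal_frame_exists[OF B] by blast
  define P where "P = matrix (inv \<phi>)"
  have inj: "inj \<phi>" using linear_surjective_imp_injective[OF \<phi>(1,2)] by simp
  have lin: "linear (inv \<phi>)"
    by (intro linearI inv_f_eq[OF inj])
      (simp_all add: linear_add[OF \<phi>(1)] linear_scale[OF \<phi>(1)] surj_f_inv_f[OF \<phi>(2)])
  have eq: "B u v = inv \<phi> u \<bullet> inv \<phi> v" for u v
    using \<phi>(3)[of "inv \<phi> u" "inv \<phi> v"] \<phi>(2) by (simp add: surj_f_inv_f)
  have "(\<chi> i j. B (axis i 1) (axis j 1)) = transpose P ** P"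
    by (simp add: vec_eq_iff eq P_def matrix_matrix_mult_def transpose_def matrix_def inner_vec_def)
  then have "det (\<chi> i j. B (axis i 1) (axis j 1)) = (det P)\<^sup>2"
    by (simp add: det_mul det_transpose power2_eq_square)
  moreover have "det P \<noteq> 0"
  proof -
    have "matrix \<phi> ** P = mat 1"
      unfolding P_def using matrix_compose[OF lin \<phi>(1)] \<phi>(2) by (simp add: o_def surj_f_inv_f matrix_id_mat_1[unfolded id_def])
    then have "det (matrix \<phi>) * det P = 1" by (metis det_I det_mul)
    then show ?thesis by auto
  qed
  ultimately show ?thesis by simp
qed

section \<open>The exterior derivative in a chart\<close>

lemma smooth_in_chart_det:
  fixes M :: "'a \<Rightarrow> real ^ 'n::finite ^ 'n"
  assumes "\<And>i j. smooth_in_chart c (\<lambda>q. M q $ i $ j)"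
  shows "smooth_in_chart c (\<lambda>q. det (M q))"
  unfolding det_def by (intro smooth_in_chart_sum smooth_in_chart_mult smooth_in_chart_prod smooth_in_chart_const assms)

lemma smooth_in_chart_dual_basis:
  fixes B :: "'a \<Rightarrow> real ^ 'm::finite \<Rightarrow> real ^ 'm \<Rightarrow> real"
  assumes "\<And>q. q \<in> fst c \<Longrightarrow> nondegenerate (B q)" "\<And>u v. smooth_in_chart c (\<lambda>q. B q u v)"
  shows "smooth_in_chart c (\<lambda>q. dual_basis (B q) i $ k)"
proof -
  let ?f = "\<lambda>v::real ^ 'm. v $ i"
  let ?N = "\<lambda>q. \<chi> i j. if j = k then ?f (axis i 1) else B q (axis j 1) (axis i 1)"
  let ?M = "\<lambda>q. \<chi> i j. B q (axis j 1) (axis i 1)"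
  have "smooth_in_chart c (\<lambda>q. ?N q $ a $ b)" for a b
    by (cases "b = k") (simp_all add: assms(2) smooth_in_chart_const)
  then have "smooth_in_chart c (\<lambda>q. det (?N q) / det (?M q))"
    by (intro smooth_in_chart_divide smooth_in_chart_det)
      (simp_all add: assms(2) dual_vec_component(1)[OF assms(1) linear_vec_nth])
  then show ?thesis
    by (rule smooth_in_chart_cong) (simp add: dual_vec_component(2)[OF assms(1) linear_vec_nth])
qed

abbreviation smooth_components :: "('a, 'm::finite) chart \<Rightarrow> ('a \<Rightarrow> 'v list \<Rightarrow> real) \<Rightarrow> bool" where
  "smooth_components c u \<equiv> (\<forall>vs. smooth_in_chart c (\<lambda>q. u q vs))"

lemma smooth_in_chart_insert_fields:
  fixes u :: "'a \<Rightarrow> (real ^ 'n::finite) list \<Rightarrow> real" and Ys :: "('a \<Rightarrow> real ^ 'n) list"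
  assumes "smooth_components c u" "\<And>q. q \<in> fst c \<Longrightarrow> alternating_multilinear (u q)"
    and "\<And>Y i. Y \<in> set Ys \<Longrightarrow> smooth_in_chart c (\<lambda>q. Y q $ i)"
  shows "smooth_in_chart c (\<lambda>q. u q (map (\<lambda>Y. Y q) Ys))"
  using assms
proof (induction Ys arbitrary: u)
  case (Cons Y Ys)
  have "smooth_in_chart c (\<lambda>q. contr x (u q) (map (\<lambda>Y. Y q) Ys))" for x
    by (rule Cons.IH) (use Cons.prems in \<open>simp_all add: alternating_contr[OF Cons.prems(2)]\<close>)
  then have "smooth_in_chart c (\<lambda>q. \<Sum>i\<in>UNIV. Y q $ i * contr (axis i 1) (u q) (map (\<lambda>Y. Y q) Ys))"
    using Cons.prems by (intro smooth_in_chart_sum smooth_in_chart_mult) auto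
  then show ?case
    by (rule smooth_in_chart_cong)
      (simp add: alternating_expand[OF alternating_linear[OF Cons.prems(2)], symmetric])
qed simp

text \<open>The product rule for a form evaluated on variable vector fields: either all fields are
  frozen, or exactly one of them is differentiated. It is applied to fields obtained from the
  Jacobian of a transition map.\<close>

lemma chart_deriv_insert_fields:
  fixes u :: "'a \<Rightarrow> (real ^ 'n::finite) list \<Rightarrow> real" and Ys :: "('a \<Rightarrow> real ^ 'n) list"
    and v :: "real ^ 'm::finite"
  assumes c: "good_chart c" "p \<in> fst c"
    and "smooth_components c u" "\<And>q. q \<in> fst c \<Longrightarrow> alternating_multilinear (u q)"
    and "\<And>Y i. Y \<in> set Ys \<Longrightarrow> smooth_in_chart c (\<lambda>q. Y q $ i)"
  defines "D \<equiv> \<lambda>Y. \<chi> i. chart_deriv c (\<lambda>q. Y q $ i) p v"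
  shows "chart_deriv c (\<lambda>q. u q (map (\<lambda>Y. Y q) Ys)) p v =
    chart_deriv c (\<lambda>q. u q (map (\<lambda>Y. Y p) Ys)) p v
    + (\<Sum>j<length Ys. u p ((map (\<lambda>Y. Y p) Ys)[j := D (Ys ! j)]))"
  using assms(3-5)
proof (induction Ys arbitrary: u)
  case (Cons Y Ys)
  let ?L = "\<lambda>q. map (\<lambda>Y. Y q) Ys"
  note lin = alternating_linear[OF Cons.prems(2)]
  have sm: "smooth_in_chart c (\<lambda>q. u q (x # ?L q))" for x
    by (rule smooth_in_chart_insert_fields) (use Cons.prems in \<open>simp_all add: alternating_contr[OF Cons.prems(2)]\<close>)
  have smY: "smooth_in_chart c (\<lambda>q. Y q $ i)" for i using Cons.prems by simp
  have smc: "smooth_in_chart c (\<lambda>q. u q ws)" for ws using Cons.prems by simp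
  have "chart_deriv c (\<lambda>q. u q (Y q # ?L q)) p v = chart_deriv c (\<lambda>q. \<Sum>i\<in>UNIV. Y q $ i * u q (axis i 1 # ?L q)) p v"
    by (rule chart_deriv_cong[OF _ c(2)]) (simp add: alternating_expand[OF lin, symmetric])
  also have "\<dots> = (\<Sum>i\<in>UNIV. Y p $ i * chart_deriv c (\<lambda>q. u q (axis i 1 # ?L q)) p v + D Y $ i * u p (axis i 1 # ?L p))"
    by (simp add: chart_deriv_sum[OF c] chart_deriv_mult[OF c] smooth_in_chart_mult sm smY D_def)
  also have "\<dots> = (\<Sum>i\<in>UNIV. Y p $ i * chart_deriv c (\<lambda>q. u q (axis i 1 # ?L q)) p v) + u p (D Y # ?L p)"
    by (simp add: sum.distrib alternating_expand[OF lin[OF c(2)], symmetric])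
  also have "(\<Sum>i\<in>UNIV. Y p $ i * chart_deriv c (\<lambda>q. u q (axis i 1 # ?L q)) p v) =
    (\<Sum>i\<in>UNIV. Y p $ i * chart_deriv c (\<lambda>q. u q (axis i 1 # ?L p)) p v)
    + (\<Sum>i\<in>UNIV. Y p $ i * (\<Sum>j<length Ys. u p (axis i 1 # (?L p)[j := D (Ys ! j)])))"
    using Cons.IH[of "\<lambda>q. contr (axis _ 1) (u q)"] Cons.prems alternating_contr[OF Cons.prems(2)]
    by (simp add: sum.distrib[symmetric] distrib_left)
  also have "(\<Sum>i\<in>UNIV. Y p $ i * chart_deriv c (\<lambda>q. u q (axis i 1 # ?L p)) p v)
      = chart_deriv c (\<lambda>q. \<Sum>i\<in>UNIV. Y p $ i * u q (axis i 1 # ?L p)) p v"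
    by (simp add: chart_deriv_sum[OF c] chart_deriv_cmult[OF c] smooth_in_chart_mult smooth_in_chart_const smc)
  also have "\<dots> = chart_deriv c (\<lambda>q. u q (Y p # ?L p)) p v"
    by (rule chart_deriv_cong[OF _ c(2)]) (simp add: alternating_expand[OF lin, symmetric])
  also have "(\<Sum>i\<in>UNIV. Y p $ i * (\<Sum>j<length Ys. u p (axis i 1 # (?L p)[j := D (Ys ! j)])))
      = (\<Sum>j<length Ys. u p (Y p # (?L p)[j := D (Ys ! j)]))"
    unfolding sum_distrib_left by (subst sum.swap) (simp add: alternating_expand[OF lin[OF c(2)], symmetric])
  finally show ?case
    by (simp add: sum.lessThan_Suc_shift algebra_simps del: sum.lessThan_Suc)
qed simp

lemma alt_sum_map: "alt_sum G (map \<phi> vs) = alt_sum (\<lambda>v ws. G (\<phi> v) (map \<phi> ws)) vs"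
  by (simp add: alt_sum_def take_map drop_map)

text \<open>The second derivatives of a change of coordinates do not contribute to the exterior derivative.\<close>

lemma alt_sum_symmetric_zero:
  assumes "alternating_multilinear \<alpha>" and sym: "\<And>v w. S v w = S w v"
  shows "alt_sum (\<lambda>v ws. \<Sum>j<length ws. \<alpha> ((map \<phi> ws)[j := S v (ws ! j)])) vs = 0"
  using assms(1)
proof (induction vs arbitrary: \<alpha>)
  case (Cons v vs)
  have "alt_sum (\<lambda>w ws. \<Sum>j<length (v # ws). \<alpha> ((map \<phi> (v # ws))[j := S w ((v # ws) ! j)])) vs
     = alt_sum (\<lambda>w ws. \<alpha> (S w v # map \<phi> ws)) vs
      + alt_sum (\<lambda>w ws. \<Sum>j<length ws. contr (\<phi> v) \<alpha> ((map \<phi> ws)[j := S w (ws ! j)])) vs"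
    by (simp add: alt_sum_add[symmetric] sum.lessThan_Suc_shift del: sum.lessThan_Suc)
  also have "\<dots> = alt_sum (\<lambda>w ws. \<alpha> (S w v # map \<phi> ws)) vs"
    using Cons.IH[OF alternating_contr[OF Cons.prems]] by simp
  \<comment> \<open>Moving S w v from the front to the place of w cancels the alternating sign. By
    symmetry of \<open>S\<close> the result is the term that belongs to the first argument v, so the
    two cancel.\<close>
  also have "\<dots> = (\<Sum>j<length vs. \<alpha> ((map \<phi> vs)[j := S v (vs ! j)]))"
    unfolding alt_sum_def
    using alternating_move_front[OF Cons.prems, of _ "map \<phi> vs"] by (simp add: take_map drop_map sym)
  finally show ?case by (simp add: alt_sum_Cons)
qed simp

text \<open>The exterior derivative in one chart, for arbitrary families \<open>u\<close>.
  Contractions and graded signs of a form may be inserted, as the inductions on the argument list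
  require.\<close>

definition chart_d :: "('a, 'm::finite) chart \<Rightarrow> ('a \<Rightarrow> (real ^ 'm) list \<Rightarrow> real) \<Rightarrow> 'a \<Rightarrow> (real ^ 'm) list \<Rightarrow> real" where
  "chart_d c u p vs = alt_sum (\<lambda>v ws. chart_deriv c (\<lambda>q. u q ws) p v) vs"

lemma ext_d_eq: "ext_d A \<eta> c p vs = (if c \<in> A \<and> p \<in> fst c then chart_d c (\<eta> c) p vs else 0)"
  by (simp add: ext_d_def chart_d_def alt_sum_def)

lemma chart_d_Nil [simp]: "chart_d c u p [] = 0"
  by (simp add: chart_d_def)

text \<open>Cartan's formula for a constant vector field v: the contraction of the differential and
  the differential of the contraction add up to the directional derivative.\<close>

lemma chart_d_Cons:
  "chart_d c u p (v # vs) = chart_deriv c (\<lambda>q. u q vs) p v - chart_d c (\<lambda>q. contr v (u q)) p vs"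
  by (simp add: chart_d_def alt_sum_Cons)

lemma smooth_chart_d:
  assumes "good_chart c" "smooth_components c u"
  shows "smooth_in_chart c (\<lambda>q. chart_d c u q vs)"
  unfolding chart_d_def alt_sum_def
  using assms by (intro smooth_in_chart_sum smooth_in_chart_mult smooth_in_chart_const smooth_in_chart_deriv) auto

lemma chart_d_lincomb:
  assumes "good_chart c" "p \<in> fst c" "smooth_components c u" "smooth_components c u'"
  shows "chart_d c (\<lambda>q ws. a * u q ws + b * u' q ws) p vs = a * chart_d c u p vs + b * chart_d c u' p vs"
  unfolding chart_d_def alt_sum_lincomb[symmetric] using assms
  by (simp add: chart_deriv_add chart_deriv_cmult smooth_in_chart_mult smooth_in_chart_const)

lemma chart_d_cong: "p \<in> fst c \<Longrightarrow> (\<And>q ws. q \<in> fst c \<Longrightarrow> u q ws = u' q ws) \<Longrightarrow> chart_d c u p vs = chart_d c u' p vs"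
  unfolding chart_d_def by (intro alt_sum_cong chart_deriv_cong)

lemma chart_deriv_alt_sum:
  assumes "good_chart c" "p \<in> fst c" "\<And>w ws. smooth_in_chart c (\<lambda>q. G q w ws)"
  shows "chart_deriv c (\<lambda>q. alt_sum (G q) vs) p v = alt_sum (\<lambda>w ws. chart_deriv c (\<lambda>q. G q w ws) p v) vs"
  unfolding alt_sum_def using assms
  by (simp add: chart_deriv_sum chart_deriv_cmult smooth_in_chart_mult smooth_in_chart_const)

text \<open>Directional derivatives along constant fields commute with each other and hence with
  \<open>chart_d\<close>. Cartan's formula, used twice, then reduces the claim to the contraction of
  \<open>u\<close>.\<close>

lemma chart_d_chart_d:
  assumes c: "good_chart c" "p \<in> fst c" and "smooth_components c u"
  shows "chart_d c (chart_d c u) p vs = 0"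
  using assms(3)
proof (induction vs arbitrary: u)
  case (Cons v vs)
  have sm: "smooth_components c (\<lambda>q ws. chart_deriv c (\<lambda>r. u r ws) q v)"
    "smooth_components c (\<lambda>q. chart_d c (\<lambda>r. contr v (u r)) q)"
    using c(1) Cons.prems by (auto intro: smooth_in_chart_deriv smooth_chart_d)
  have "chart_d c (\<lambda>q. contr v (chart_d c u q)) p vs =
      chart_d c (\<lambda>q ws. 1 * chart_deriv c (\<lambda>r. u r ws) q v + (- 1) * chart_d c (\<lambda>r. contr v (u r)) q ws) p vs"
    by (simp add: chart_d_Cons)
  also have "\<dots> = chart_d c (\<lambda>q ws. chart_deriv c (\<lambda>r. u r ws) q v) p vs"
    unfolding chart_d_lincomb[OF c sm] using Cons.IH[of "\<lambda>q. contr v (u q)"] Cons.prems by simp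
  also have "\<dots> = chart_deriv c (\<lambda>q. chart_d c u q vs) p v"
    unfolding chart_d_def using Cons.prems c
    by (simp add: chart_deriv_alt_sum smooth_in_chart_deriv chart_deriv_commute[OF c, of _ v])
  finally show ?case by (simp add: chart_d_Cons)
qed simp

lemma chart_deriv_wedge:
  assumes "good_chart c" "p \<in> fst c" "smooth_components c a" "smooth_components c b"
  shows "chart_deriv c (\<lambda>q. wedge (a q) (b q) vs) p v =
    wedge (\<lambda>ws. chart_deriv c (\<lambda>q. a q ws) p v) (b p) vs + wedge (a p) (\<lambda>ws. chart_deriv c (\<lambda>q. b q ws) p v) vs"
  unfolding wedge_def using assms
  by (simp add: chart_deriv_sum chart_deriv_cmult chart_deriv_mult chart_deriv_const mult.assoc smooth_in_chart_mult smooth_in_chart_const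
      sum.distrib[symmetric] algebra_simps)

lemma smooth_wedge:
  assumes "smooth_components c a" "smooth_components c b"
  shows "smooth_in_chart c (\<lambda>q. wedge (a q) (b q) vs)"
  unfolding wedge_def using assms
  by (intro smooth_in_chart_sum smooth_in_chart_mult smooth_in_chart_const) auto

lemma chart_d_graded_sign:
  assumes "good_chart c" "p \<in> fst c" "smooth_components c u"
  shows "chart_d c (\<lambda>q. graded_sign (u q)) p = (\<lambda>vs. - graded_sign (chart_d c u p) vs)"
proof
  fix vs :: "(real ^ 'b) list"
  have "chart_d c (\<lambda>q. graded_sign (u q)) p vs =
      alt_sum (\<lambda>v ws. (-1) ^ length ws * chart_deriv c (\<lambda>q. u q ws) p v) vs"
    unfolding chart_d_def graded_sign_def using assms by (simp add: chart_deriv_cmult)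
  also have "\<dots> = alt_sum (\<lambda>v ws. - ((-1) ^ length vs) * chart_deriv c (\<lambda>q. u q ws) p v + 0 * 0) vs"
    by (rule alt_sum_cong, drule sym) simp
  also have "\<dots> = - graded_sign (chart_d c u p) vs"
    unfolding alt_sum_lincomb by (simp add: graded_sign_def chart_d_def)
  finally show "chart_d c (\<lambda>q. graded_sign (u q)) p vs = - graded_sign (chart_d c u p) vs" .
qed

text \<open>Induction on the arguments: contraction is an antiderivation, the directional derivative
  is a derivation, and Cartan's formula combines the two. The graded sign is that of moving the
  differential past \<open>a\<close>.\<close>

lemma chart_d_wedge:
  assumes c: "good_chart c" "p \<in> fst c" and "smooth_components c a" "smooth_components c b"
  shows "chart_d c (\<lambda>q. wedge (a q) (b q)) p vs =
    wedge (chart_d c a p) (b p) vs + wedge (graded_sign (a p)) (chart_d c b p) vs"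
  using assms(3,4)
proof (induction vs arbitrary: a b)
  case Nil
  show ?case by (simp add: wedge_Nil)
next
  case (Cons v vs)
  let ?a = "\<lambda>q. contr v (a q)" and ?b = "\<lambda>q. contr v (b q)" and ?s = "\<lambda>q. graded_sign (a q)"
  have sm: "smooth_components c ?a" "smooth_components c ?b" "smooth_components c ?s"
    using Cons.prems by (auto simp: graded_sign_def intro!: smooth_in_chart_mult smooth_in_chart_const)
  have "chart_d c (\<lambda>q. contr v (wedge (a q) (b q))) p vs =
     chart_d c (\<lambda>q ws. 1 * wedge (?a q) (b q) ws + 1 * wedge (?s q) (?b q) ws) p vs"
    by (simp add: wedge_Cons)
  also have "\<dots> = chart_d c (\<lambda>q. wedge (?a q) (b q)) p vs + chart_d c (\<lambda>q. wedge (?s q) (?b q)) p vs"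
    by (subst chart_d_lincomb[OF c]) (use sm Cons.prems in \<open>auto intro: smooth_wedge\<close>)
  also have "\<dots> = wedge (chart_d c ?a p) (b p) vs + wedge (graded_sign (?a p)) (chart_d c b p) vs
      + (- wedge (graded_sign (chart_d c a p)) (?b p) vs + wedge (a p) (chart_d c ?b p) vs)"
    unfolding Cons.IH[OF sm(1) Cons.prems(2)] Cons.IH[OF sm(3,2)]
    by (simp add: chart_d_graded_sign[OF c Cons.prems(1)] wedge_minus_left)
  finally have eq: "chart_d c (\<lambda>q. contr v (wedge (a q) (b q))) p vs = \<dots>" .
  have "contr v (chart_d c a p) = (\<lambda>ws. 1 * chart_deriv c (\<lambda>q. a q ws) p v + (-1) * chart_d c ?a p ws)"
    "contr v (chart_d c b p) = (\<lambda>ws. 1 * chart_deriv c (\<lambda>q. b q ws) p v + (-1) * chart_d c ?b p ws)"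
    by (simp_all add: chart_d_Cons fun_eq_iff)
  then have "wedge (contr v (chart_d c a p)) (b p) vs =
        wedge (\<lambda>ws. chart_deriv c (\<lambda>q. a q ws) p v) (b p) vs - wedge (chart_d c ?a p) (b p) vs"
    "wedge (a p) (contr v (chart_d c b p)) vs =
        wedge (a p) (\<lambda>ws. chart_deriv c (\<lambda>q. b q ws) p v) vs - wedge (a p) (chart_d c ?b p) vs"
    by (simp_all only: wedge_lincomb_left wedge_lincomb_right)
  moreover have "chart_d c (\<lambda>q. wedge (a q) (b q)) p (v # vs) =
      chart_deriv c (\<lambda>q. wedge (a q) (b q) vs) p v - chart_d c (\<lambda>q. contr v (wedge (a q) (b q))) p vs"
    by (rule chart_d_Cons)
  ultimately show ?case
    unfolding eq chart_deriv_wedge[OF c Cons.prems]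
    by (simp add: wedge_Cons[of _ _ v] contr_graded_sign wedge_minus_left)
qed

text \<open>The second summand is the wedge product of df with \<open>u\<close>.\<close>

lemma chart_d_scale:
  assumes c: "good_chart c" "p \<in> fst c" and "smooth_in_chart c f" "smooth_components c u"
  shows "chart_d c (\<lambda>q ws. f q * u q ws) p vs =
    f p * chart_d c u p vs + alt_sum (\<lambda>v ws. chart_deriv c f p v * u p ws) vs"
proof -
  have "chart_d c (\<lambda>q ws. f q * u q ws) p vs =
     alt_sum (\<lambda>v ws. f p * chart_deriv c (\<lambda>q. u q ws) p v + 1 * (chart_deriv c f p v * u p ws)) vs"
    unfolding chart_d_def using assms by (simp add: chart_deriv_mult)
  then show ?thesis unfolding alt_sum_lincomb by (simp add: chart_d_def)
qed

lemma alternating_chart_d: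
  assumes c: "good_chart c" "p \<in> fst c" and u: "smooth_components c u" "\<And>q. q \<in> fst c \<Longrightarrow> alternating_multilinear (u q)"
  shows "alternating_multilinear (chart_d c u p)"
proof -
  have "alternating_multilinear (\<lambda>ws. chart_deriv c (\<lambda>q. u q ws) p v)" for v
    unfolding alternating_multilinear_def
  proof (intro conjI allI impI)
    fix vs :: "(real ^ 'b) list"
    show "linear (\<lambda>x. chart_deriv c (\<lambda>q. u q (vs[i := x])) p v)" if i: "i < length vs" for i
    proof (rule linearI)
      fix x y :: "real ^ 'b" and a :: real
      note lin = alternating_linear_nth[OF u(2) i]
      have "chart_deriv c (\<lambda>q. u q (vs[i := x + y])) p v = chart_deriv c (\<lambda>q. u q (vs[i := x]) + u q (vs[i := y])) p v"
        by (rule chart_deriv_cong[OF _ c(2)]) (simp add: linear_add[OF lin])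
      then show "chart_deriv c (\<lambda>q. u q (vs[i := x + y])) p v =
          chart_deriv c (\<lambda>q. u q (vs[i := x])) p v + chart_deriv c (\<lambda>q. u q (vs[i := y])) p v"
        using u(1) by (simp add: chart_deriv_add[OF c])
      have "chart_deriv c (\<lambda>q. u q (vs[i := a *\<^sub>R x])) p v = chart_deriv c (\<lambda>q. a * u q (vs[i := x])) p v"
        by (rule chart_deriv_cong[OF _ c(2)]) (simp add: linear_scale[OF lin])
      then show "chart_deriv c (\<lambda>q. u q (vs[i := a *\<^sub>R x])) p v = a *\<^sub>R chart_deriv c (\<lambda>q. u q (vs[i := x])) p v"
        using u(1) by (simp add: chart_deriv_cmult[OF c])
    qed
    show "chart_deriv c (\<lambda>q. u q vs) p v = 0" if ij: "j < length vs" "i < j" "vs ! i = vs ! j" for i j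
    proof -
      have "chart_deriv c (\<lambda>q. u q vs) p v = chart_deriv c (\<lambda>q. 0) p v"
        by (rule chart_deriv_cong[OF _ c(2)]) (use u(2) ij in \<open>auto simp: alternating_multilinear_def\<close>)
      then show ?thesis by (simp add: chart_deriv_const[OF c])
    qed
  qed
  moreover have "linear (\<lambda>v. chart_deriv c (\<lambda>q. u q ws) p v)" for ws
    using chart_deriv_linear[OF _ c(2), of "\<lambda>q. u q ws"] u(1) by simp
  ultimately show ?thesis unfolding chart_d_def[abs_def] by (rule alternating_alt_sum)
qed

section \<open>Forms on a manifold and first-order operators\<close>

text \<open>Forms are real-valued functions of several arguments. The pointwise vector space
  structure makes \<open>linear\<close> and the rules for \<open>scaleR\<close> applicable to
  operators on forms.\<close>

instantiation "fun" :: (type, real_vector) real_vector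
begin

definition "scaleR r f = (\<lambda>x. r *\<^sub>R f x)"

instance
  by standard (simp_all add: scaleR_fun_def fun_eq_iff scaleR_add_right scaleR_add_left)

end

lemma scaleR_fun_apply [simp]: "(r *\<^sub>R f) x = r *\<^sub>R f x"
  by (simp add: scaleR_fun_def)

lemma form_add_eq: "form_add \<alpha> \<beta> = \<alpha> + \<beta>"
  and form_diff_eq: "form_diff \<alpha> \<beta> = \<alpha> - \<beta>"
  and zero_form_eq: "(\<lambda>c p vs. 0 :: real) = 0"
  by (simp_all add: form_add_def form_diff_def fun_eq_iff)

lemma form_scale_apply: "form_scale f \<eta> c p vs = f p * \<eta> c p vs"
  by (simp add: form_scale_def)

lemma form_scale_const: "form_scale (\<lambda>p. r) \<eta> = r *\<^sub>R \<eta>"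
  and form_scale_add: "form_scale f (\<eta> + \<zeta>) = form_scale f \<eta> + form_scale f \<zeta>"
  and form_scale_diff: "form_scale f (\<eta> - \<zeta>) = form_scale f \<eta> - form_scale f \<zeta>"
  and form_scale_zero: "form_scale f 0 = 0"
  and form_scale_scaleR: "form_scale f (r *\<^sub>R \<eta>) = r *\<^sub>R form_scale f \<eta>"
  and form_scale_mult: "form_scale (\<lambda>p. f p * h p) \<eta> = form_scale f (form_scale h \<eta>)"
  by (simp_all add: form_scale_def fun_eq_iff algebra_simps)

lemma form_scale_commute: "form_scale f (form_scale h \<eta>) = form_scale h (form_scale f \<eta>)"
  by (simp add: form_scale_def fun_eq_iff)

text \<open>The step of the descending induction in \<open>second_commutator\<close>, where
  \<open>f\<close> is the operator L and \<open>r\<close> a nonzero sum of weights.\<close>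

lemma scaleR_zero_of_diff:
  fixes c :: "'x::real_vector"
  shows "f a = b - r *\<^sub>R c \<Longrightarrow> a = 0 \<Longrightarrow> b = 0 \<Longrightarrow> f 0 = 0 \<Longrightarrow> r \<noteq> 0 \<Longrightarrow> c = 0"
  by simp

context bordered_manifold
begin

lemma forms_outside: "\<eta> \<in> forms A k \<Longrightarrow> c \<notin> A \<or> p \<notin> fst c \<or> int (length vs) \<noteq> k \<Longrightarrow> \<eta> c p vs = 0"
  unfolding forms_def mem_Collect_eq by blast

lemma forms_alternating: "\<eta> \<in> forms A k \<Longrightarrow> c \<in> A \<Longrightarrow> p \<in> fst c \<Longrightarrow> alternating_multilinear (\<eta> c p)"
  by (simp add: forms_def)

lemma forms_smooth: "\<eta> \<in> forms A k \<Longrightarrow> c \<in> A \<Longrightarrow> smooth_in_chart c (\<lambda>p. \<eta> c p vs)"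
  by (simp add: forms_def)

lemma forms_change:
  "\<eta> \<in> forms A k \<Longrightarrow> c \<in> A \<Longrightarrow> c' \<in> A \<Longrightarrow> p \<in> fst c \<Longrightarrow> p \<in> fst c' \<Longrightarrow>
    \<eta> c p vs = \<eta> c' p (map (chart_deriv c (snd c') p) vs)"
  unfolding forms_def mem_Collect_eq by blast

lemma formsI:
  assumes "\<And>c p vs. c \<notin> A \<or> p \<notin> fst c \<or> int (length vs) \<noteq> k \<Longrightarrow> \<eta> c p vs = 0"
    and "\<And>c p. c \<in> A \<Longrightarrow> p \<in> fst c \<Longrightarrow> alternating_multilinear (\<eta> c p)"
    and "\<And>c vs. c \<in> A \<Longrightarrow> smooth_in_chart c (\<lambda>p. \<eta> c p vs)"
    and "\<And>c c' p vs. c \<in> A \<Longrightarrow> c' \<in> A \<Longrightarrow> p \<in> fst c \<Longrightarrow> p \<in> fst c' \<Longrightarrow>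
      \<eta> c p vs = \<eta> c' p (map (chart_deriv c (snd c') p) vs)"
  shows "\<eta> \<in> forms A k"
  unfolding forms_def mem_Collect_eq
  by (intro conjI allI ballI impI; (rule assms(1) | rule assms(2) | rule assms(3) | rule assms(4))) auto

lemma forms_0: "0 \<in> forms A k"
  by (rule formsI) (auto simp: smooth_in_chart_const alternating_zero zero_fun_def)

lemma forms_add:
  assumes "\<eta> \<in> forms A k" "\<zeta> \<in> forms A k"
  shows "\<eta> + \<zeta> \<in> forms A k"
proof (rule formsI)
  show "(\<eta> + \<zeta>) c p vs = (\<eta> + \<zeta>) c' p (map (chart_deriv c (snd c') p) vs)"
    if "c \<in> A" "c' \<in> A" "p \<in> fst c" "p \<in> fst c'" for c c' p vs
    using forms_change[OF assms(1) that] forms_change[OF assms(2) that] by simp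
  show "alternating_multilinear ((\<eta> + \<zeta>) c p)" if "c \<in> A" "p \<in> fst c" for c p
    using alternating_add[OF forms_alternating[OF assms(1) that] forms_alternating[OF assms(2) that]]
    by (simp add: plus_fun_def)
qed (use forms_outside[OF assms(1)] forms_outside[OF assms(2)] forms_smooth[OF assms(1)] forms_smooth[OF assms(2)]
    in \<open>auto intro: smooth_in_chart_add\<close>)

lemma forms_scale:
  assumes "smooth_function A f" "\<eta> \<in> forms A k"
  shows "form_scale f \<eta> \<in> forms A k"
proof (rule formsI)
  show "form_scale f \<eta> c p vs = form_scale f \<eta> c' p (map (chart_deriv c (snd c') p) vs)"
    if "c \<in> A" "c' \<in> A" "p \<in> fst c" "p \<in> fst c'" for c c' p vs
    using forms_change[OF assms(2) that] by (simp add: form_scale_def)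
  show "alternating_multilinear (form_scale f \<eta> c p)" if "c \<in> A" "p \<in> fst c" for c p
    using alternating_cmult[OF forms_alternating[OF assms(2) that]] by (simp add: form_scale_def)
  show "smooth_in_chart c (\<lambda>p. form_scale f \<eta> c p vs)" if "c \<in> A" for c vs
    using smooth_in_chart_mult[OF _ forms_smooth[OF assms(2) that]] assms(1) that
    by (simp add: form_scale_def smooth_function_def)
qed (use forms_outside[OF assms(2)] in \<open>auto simp: form_scale_def\<close>)

lemma forms_scaleR: "\<eta> \<in> forms A k \<Longrightarrow> r *\<^sub>R \<eta> \<in> forms A k"
  using forms_scale[OF smooth_function_const] by (simp add: form_scale_const)

lemma forms_diff: "\<eta> \<in> forms A k \<Longrightarrow> \<zeta> \<in> forms A k \<Longrightarrow> \<eta> - \<zeta> \<in> forms A k"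
  using forms_add[OF _ forms_scaleR[of \<zeta> k "-1"]] by simp

lemma forms_neg_degree: "\<eta> \<in> forms A k \<Longrightarrow> k < 0 \<Longrightarrow> \<eta> = 0"
  using forms_outside by (fastforce simp: fun_eq_iff)

lemma forms_large_degree:
  assumes "\<eta> \<in> forms A k" "k > int CARD('m)"
  shows "\<eta> = 0"
proof -
  have "\<eta> c p vs = 0" for c p vs
    using forms_outside[OF assms(1)] alternating_zero_of_length[OF forms_alternating[OF assms(1)], of c p vs] assms(2)
    by (metis of_nat_less_iff)
  then show ?thesis by (simp add: fun_eq_iff)
qed

lemma transition_deriv_component:
  assumes c: "c \<in> A" "c' \<in> A" and q: "q \<in> fst (overlap c c')"
  shows "chart_deriv c (snd c') q w $ i = chart_deriv (overlap c c') (\<lambda>r. snd c' r $ i) q w"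
  using chart_deriv_linear_comp[OF good_overlap[OF c] q smooth_transition[OF c] bounded_linear_vec_nth, of i w]
    chart_deriv_overlap[OF c _ _ smooth_transition[OF c], of q] q by simp

lemma smooth_transition_deriv:
  assumes c: "c \<in> A" "c' \<in> A"
  shows "smooth_in_chart (overlap c c') (\<lambda>q. chart_deriv c (snd c') q w $ i)"
  by (rule smooth_in_chart_cong[OF smooth_in_chart_deriv[OF good_overlap[OF c]]])
    (use transition_deriv_component[OF c] smooth_in_chart_linear_comp[OF bounded_linear_vec_nth smooth_transition[OF c]] in auto)

lemma ext_d_in_forms:
  assumes \<eta>: "\<eta> \<in> forms A k"
  shows "ext_d A \<eta> \<in> forms A (k + 1)"
proof (rule formsI)
  fix c :: "('a, 'm) chart" and p and vs :: "(real ^ 'm) list"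
  assume out: "c \<notin> A \<or> p \<notin> fst c \<or> int (length vs) \<noteq> k + 1"
  show "ext_d A \<eta> c p vs = 0"
  proof (cases "c \<in> A \<and> p \<in> fst c")
    case True
    then have len: "int (length vs) \<noteq> k + 1" using out by blast
    have "chart_d c (\<eta> c) p vs = alt_sum (\<lambda>v ws. 0 * 0 + 0 * (0::real)) vs"
      unfolding chart_d_def
    proof (rule alt_sum_cong)
      fix w :: "real ^ 'm" and ws :: "(real ^ 'm) list" assume "Suc (length ws) = length vs"
      then have "(\<lambda>q. \<eta> c q ws) = (\<lambda>q. 0)" using forms_outside[OF \<eta>, of c _ ws] len by auto
      then show "chart_deriv c (\<lambda>q. \<eta> c q ws) p w = 0 * 0 + 0 * (0::real)"
        using chart_deriv_const[of c p 0] True by simp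
    qed
    then show ?thesis using True by (simp add: ext_d_eq alt_sum_def)
  qed (auto simp: ext_d_eq)
next
  show "alternating_multilinear (ext_d A \<eta> c p)" if c: "c \<in> A" "p \<in> fst c" for c p
  proof -
    have "ext_d A \<eta> c p = chart_d c (\<eta> c) p" using c by (auto simp: ext_d_eq)
    then show ?thesis using alternating_chart_d[of c p "\<eta> c"] c forms_smooth[OF \<eta>] forms_alternating[OF \<eta>] by simp
  qed
  show "smooth_in_chart c (\<lambda>p. ext_d A \<eta> c p vs)" if "c \<in> A" for c vs
    by (rule smooth_in_chart_cong[OF smooth_chart_d[of c "\<eta> c" vs]]) (use that forms_smooth[OF \<eta>] in \<open>auto simp: ext_d_eq\<close>)
next
  fix c c' :: "('a, 'm) chart" and p and vs :: "(real ^ 'm) list"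
  assume c: "c \<in> A" "c' \<in> A" "p \<in> fst c" "p \<in> fst c'"
  let ?o = "overlap c c'" and ?F = "\<lambda>q. chart_deriv c (snd c') q"
  define S where "S = (\<lambda>v w. \<chi> i. chart_deriv ?o (\<lambda>q. ?F q w $ i) p v)"
  have o: "good_chart ?o" "p \<in> fst ?o" using c by auto
  note Fsm = smooth_transition_deriv[OF c(1,2)] and Feq = transition_deriv_component[OF c(1,2)]
  have sym: "S v w = S w v" for v w
  proof -
    have "chart_deriv ?o (\<lambda>q. ?F q w $ i) p v = chart_deriv ?o (\<lambda>q. chart_deriv ?o (\<lambda>r. snd c' r $ i) q w) p v" for i v w
      by (rule chart_deriv_cong[OF Feq o(2)])
    then show ?thesis
      unfolding S_def
      using chart_deriv_commute[OF o smooth_in_chart_linear_comp[OF bounded_linear_vec_nth smooth_transition[OF c(1,2)]]]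
      by simp
  qed
  \<comment> \<open>Differentiating the transformation law of \<eta> also differentiates the
    Jacobian \<open>?F\<close>. The extra terms contain \<open>S\<close>, the second derivative of
    the transition map, and cancel in the alternating sum because \<open>S\<close> is
    symmetric.\<close>
  have "chart_deriv c (\<lambda>q. \<eta> c q ws) p v =
     chart_deriv c' (\<lambda>q. \<eta> c' q (map (?F p) ws)) p (?F p v)
     + (\<Sum>j<length ws. \<eta> c' p ((map (?F p) ws)[j := S v (ws ! j)]))" for v ws
  proof -
    let ?Ys = "map (\<lambda>w q. ?F q w) ws"
    have u: "smooth_components ?o (\<eta> c')" "\<And>q. q \<in> fst ?o \<Longrightarrow> alternating_multilinear (\<eta> c' q)"
      using smooth_overlap[OF c(1,2) forms_smooth[OF \<eta> c(2)]] forms_alternating[OF \<eta> c(2)] by auto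
    have Ysm: "\<And>Y i. Y \<in> set ?Ys \<Longrightarrow> smooth_in_chart ?o (\<lambda>q. Y q $ i)" using Fsm by auto
    have map: "map (\<lambda>Y. Y q) ?Ys = map (?F q) ws" for q by simp
    have "chart_deriv c (\<lambda>q. \<eta> c q ws) p v = chart_deriv ?o (\<lambda>q. \<eta> c' q (map (\<lambda>Y. Y q) ?Ys)) p v"
      by (rule fun_cong[OF chart_deriv_overlap[OF c smooth_in_chart_insert_fields[OF u Ysm]]])
        (use forms_change[OF \<eta> c(1,2)] in \<open>auto simp: o_def\<close>)
    also have "\<dots> = chart_deriv ?o (\<lambda>q. \<eta> c' q (map (?F p) ws)) p v
        + (\<Sum>j<length ws. \<eta> c' p ((map (?F p) ws)[j := S v (ws ! j)]))"
      using chart_deriv_insert_fields[where Ys="?Ys" and v=v, OF o u Ysm] unfolding map by (simp add: S_def)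
    also have "chart_deriv ?o (\<lambda>q. \<eta> c' q (map (?F p) ws)) p v = chart_deriv c' (\<lambda>q. \<eta> c' q (map (?F p) ws)) p (?F p v)"
      using chart_deriv_chain[OF c forms_smooth[OF \<eta> c(2)], of "map (?F p) ws" v]
        chart_deriv_overlap[OF c smooth_overlap[OF c(1,2) forms_smooth[OF \<eta> c(2)]], of "map (?F p) ws"] by simp
    finally show ?thesis .
  qed
  then have "chart_d c (\<eta> c) p vs = chart_d c' (\<eta> c') p (map (?F p) vs)"
    unfolding chart_d_def alt_sum_map
    by (simp add: alt_sum_add alt_sum_symmetric_zero[where S=S, OF forms_alternating[OF \<eta> c(2,4)] sym])
  then show "ext_d A \<eta> c p vs = ext_d A \<eta> c' p (map (?F p) vs)"
    using c by (simp add: ext_d_eq)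
qed

lemma ext_d_lincomb:
  assumes "\<eta> \<in> forms A k" "\<zeta> \<in> forms A l"
  shows "ext_d A (a *\<^sub>R \<eta> + b *\<^sub>R \<zeta>) = a *\<^sub>R ext_d A \<eta> + b *\<^sub>R ext_d A \<zeta>"
proof -
  have "chart_d c ((a *\<^sub>R \<eta> + b *\<^sub>R \<zeta>) c) p vs = a * chart_d c (\<eta> c) p vs + b * chart_d c (\<zeta> c) p vs"
    if "c \<in> A" "p \<in> fst c" for c p vs
    using chart_d_lincomb[of c p "\<eta> c" "\<zeta> c" a b vs] forms_smooth[OF assms(1)] forms_smooth[OF assms(2)] that
    by (simp add: plus_fun_def scaleR_fun_def)
  then show ?thesis by (intro ext) (simp add: ext_d_eq)
qed

lemma ext_d_add: "\<eta> \<in> forms A k \<Longrightarrow> \<zeta> \<in> forms A l \<Longrightarrow> ext_d A (\<eta> + \<zeta>) = ext_d A \<eta> + ext_d A \<zeta>"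
  using ext_d_lincomb[of \<eta> k \<zeta> l 1 1] by simp

lemma ext_d_diff: "\<eta> \<in> forms A k \<Longrightarrow> \<zeta> \<in> forms A l \<Longrightarrow> ext_d A (\<eta> - \<zeta>) = ext_d A \<eta> - ext_d A \<zeta>"
  using ext_d_lincomb[of \<eta> k \<zeta> l 1 "-1"] by simp

lemma ext_d_scaleR: "\<eta> \<in> forms A k \<Longrightarrow> ext_d A (r *\<^sub>R \<eta>) = r *\<^sub>R ext_d A \<eta>"
  using ext_d_lincomb[of \<eta> k 0 k r 0] forms_0 by simp

lemma ext_d_ext_d:
  assumes "\<eta> \<in> forms A k"
  shows "ext_d A (ext_d A \<eta>) = 0"
proof -
  have "chart_d c (ext_d A \<eta> c) p vs = 0" if c: "c \<in> A" "p \<in> fst c" for c p vs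
    using chart_d_cong[OF c(2), of "ext_d A \<eta> c" "chart_d c (\<eta> c)"] c chart_d_chart_d[of c p "\<eta> c"] forms_smooth[OF assms]
    by (simp add: ext_d_eq)
  then show ?thesis by (intro ext) (simp add: ext_d_eq)
qed

text \<open>The last condition says [[T, f], h] = 0, the algebraic characterisation of differential
  operators of order at most one. It is invariant under transposition, so formal adjoints inherit
  it.\<close>

definition first_order_operator ::
  "('a, 'm) mform set \<Rightarrow> ('a, 'm) mform set \<Rightarrow> (('a, 'm) mform \<Rightarrow> ('a, 'm) mform) \<Rightarrow> bool" where
  "first_order_operator E F T \<longleftrightarrow>
     (\<forall>\<eta>\<in>E. T \<eta> \<in> F) \<and> (\<forall>\<eta>\<in>E. \<forall>\<zeta>\<in>E. T (\<eta> + \<zeta>) = T \<eta> + T \<zeta>) \<and>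
     (\<forall>\<eta>\<in>E. \<forall>f h. smooth_function A f \<longrightarrow> smooth_function A h \<longrightarrow>
        T (form_scale f (form_scale h \<eta>)) + form_scale f (form_scale h (T \<eta>)) =
        form_scale f (T (form_scale h \<eta>)) + form_scale h (T (form_scale f \<eta>)))"

text \<open>The commutator [d, f] is the wedge product with df, which commutes with multiplication
  by functions. In coordinates this is the product rule for the derivative of f h.\<close>

lemma ext_d_first_order: "first_order_operator (forms A k) (forms A (k + 1)) (ext_d A)"
  unfolding first_order_operator_def
proof (intro conjI ballI allI impI)
  fix \<eta> f h assume \<eta>: "\<eta> \<in> forms A k" and f: "smooth_function A f" "smooth_function A h"
  have "chart_d c (form_scale f (form_scale h \<eta>) c) p vs + f p * h p * chart_d c (\<eta> c) p vs =
     f p * chart_d c (form_scale h \<eta> c) p vs + h p * chart_d c (form_scale f \<eta> c) p vs"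
    if c: "c \<in> A" "p \<in> fst c" for c p vs
  proof -
    have sm: "smooth_in_chart c f" "smooth_in_chart c h" "smooth_in_chart c (\<lambda>p. f p * h p)" "smooth_components c (\<eta> c)"
      using f c forms_smooth[OF \<eta>] by (auto simp: smooth_function_def intro: smooth_in_chart_mult)
    have eq: "form_scale f (form_scale h \<eta>) c = (\<lambda>q ws. (f q * h q) * \<eta> c q ws)"
      by (simp add: form_scale_def fun_eq_iff)
    have eq': "form_scale f \<eta> c = (\<lambda>q ws. f q * \<eta> c q ws)" for f by (simp add: form_scale_def)
    have "alt_sum (\<lambda>v ws. chart_deriv c (\<lambda>p. f p * h p) p v * \<eta> c p ws) vs =
       f p * alt_sum (\<lambda>v ws. chart_deriv c h p v * \<eta> c p ws) vs
        + h p * alt_sum (\<lambda>v ws. chart_deriv c f p v * \<eta> c p ws) vs"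
      unfolding alt_sum_lincomb[symmetric]
      by (rule alt_sum_cong) (use c sm in \<open>simp add: chart_deriv_mult algebra_simps\<close>)
    moreover have scale: "chart_d c (\<lambda>q ws. f q * u q ws) p vs =
        f p * chart_d c u p vs + alt_sum (\<lambda>v ws. chart_deriv c f p v * u p ws) vs"
      if "smooth_in_chart c f" "smooth_components c u" for f u
      using chart_d_scale[OF good_chart[OF c(1)] c(2) that] .
    ultimately show ?thesis
      unfolding eq eq' scale[OF sm(3,4)] scale[OF sm(1,4)] scale[OF sm(2,4)] by (simp add: algebra_simps)
  qed
  then show "ext_d A (form_scale f (form_scale h \<eta>)) + form_scale f (form_scale h (ext_d A \<eta>)) =
        form_scale f (ext_d A (form_scale h \<eta>)) + form_scale h (ext_d A (form_scale f \<eta>))"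
    by (intro ext) (simp add: ext_d_eq form_scale_apply mult.assoc)
qed (auto simp: ext_d_in_forms ext_d_add)

text \<open>Modules over the smooth functions within one degree; all forms and the primitive forms
  are the instances.\<close>

definition form_module :: "('a, 'm) mform set \<Rightarrow> bool" where
  "form_module E \<longleftrightarrow> (\<exists>k. E \<subseteq> forms A k) \<and> (\<forall>\<eta>\<in>E. \<forall>\<zeta>\<in>E. \<eta> + \<zeta> \<in> E) \<and>
     (\<forall>\<eta>\<in>E. \<forall>f. smooth_function A f \<longrightarrow> form_scale f \<eta> \<in> E)"

lemma form_module_add: "form_module E \<Longrightarrow> \<eta> \<in> E \<Longrightarrow> \<zeta> \<in> E \<Longrightarrow> \<eta> + \<zeta> \<in> E"
  and form_module_scale: "form_module E \<Longrightarrow> \<eta> \<in> E \<Longrightarrow> smooth_function A f \<Longrightarrow> form_scale f \<eta> \<in> E"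
  by (simp_all add: form_module_def)

lemma form_module_scaleR: "form_module E \<Longrightarrow> \<eta> \<in> E \<Longrightarrow> r *\<^sub>R \<eta> \<in> E"
  using form_module_scale[OF _ _ smooth_function_const[of r]] by (simp add: form_scale_const)

lemma form_module_diff: "form_module E \<Longrightarrow> \<eta> \<in> E \<Longrightarrow> \<zeta> \<in> E \<Longrightarrow> \<eta> - \<zeta> \<in> E"
  using form_module_add[of E \<eta> "- \<zeta>"] form_module_scaleR[of E \<zeta> "-1"] by simp

lemma form_module_forms: "form_module (forms A k)"
  by (auto simp: form_module_def forms_add forms_scale)

lemma first_order_operatorD:
  assumes "first_order_operator E F T" "\<eta> \<in> E"
  shows "T \<eta> \<in> F" and "\<zeta> \<in> E \<Longrightarrow> T (\<eta> + \<zeta>) = T \<eta> + T \<zeta>"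
    and "smooth_function A f \<Longrightarrow> smooth_function A h \<Longrightarrow>
        T (form_scale f (form_scale h \<eta>)) + form_scale f (form_scale h (T \<eta>)) =
        form_scale f (T (form_scale h \<eta>)) + form_scale h (T (form_scale f \<eta>))"
  using assms by (auto simp: first_order_operator_def)

lemma first_order_operator_zero:
  assumes "first_order_operator E F T" "0 \<in> E"
  shows "T 0 = 0"
  using first_order_operatorD(2)[OF assms assms(2)] by simp

lemma first_order_operator_cong:
  assumes "first_order_operator E F T" "form_module E" "\<And>\<eta>. \<eta> \<in> E \<Longrightarrow> T' \<eta> = T \<eta>"
  shows "first_order_operator E F T'"
  using assms(1) unfolding first_order_operator_def
  by (simp add: assms(3) form_module_scale[OF assms(2)] form_module_add[OF assms(2)])

lemma first_order_operator_subset: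
  "first_order_operator E F T \<Longrightarrow> E' \<subseteq> E \<Longrightarrow> (\<And>\<eta>. \<eta> \<in> E' \<Longrightarrow> T \<eta> \<in> F') \<Longrightarrow> first_order_operator E' F' T"
  unfolding first_order_operator_def by (meson subsetD)

lemma first_order_operator_compose_left:
  assumes "first_order_operator E F T" "linear S" "\<And>f \<eta>. S (form_scale f \<eta>) = form_scale f (S \<eta>)"
    and "\<And>\<eta>. \<eta> \<in> F \<Longrightarrow> S \<eta> \<in> G"
  shows "first_order_operator E G (\<lambda>\<eta>. S (T \<eta>))"
  unfolding first_order_operator_def
proof (intro conjI ballI allI impI)
  fix \<eta> f h assume \<eta>: "\<eta> \<in> E" and f: "smooth_function A f" "smooth_function A h"
  show "S (T (form_scale f (form_scale h \<eta>))) + form_scale f (form_scale h (S (T \<eta>))) =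
        form_scale f (S (T (form_scale h \<eta>))) + form_scale h (S (T (form_scale f \<eta>)))"
    using arg_cong[OF first_order_operatorD(3)[OF assms(1) \<eta> f], of S] by (simp add: linear_add[OF assms(2)] assms(3))
qed (use assms(4) first_order_operatorD[OF assms(1)] in \<open>auto simp: linear_add[OF assms(2)]\<close>)

lemma first_order_operator_compose_right:
  assumes "first_order_operator E' F T" "linear S" "\<And>f \<eta>. S (form_scale f \<eta>) = form_scale f (S \<eta>)"
    and "\<And>\<eta>. \<eta> \<in> E \<Longrightarrow> S \<eta> \<in> E'"
  shows "first_order_operator E F (\<lambda>\<eta>. T (S \<eta>))"
  using assms(1) unfolding first_order_operator_def
  by (simp add: assms(3,4) linear_add[OF assms(2)])

lemma first_order_operator_minus:
  assumes "first_order_operator E F T" "first_order_operator E F T'" "form_module F"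
  shows "first_order_operator E F (\<lambda>\<eta>. T \<eta> - T' \<eta>)"
  unfolding first_order_operator_def
proof (intro conjI ballI allI impI)
  fix \<eta> f h assume \<eta>: "\<eta> \<in> E" and f: "smooth_function A f" "smooth_function A h"
  show "T (form_scale f (form_scale h \<eta>)) - T' (form_scale f (form_scale h \<eta>)) + form_scale f (form_scale h (T \<eta> - T' \<eta>)) =
        form_scale f (T (form_scale h \<eta>) - T' (form_scale h \<eta>)) + form_scale h (T (form_scale f \<eta>) - T' (form_scale f \<eta>))"
    using first_order_operatorD(3)[OF assms(1) \<eta> f] first_order_operatorD(3)[OF assms(2) \<eta> f]
    unfolding form_scale_diff by (simp add: algebra_simps)
qed (use form_module_diff[OF assms(3)] first_order_operatorD[OF assms(1)] first_order_operatorD[OF assms(2)] in auto)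

end

section \<open>The operators L and \<Lambda> and their commutation relations\<close>

locale symplectic_manifold = bordered_manifold X A
  for X :: "'a topology" and A :: "('a, 'm::finite) chart set" +
  fixes \<omega> :: "('a, 'm) mform" and n :: nat
  assumes symplectic: "symplectic_form A \<omega>" and dim: "CARD('m) = 2 * n"
begin

abbreviation d where "d \<equiv> ext_d A"
abbreviation L where "L \<equiv> lefschetz_L \<omega>"
abbreviation Lam where "Lam \<equiv> lefschetz_Lambda \<omega>"
abbreviation \<omega>_at where "\<omega>_at c p \<equiv> (\<lambda>u v. \<omega> c p [u, v])"

lemma \<omega>_form: "\<omega> \<in> forms A 2" and d_\<omega>: "d \<omega> = 0"
  using symplectic by (auto simp: symplectic_form_def zero_form_eq)

lemma \<omega>_nondegenerate:
  assumes "c \<in> A" "p \<in> fst c"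
  shows "nondegenerate (\<omega>_at c p)"
  using alternating_bilinear[OF forms_alternating[OF \<omega>_form assms], of "[]"] symplectic assms
  by (auto simp: nondegenerate_def symplectic_form_def)

lemma \<omega>_supported: "supported_at 2 (\<omega> c p)"
  using forms_outside[OF \<omega>_form] by (auto simp: supported_at_def)

lemma Lam_eq: "Lam \<eta> c p = contract (\<omega>_at c p) (\<eta> c p)"
  by (simp add: lefschetz_Lambda_def contract_def fun_eq_iff)

lemma L_eq: "L \<eta> c p = wedge (\<omega> c p) (\<eta> c p)"
  by (simp add: lefschetz_L_def)

lemma Lam_in_forms:
  assumes \<eta>: "\<eta> \<in> forms A k"
  shows "Lam \<eta> \<in> forms A (k - 2)"
proof (rule formsI)
  show "Lam \<eta> c p vs = 0" if "c \<notin> A \<or> p \<notin> fst c \<or> int (length vs) \<noteq> k - 2" for c p vs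
    unfolding Lam_eq contract_def using forms_outside[OF \<eta>, of c p "_ # _ # vs"] that by force
  show "alternating_multilinear (Lam \<eta> c p)" if "c \<in> A" "p \<in> fst c" for c p
    unfolding Lam_eq by (rule alternating_contract[OF forms_alternating[OF \<eta> that]])
  show "smooth_in_chart c (\<lambda>p. Lam \<eta> c p vs)" if c: "c \<in> A" for c vs
  proof -
    have "smooth_in_chart c (\<lambda>q. dual_basis (\<omega>_at c q) i $ j)" for i j
      by (rule smooth_in_chart_dual_basis[where B="\<omega>_at c"]) (rule \<omega>_nondegenerate[OF c] forms_smooth[OF \<omega>_form c], assumption?)+
    then have Y: "smooth_in_chart c (\<lambda>q. Y q $ j)"
      if "Y \<in> set ((\<lambda>q. dual_basis (\<omega>_at c q) i) # map (\<lambda>v q. v) (axis i 1 # vs))" for Y i j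
      using that by (auto simp: smooth_in_chart_const)
    have "smooth_components c (\<eta> c)" using forms_smooth[OF \<eta> c] by blast
    from smooth_in_chart_insert_fields[OF this forms_alternating[OF \<eta> c] Y]
    have "smooth_in_chart c (\<lambda>q. \<eta> c q (map (\<lambda>Y. Y q) ((\<lambda>q. dual_basis (\<omega>_at c q) i) # map (\<lambda>v q. v) (axis i 1 # vs))))" for i
      by this
    then show ?thesis
      unfolding Lam_eq contract_def
      by (intro smooth_in_chart_mult smooth_in_chart_const smooth_in_chart_sum) (simp add: o_def)
  qed
  show "Lam \<eta> c p vs = Lam \<eta> c' p (map (chart_deriv c (snd c') p) vs)"
    if c: "c \<in> A" "c' \<in> A" "p \<in> fst c" "p \<in> fst c'" for c c' p vs
  proof -
    have eq: "(\<lambda>ws. \<eta> c' p (map (chart_deriv c (snd c') p) ws)) = \<eta> c p"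
      using forms_change[OF \<eta> c] by (simp add: fun_eq_iff)
    \<comment> \<open>Transition derivatives preserve \<omega> and hence the contraction with its
      inverse.\<close>
    show ?thesis
      using contract_map[OF \<omega>_nondegenerate[OF c(1,3)] \<omega>_nondegenerate[OF c(2,4)] transition_linear[OF c] transition_surj[OF c]
         _ forms_alternating[OF \<eta> c(2,4)], of vs] forms_change[OF \<omega>_form c] unfolding Lam_eq eq by simp
  qed
qed

lemma L_in_forms:
  assumes \<eta>: "\<eta> \<in> forms A k"
  shows "L \<eta> \<in> forms A (k + 2)"
proof (rule formsI)
  show "L \<eta> c p vs = 0" if out: "c \<notin> A \<or> p \<notin> fst c \<or> int (length vs) \<noteq> k + 2" for c p vs
  proof (cases "k < 0 \<or> c \<notin> A \<or> p \<notin> fst c")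
    case True
    then have "\<eta> c p vs = 0" for vs
      using forms_outside[OF \<eta>, of c p vs] forms_neg_degree[OF \<eta>] by (cases "k < 0") auto
    then have "\<eta> c p = (\<lambda>vs. 0)" by (rule ext)
    then show ?thesis by (simp add: L_eq wedge_zero_right)
  next
    case False
    then obtain m where m: "k = int m" using nonneg_int_cases[of k] by auto
    have "supported_at m (\<eta> c p)" using forms_outside[OF \<eta>] m by (auto simp: supported_at_def)
    from supported_at_wedge[OF \<omega>_supported this] show ?thesis
      using out False m by (auto simp: L_eq supported_at_def)
  qed
  show "alternating_multilinear (L \<eta> c p)" if "c \<in> A" "p \<in> fst c" for c p
    unfolding L_eq by (rule alternating_wedge[OF forms_alternating[OF \<omega>_form that] forms_alternating[OF \<eta> that]])
  show "smooth_in_chart c (\<lambda>p. L \<eta> c p vs)" if "c \<in> A" for c vs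
    unfolding L_eq using forms_smooth[OF \<omega>_form that] forms_smooth[OF \<eta> that] by (intro smooth_wedge) auto
  show "L \<eta> c p vs = L \<eta> c' p (map (chart_deriv c (snd c') p) vs)"
    if c: "c \<in> A" "c' \<in> A" "p \<in> fst c" "p \<in> fst c'" for c c' p vs
  proof -
    have "\<eta> c p = (\<lambda>ws. \<eta> c' p (map (chart_deriv c (snd c') p) ws))"
      "\<omega> c p = (\<lambda>ws. \<omega> c' p (map (chart_deriv c (snd c') p) ws))"
      using forms_change[OF \<eta> c] forms_change[OF \<omega>_form c] by auto
    then show ?thesis by (simp only: L_eq wedge_map)
  qed
qed

lemma L_lincomb: "L (a *\<^sub>R \<eta> + b *\<^sub>R \<zeta>) = a *\<^sub>R L \<eta> + b *\<^sub>R L \<zeta>"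
proof -
  have "(a *\<^sub>R \<eta> + b *\<^sub>R \<zeta>) c p = (\<lambda>vs. a * \<eta> c p vs + b * \<zeta> c p vs)" for c p
    by (simp add: fun_eq_iff)
  then show ?thesis by (intro ext) (simp add: L_eq wedge_lincomb_right)
qed

lemma Lam_lincomb: "Lam (a *\<^sub>R \<eta> + b *\<^sub>R \<zeta>) = a *\<^sub>R Lam \<eta> + b *\<^sub>R Lam \<zeta>"
  by (intro ext) (simp add: Lam_eq contract_def sum.distrib sum_distrib_left algebra_simps)

lemma L_linear: "linear L"
  by (rule linearI) (use L_lincomb[of 1 _ 1] L_lincomb[of _ _ 0 0] in simp_all)

lemma Lam_linear: "linear Lam"
  by (rule linearI) (use Lam_lincomb[of 1 _ 1] Lam_lincomb[of _ _ 0 0] in simp_all)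

lemma L_scale: "L (form_scale f \<eta>) = form_scale f (L \<eta>)"
  using wedge_lincomb_right[of _ "f _" "\<eta> _ _" 0 "\<lambda>_. 0"] by (intro ext) (simp add: L_eq form_scale_def)

lemma Lam_scale: "Lam (form_scale f \<eta>) = form_scale f (Lam \<eta>)"
  by (intro ext) (simp add: Lam_eq form_scale_def contract_def sum_distrib_left algebra_simps)

lemma Lam_L:
  assumes \<eta>: "\<eta> \<in> forms A k"
  shows "Lam (L \<eta>) = L (Lam \<eta>) + (real n - of_int k) *\<^sub>R \<eta>"
proof -
  have "Lam (L \<eta>) c p vs = (L (Lam \<eta>) + (real n - of_int k) *\<^sub>R \<eta>) c p vs" for c p vs
  proof (cases "c \<in> A \<and> p \<in> fst c")
    case True
    \<comment> \<open>Where the number of arguments differs from k the form vanishes, so k may be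
      replaced with the length that occurs in \<open>contract_wedge\<close>.\<close>
    have "(real n - of_int k) * \<eta> c p vs = (real n - real (length vs)) * \<eta> c p vs"
      using forms_outside[OF \<eta>, of c p vs] by (cases "int (length vs) = k") auto
    moreover have "contract (\<omega>_at c p) (wedge (\<omega> c p) (\<eta> c p)) vs =
        wedge (\<omega> c p) (contract (\<omega>_at c p) (\<eta> c p)) vs + (real n - real (length vs)) * \<eta> c p vs"
      using contract_wedge[OF forms_alternating[OF \<omega>_form] \<omega>_supported \<omega>_nondegenerate refl forms_alternating[OF \<eta>], of c p c p vs] True dim
      by simp
    ultimately show ?thesis
      by (simp only: plus_fun_apply scaleR_fun_apply real_scaleR_def Lam_eq L_eq)
  next
    case False
    then show ?thesis
      using forms_outside[OF \<eta>, of c p vs] forms_outside[OF Lam_in_forms[OF L_in_forms[OF \<eta>]], of c p vs]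
        forms_outside[OF L_in_forms[OF Lam_in_forms[OF \<eta>]], of c p vs]
      by auto
  qed
  then show ?thesis by (intro ext)
qed

text \<open>In the Leibniz rule the term with d\<omega> vanishes, and the even degree of \<omega>
  leaves no sign.\<close>

lemma d_L:
  assumes \<eta>: "\<eta> \<in> forms A k"
  shows "d (L \<eta>) = L (d \<eta>)"
proof -
  have "chart_d c (L \<eta> c) p vs = L (d \<eta>) c p vs" if c: "c \<in> A" "p \<in> fst c" for c p vs
  proof -
    have "d \<eta> c p = chart_d c (\<eta> c) p" "d \<omega> c p = chart_d c (\<omega> c) p" using c by (auto simp: ext_d_eq)
    moreover have "chart_d c (\<omega> c) p = (\<lambda>vs. 0)" using calculation(2) by (simp add: d_\<omega> fun_eq_iff)
    ultimately show ?thesis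
      using chart_d_wedge[of c p "\<omega> c" "\<eta> c" vs] c forms_smooth[OF \<eta>] forms_smooth[OF \<omega>_form]
        supported_at_graded_sign[OF \<omega>_supported[of c p]]
      by (simp add: lefschetz_L_def wedge_zero_left)
  qed
  moreover have "L (d \<eta>) c p vs = 0" if "\<not> (c \<in> A \<and> p \<in> fst c)" for c p vs
    using forms_outside[OF L_in_forms[OF ext_d_in_forms[OF \<eta>]]] that by blast
  ultimately show ?thesis by (intro ext) (simp add: ext_d_eq)
qed

section \<open>The Lefschetz decomposition\<close>

lemma L_Lam:
  assumes "\<eta> \<in> forms A k" "c = real n - of_int k"
  shows "L (Lam \<eta>) = Lam (L \<eta>) - c *\<^sub>R \<eta>"
  using Lam_L[OF assms(1)] assms(2) by simp

text \<open>\<open>comm2 j\<close> is \<open>[\<Lambda>, \<dots> [\<Lambda>, d] \<dots>]\<close> with \<open>j + 2\<close> brackets.\<close>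

primrec comm2 :: "nat \<Rightarrow> ('a, 'm) mform \<Rightarrow> ('a, 'm) mform" where
  "comm2 0 \<eta> = Lam (Lam (d \<eta>)) - 2 *\<^sub>R Lam (d (Lam \<eta>)) + d (Lam (Lam \<eta>))"
| "comm2 (Suc j) \<eta> = Lam (comm2 j \<eta>) - comm2 j (Lam \<eta>)"

lemma Lam_d: "\<eta> \<in> forms A k \<Longrightarrow> Lam (d \<eta>) \<in> forms A (k - 1)"
  using Lam_in_forms[OF ext_d_in_forms, of \<eta> k] by (simp add: algebra_simps)

lemma d_Lam: "\<eta> \<in> forms A k \<Longrightarrow> d (Lam \<eta>) \<in> forms A (k - 1)"
  using ext_d_in_forms[OF Lam_in_forms, of \<eta> k] by simp

lemma comm2_in_forms: "\<eta> \<in> forms A k \<Longrightarrow> comm2 j \<eta> \<in> forms A (k - 3 - 2 * int j)"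
proof (induction j arbitrary: \<eta> k)
  case 0
  have "Lam (Lam (d \<eta>)) \<in> forms A (k - 3)" "Lam (d (Lam \<eta>)) \<in> forms A (k - 3)" "d (Lam (Lam \<eta>)) \<in> forms A (k - 3)"
    using Lam_in_forms[OF Lam_d[OF 0]] Lam_in_forms[OF d_Lam[OF 0]] d_Lam[OF Lam_in_forms[OF 0]] by simp_all
  then have "comm2 0 \<eta> \<in> forms A (k - 3)"
    unfolding comm2.simps by (intro forms_add forms_diff forms_scaleR)
  moreover have "k - 3 - 2 * int 0 = k - 3" by simp
  ultimately show ?case by (simp only:)
next
  case (Suc j)
  have "k - 3 - 2 * int j - 2 = k - 3 - 2 * int (Suc j)" "k - 2 - 3 - 2 * int j = k - 3 - 2 * int (Suc j)" by simp_all
  then show ?case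
    using forms_diff[OF Lam_in_forms[OF Suc.IH[OF Suc.prems]], of "comm2 j (Lam \<eta>)"] Suc.IH[OF Lam_in_forms[OF Suc.prems]]
    by (simp only: comm2.simps)
qed

lemma comm2_lincomb:
  "\<eta> \<in> forms A k \<Longrightarrow> \<zeta> \<in> forms A k \<Longrightarrow> comm2 j (a *\<^sub>R \<eta> + b *\<^sub>R \<zeta>) = a *\<^sub>R comm2 j \<eta> + b *\<^sub>R comm2 j \<zeta>"
proof (induction j arbitrary: \<eta> \<zeta> k)
  case 0
  note Lam = Lam_in_forms[OF 0(1)] Lam_in_forms[OF 0(2)]
  show ?case
    unfolding comm2.simps Lam_lincomb ext_d_lincomb[OF 0] ext_d_lincomb[OF Lam] ext_d_lincomb[OF Lam[THEN Lam_in_forms]]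
    by (intro ext) (simp add: algebra_simps)
next
  case (Suc j)
  show ?case
    unfolding comm2.simps Lam_lincomb Suc.IH[OF Suc.prems] Suc.IH[OF Suc.prems[THEN Lam_in_forms]]
    by (intro ext) (simp add: algebra_simps)
qed

lemma comm2_diff: "\<eta> \<in> forms A k \<Longrightarrow> \<zeta> \<in> forms A k \<Longrightarrow> comm2 j (\<eta> - c *\<^sub>R \<zeta>) = comm2 j \<eta> - c *\<^sub>R comm2 j \<zeta>"
  using comm2_lincomb[of \<eta> k \<zeta> j 1 "- c"] by (simp del: comm2.simps)

lemma d_diff: "\<eta> \<in> forms A k \<Longrightarrow> \<zeta> \<in> forms A l \<Longrightarrow> d (\<eta> - c *\<^sub>R \<zeta>) = d \<eta> - c *\<^sub>R d \<zeta>"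
  using ext_d_lincomb[of \<eta> k \<zeta> l 1 "- c"] by simp

lemmas L_Lam_linear = linear_diff[OF L_linear] linear_diff[OF Lam_linear] linear_add[OF L_linear] linear_add[OF Lam_linear]
    linear_scale[OF L_linear] linear_scale[OF Lam_linear]

text \<open>Under H, \<open>d\<close> has weight -1 and [\<Lambda>, d] has weight 1. From [L, d] = 0
  and [L, \<Lambda>] = -H it follows that [L, [\<Lambda>, d]] = d. In the bracket of L with
  [\<Lambda>, [\<Lambda>, d]] the two contributions are then [\<Lambda>, d] and its
  negative.\<close>

lemma L_comm2_0:
  assumes \<eta>: "\<eta> \<in> forms A k"
  shows "L (comm2 0 \<eta>) = comm2 0 (L \<eta>)"
proof -
  \<comment> \<open>This is the value of H on \<eta>. The shifts of it below are the changes of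
    degree under \<open>d\<close> and \<open>Lam\<close>.\<close>
  define c where "c = real n - of_int k"
  have L\<eta>: "L (Lam \<eta>) = Lam (L \<eta>) - c *\<^sub>R \<eta>"
    by (rule L_Lam[OF \<eta>]) (simp add: c_def)
  have Ld\<eta>: "L (Lam (d \<eta>)) = Lam (d (L \<eta>)) - (c - 1) *\<^sub>R d \<eta>"
    unfolding d_L[OF \<eta>] by (rule L_Lam[OF ext_d_in_forms[OF \<eta>]]) (simp add: c_def)
  have "L (Lam (Lam (d \<eta>))) = Lam (L (Lam (d \<eta>))) - (c + 1) *\<^sub>R Lam (d \<eta>)"
    by (rule L_Lam[OF Lam_d[OF \<eta>]]) (simp add: c_def)
  then have 1: "L (Lam (Lam (d \<eta>))) = Lam (Lam (d (L \<eta>))) - (c - 1) *\<^sub>R Lam (d \<eta>) - (c + 1) *\<^sub>R Lam (d \<eta>)"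
    unfolding Ld\<eta> L_Lam_linear .
  have Ld: "L (d (Lam \<eta>)) = d (Lam (L \<eta>)) - c *\<^sub>R d \<eta>"
    unfolding d_L[OF Lam_in_forms[OF \<eta>], symmetric] L\<eta> by (rule d_diff[OF Lam_in_forms[OF L_in_forms[OF \<eta>]] \<eta>])
  have "L (Lam (d (Lam \<eta>))) = Lam (L (d (Lam \<eta>))) - (c + 1) *\<^sub>R d (Lam \<eta>)"
    by (rule L_Lam[OF d_Lam[OF \<eta>]]) (simp add: c_def)
  then have 2: "L (Lam (d (Lam \<eta>))) = Lam (d (Lam (L \<eta>))) - c *\<^sub>R Lam (d \<eta>) - (c + 1) *\<^sub>R d (Lam \<eta>)"
    unfolding Ld L_Lam_linear .
  have "L (Lam (Lam \<eta>)) = Lam (L (Lam \<eta>)) - (c + 2) *\<^sub>R Lam \<eta>"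
    by (rule L_Lam[OF Lam_in_forms[OF \<eta>]]) (simp add: c_def)
  then have LL: "L (Lam (Lam \<eta>)) = Lam (Lam (L \<eta>)) - c *\<^sub>R Lam \<eta> - (c + 2) *\<^sub>R Lam \<eta>"
    unfolding L\<eta> L_Lam_linear .
  have LLL: "Lam (Lam (L \<eta>)) \<in> forms A (k - 2)" "Lam \<eta> \<in> forms A (k - 2)"
    using Lam_in_forms[OF Lam_in_forms[OF L_in_forms[OF \<eta>]]] Lam_in_forms[OF \<eta>] by simp_all
  have 3: "L (d (Lam (Lam \<eta>))) = d (Lam (Lam (L \<eta>))) - c *\<^sub>R d (Lam \<eta>) - (c + 2) *\<^sub>R d (Lam \<eta>)"
    unfolding d_L[OF Lam_in_forms[OF LLL(2)], symmetric] LL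
    unfolding d_diff[OF forms_diff[OF LLL(1) forms_scaleR[OF LLL(2)]] LLL(2)] d_diff[OF LLL] ..
  show ?thesis
    unfolding comm2.simps L_Lam_linear 1 2 3 by (intro ext) (simp add: algebra_simps)
qed

text \<open>The coefficient is 3 + 5 + ... + (2 j + 3), the sum of the weights of
  \<open>comm2 0\<close> up to \<open>comm2 j\<close>, because each further bracket with \<Lambda>
  contributes one -H. What counts later is that it is nonzero.\<close>

lemma L_comm2_Suc:
  assumes "\<eta> \<in> forms A k"
  shows "L (comm2 (Suc j) \<eta>) = comm2 (Suc j) (L \<eta>) - (real (Suc j) * real (j + 3)) *\<^sub>R comm2 j \<eta>"
  using assms
proof (induction j arbitrary: \<eta> k)
  case (0 \<eta> k)
  define c where "c = real n - of_int k"
  have "L (Lam (comm2 0 \<eta>)) = Lam (L (comm2 0 \<eta>)) - (c + 3) *\<^sub>R comm2 0 \<eta>"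
    by (rule L_Lam[OF comm2_in_forms[OF 0]]) (simp add: c_def)
  moreover have "L (Lam \<eta>) = Lam (L \<eta>) - c *\<^sub>R \<eta>"
    by (rule L_Lam[OF 0]) (simp add: c_def)
  moreover have "Lam (L \<eta>) \<in> forms A k"
    using Lam_in_forms[OF L_in_forms[OF 0]] by simp
  ultimately show ?case
    unfolding comm2.simps(2) L_Lam_linear L_comm2_0[OF 0] L_comm2_0[OF Lam_in_forms[OF 0]]
    by (simp only: comm2_diff[OF _ 0]) (intro ext, simp add: algebra_simps del: comm2.simps)
next
  case (Suc j \<eta> k)
  let ?m = "real (Suc j) * real (j + 3)" and ?V = "comm2 (Suc j)"
  define c where "c = real n - of_int k"
  have 1: "L (Lam (?V \<eta>)) = Lam (L (?V \<eta>)) - (c + real (2 * j + 5)) *\<^sub>R ?V \<eta>"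
    by (rule L_Lam[OF comm2_in_forms[OF Suc.prems]]) (simp add: c_def)
  have 2: "L (Lam \<eta>) = Lam (L \<eta>) - c *\<^sub>R \<eta>"
    by (rule L_Lam[OF Suc.prems]) (simp add: c_def)
  have 3: "Lam (L \<eta>) \<in> forms A k"
    using Lam_in_forms[OF L_in_forms[OF Suc.prems]] by simp
  have "L (comm2 (Suc (Suc j)) \<eta>) = L (Lam (?V \<eta>)) - L (?V (Lam \<eta>))"
    by (simp only: comm2.simps(2)[of "Suc j"] L_Lam_linear)
  also have "\<dots> = comm2 (Suc (Suc j)) (L \<eta>) - ?m *\<^sub>R ?V \<eta> - real (2 * j + 5) *\<^sub>R ?V \<eta>"
    unfolding 1 Suc.IH[OF Suc.prems] Suc.IH[OF Lam_in_forms[OF Suc.prems]] 2 comm2_diff[OF 3 Suc.prems]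
      comm2.simps(2)[of "Suc j" "L \<eta>"] L_Lam_linear
    by (intro ext) (simp add: algebra_simps)
  also have "\<dots> = comm2 (Suc (Suc j)) (L \<eta>) - (?m + real (2 * j + 5)) *\<^sub>R ?V \<eta>"
    by (simp add: scaleR_add_left del: comm2.simps)
  also have "?m + real (2 * j + 5) = real (Suc (Suc j)) * real (Suc j + 3)"
    by (simp add: algebra_simps)
  finally show ?case .
qed

text \<open>The operator \<open>comm2 n\<close> lowers the degree by 2 n + 3, which is more than the
  dimension.\<close>

lemma comm2_eventually_zero:
  assumes "\<eta> \<in> forms A k"
  shows "comm2 n \<eta> = 0"
proof (cases "k > int CARD('m)")
  case True
  then have "\<eta> = 0" using forms_large_degree[OF assms] by simp
  then show ?thesis using comm2_lincomb[OF forms_0 forms_0, of n 0 0] by simp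
next
  case False
  then show ?thesis
    using forms_neg_degree[OF comm2_in_forms[OF assms, of n]] dim by simp
qed

text \<open>Since \<open>[L, d] = 0\<close> and \<open>d\<close> has weight \<open>-1\<close>, the second commutator of \<open>d\<close> with \<open>\<Lambda>\<close> vanishes:
  it commutes with \<open>L\<close>, while it would be a vector of nonzero weight in a finite-dimensional
  representation of \<open>sl\<^sub>2\<close>.\<close>

lemma second_commutator:
  assumes "\<eta> \<in> forms A k"
  shows "Lam (Lam (d \<eta>)) - 2 *\<^sub>R Lam (d (Lam \<eta>)) + d (Lam (Lam \<eta>)) = 0"
proof -
  \<comment> \<open>Descent from \<open>comm2 n\<close> to \<open>comm2 0\<close>: once
    \<open>comm2 (Suc j)\<close> vanishes on all forms, \<open>L_comm2_Suc\<close> leaves a nonzero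
    multiple of \<open>comm2 j\<close>.\<close>
  have "comm2 (n - i) \<eta> = 0" if "i \<le> n" "\<eta> \<in> forms A k" for i \<eta> k
    using that
  proof (induction i arbitrary: \<eta> k)
    case 0
    then show ?case using comm2_eventually_zero by simp
  next
    case (Suc i)
    have Suc_eq: "Suc (n - Suc i) = n - i" using Suc.prems by simp
    have "i \<le> n" using Suc.prems by simp
    then have "comm2 (Suc (n - Suc i)) \<eta> = 0" "comm2 (Suc (n - Suc i)) (L \<eta>) = 0"
      unfolding Suc_eq by (rule Suc.IH[OF _ Suc.prems(2)] Suc.IH[OF _ L_in_forms[OF Suc.prems(2)]])+
    then show ?case
      by (rule scaleR_zero_of_diff[where f=L, OF L_comm2_Suc[OF Suc.prems(2)] _ _ linear_0[OF L_linear]]) simp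
  qed
  from this[of n] assms show ?thesis by simp
qed

text \<open>\<beta> would be annihilated by \<Lambda> and have negative weight n - m. Then \<Lambda>
  maps each power \<open>(L ^^ Suc j) \<beta>\<close> to a nonzero multiple of the preceding one,
  while \<open>(L ^^ n) \<beta>\<close> vanishes for reasons of degree, and descent reaches \<beta>
  itself.\<close>

lemma Lam_injective:
  assumes \<beta>: "\<beta> \<in> forms A m" "Lam \<beta> = 0" and m: "m > int n"
  shows "\<beta> = 0"
proof -
  have Lj: "(L ^^ j) \<beta> \<in> forms A (m + 2 * int j)" for j
  proof (induction j)
    case (Suc j)
    then show ?case using L_in_forms[OF Suc] by (simp add: algebra_simps)
  qed (use \<beta> in simp)
  \<comment> \<open>The coefficient is the sum of the weights n - m - 2 i for i \<le> j.\<close>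
  have Lam_Lj: "Lam ((L ^^ Suc j) \<beta>) = (real (Suc j) * (real n - of_int m - real j)) *\<^sub>R (L ^^ j) \<beta>" for j
  proof (induction j)
    case 0
    then show ?case using Lam_L[OF \<beta>(1)] \<beta>(2) by (simp add: linear_0[OF L_linear])
  next
    case (Suc j)
    have "Lam ((L ^^ Suc (Suc j)) \<beta>) = L (Lam ((L ^^ Suc j) \<beta>)) + (real n - of_int (m + 2 * int (Suc j))) *\<^sub>R (L ^^ Suc j) \<beta>"
      using Lam_L[OF Lj[of "Suc j"]] by simp
    also have "L (Lam ((L ^^ Suc j) \<beta>)) = (real (Suc j) * (real n - of_int m - real j)) *\<^sub>R (L ^^ Suc j) \<beta>"
      unfolding Suc linear_scale[OF L_linear] by simp
    finally have "Lam ((L ^^ Suc (Suc j)) \<beta>) = (real (Suc j) * (real n - of_int m - real j) + (real n - of_int (m + 2 * int (Suc j)))) *\<^sub>R (L ^^ Suc j) \<beta>"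
      by (simp only: scaleR_add_left)
    moreover have "real (Suc j) * (real n - of_int m - real j) + (real n - of_int (m + 2 * int (Suc j)))
        = real (Suc (Suc j)) * (real n - of_int m - real (Suc j))"
      by (simp add: algebra_simps)
    ultimately show ?case by (simp only:)
  qed
  have "(L ^^ (n - i)) \<beta> = 0" if "i \<le> n" for i
    using that
  proof (induction i)
    case 0
    have "m + 2 * int n > int CARD('m)" using m dim by simp
    then show ?case using forms_large_degree[OF Lj[of n]] by simp
  next
    case (Suc i)
    have "Suc (n - Suc i) = n - i" using Suc.prems by simp
    then have "(L ^^ Suc (n - Suc i)) \<beta> = 0"
      by (simp only:) (rule Suc.IH, use Suc.prems in simp)
    then have "(real (Suc (n - Suc i)) * (real n - of_int m - real (n - Suc i))) *\<^sub>R (L ^^ (n - Suc i)) \<beta> = 0"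
      unfolding Lam_Lj[symmetric] by (simp only: linear_0[OF Lam_linear])
    moreover have "real n - of_int m - real (n - Suc i) \<noteq> 0" using m by linarith
    ultimately show ?case by (simp only: scaleR_eq_0_iff mult_eq_0_iff of_nat_eq_0_iff) auto
  qed
  from this[of n] show ?thesis by simp
qed

section \<open>Primitive forms and the operators \<open>\<partial>\<^sub>+\<close> and
  \<open>\<partial>\<^sub>-\<close>\<close>

abbreviation P where "P \<equiv> primitive_forms A n \<omega>"

text \<open>The kernel of \<Lambda> is zero outside the degrees from 0 to n, so it agrees with the
  case distinction in \<open>primitive_forms\<close>.\<close>

lemma primitive_iff: "\<beta> \<in> P k \<longleftrightarrow> \<beta> \<in> forms A k \<and> Lam \<beta> = 0"
proof (cases "0 \<le> k \<and> k \<le> int n")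
  case True
  then show ?thesis by (simp add: primitive_forms_def zero_form_eq)
next
  case False
  then have "\<beta> = 0" if "\<beta> \<in> forms A k" "Lam \<beta> = 0"
    using that forms_neg_degree[OF that(1)] Lam_injective[OF that] by linarith
  then show ?thesis using False forms_0 linear_0[OF Lam_linear] by (auto simp: primitive_forms_def zero_form_eq)
qed

lemma primitive_forms_zero: "\<beta> \<in> P k \<Longrightarrow> k < 0 \<or> k > int n \<Longrightarrow> \<beta> = 0"
  by (auto simp: primitive_forms_def zero_form_eq)

lemma form_module_primitive: "form_module (P k)"
  unfolding form_module_def
  by (auto simp: primitive_iff forms_add forms_scale linear_add[OF Lam_linear] Lam_scale form_scale_zero)

text \<open>On the kernel of \<Lambda> the second commutator reduces to \<Lambda>\<Lambda>d.\<close>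

lemma Lam_d_primitive:
  assumes "B \<in> P k"
  shows "Lam (d B) \<in> P (k - 1)"
proof -
  have B: "B \<in> forms A k" "Lam B = 0" using assms by (auto simp: primitive_iff)
  have "d 0 = 0" using ext_d_scaleR[OF forms_0, of 0] by simp
  then have "Lam (Lam (d B)) = 0"
    using second_commutator[OF B(1)] B(2) by (simp add: linear_0[OF Lam_linear])
  then show ?thesis using Lam_d[OF B(1)] by (simp add: primitive_iff)
qed

lemma forms_degree_unique:
  assumes "\<eta> \<in> forms A k" "\<eta> \<in> forms A l" "\<eta> \<noteq> 0"
  shows "k = l"
proof (rule ccontr)
  assume "k \<noteq> l"
  then have "\<eta> c p vs = 0" for c p vs
    using forms_outside[OF assms(1), of c p vs] forms_outside[OF assms(2), of c p vs] by (cases "int (length vs) = k") auto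
  then have "\<eta> = 0" by (intro ext) simp
  then show False using assms(3) by simp
qed

text \<open>Applying \<Lambda> to dB = B' + L B'' yields (n - k + 1) B'', because B'' is primitive
  of degree k - 1. The degree is an argument since the zero form belongs to every degree.\<close>

definition minus_part :: "int \<Rightarrow> ('a, 'm) mform \<Rightarrow> ('a, 'm) mform" where
  "minus_part k B = (1 / (real n - of_int k + 1)) *\<^sub>R Lam (d B)"

lemma minus_part_primitive: "B \<in> P k \<Longrightarrow> minus_part k B \<in> P (k - 1)"
  unfolding minus_part_def by (rule form_module_scaleR[OF form_module_primitive Lam_d_primitive])

lemma Lam_L_primitive: "B \<in> P k \<Longrightarrow> Lam (L B) = (real n - of_int k) *\<^sub>R B"
  using Lam_L[of B k] by (simp add: primitive_iff linear_0[OF L_linear])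

lemma plus_part_primitive:
  assumes B: "B \<in> P k"
  shows "d B - L (minus_part k B) \<in> P (k + 1)"
proof (cases "0 \<le> k \<and> k \<le> int n")
  case True
  have "L (minus_part k B) \<in> forms A (k + 1)" using L_in_forms[of "minus_part k B" "k - 1"] minus_part_primitive[OF B] by (simp add: primitive_iff add.commute)
  then have "d B - L (minus_part k B) \<in> forms A (k + 1)" using B by (auto simp: primitive_iff intro: forms_diff ext_d_in_forms)
  moreover have "Lam (L (minus_part k B)) = Lam (d B)"
  proof -
    have "Lam (L (minus_part k B)) = (real n - of_int (k - 1)) *\<^sub>R minus_part k B" by (rule Lam_L_primitive[OF minus_part_primitive[OF B]])
    also have "\<dots> = ((real n - of_int (k - 1)) * (1 / (real n - of_int k + 1))) *\<^sub>R Lam (d B)" by (simp add: minus_part_def)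
    also have "(real n - of_int (k - 1)) * (1 / (real n - of_int k + 1)) = 1" using True by (simp add: field_simps)
    finally show ?thesis by simp
  qed
  ultimately show ?thesis by (simp add: primitive_iff linear_diff[OF Lam_linear])
next
  case False
  then have "B = 0" using primitive_forms_zero[OF B] by auto
  moreover have "d 0 = 0" using ext_d_scaleR[OF forms_0, of 0] by simp
  ultimately show ?thesis
    by (simp add: primitive_iff minus_part_def linear_0[OF Lam_linear] linear_0[OF L_linear] forms_0)
qed

lemma del_decomposition_iff:
  assumes B: "B \<in> P k"
  shows "del_decomposition A n \<omega> B B' B'' \<longleftrightarrow> B'' = minus_part k B \<and> B' = d B - L (minus_part k B)"
proof
  assume "del_decomposition A n \<omega> B B' B''"
  then obtain l where l: "0 \<le> l" "l \<le> int n" "B \<in> P l" "B' \<in> P (l + 1)" "B'' \<in> P (l - 1)" "d B = B' + L B''"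
    by (auto simp: del_decomposition_def form_add_eq)
  have d0: "d 0 = 0" using ext_d_scaleR[OF forms_0, of 0] by simp
  have "Lam (d B) = (real n - of_int (l - 1)) *\<^sub>R B''"
    using l Lam_L_primitive[OF l(5)] by (simp add: linear_add[OF Lam_linear] primitive_iff)
  moreover have "real n - of_int (l - 1) \<noteq> 0" using l by linarith
  ultimately have "B'' = (1 / (real n - of_int (l - 1))) *\<^sub>R Lam (d B)" by simp
  \<comment> \<open>The degree can be read off only from a nonzero form; for B = 0 the formula gives
    0 in any degree.\<close>
  moreover have "k = l" if "B \<noteq> 0" using forms_degree_unique[OF _ _ that] B l(3) by (simp add: primitive_iff)
  ultimately have "B'' = minus_part k B"
    by (cases "B = 0") (auto simp: minus_part_def d0 linear_0[OF Lam_linear] algebra_simps)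
  then show "B'' = minus_part k B \<and> B' = d B - L (minus_part k B)" using l(6) by simp
next
  assume eq: "B'' = minus_part k B \<and> B' = d B - L (minus_part k B)"
  have "\<exists>l. 0 \<le> l \<and> l \<le> int n \<and> B \<in> P l \<and> B' \<in> P (l + 1) \<and> B'' \<in> P (l - 1)"
  proof (cases "0 \<le> k \<and> k \<le> int n")
    case True
    then show ?thesis using B minus_part_primitive[OF B] plus_part_primitive[OF B] eq by blast
  next
    case False
    then have "B = 0" using primitive_forms_zero[OF B] by auto
    moreover have "d 0 = 0" using ext_d_scaleR[OF forms_0, of 0] by simp
    ultimately have "B = 0" "B' = 0" "B'' = 0"
      using eq by (auto simp: minus_part_def linear_0[OF Lam_linear] linear_0[OF L_linear])
    moreover have "0 \<in> P j" for j by (simp add: primitive_iff forms_0 linear_0[OF Lam_linear])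
    ultimately show ?thesis by (intro exI[of _ 0]) simp
  qed
  then show "del_decomposition A n \<omega> B B' B''"
    using eq by (auto simp: del_decomposition_def form_add_eq)
qed

abbreviation dp where "dp \<equiv> del_plus A n \<omega>"
abbreviation dm where "dm \<equiv> del_minus A n \<omega>"

lemma del_minus_eq: "B \<in> P k \<Longrightarrow> dm B = minus_part k B"
  and del_plus_eq: "B \<in> P k \<Longrightarrow> dp B = d B - L (minus_part k B)"
  by (simp_all add: del_minus_def del_plus_def del_decomposition_iff)

lemma del_minus_primitive: "B \<in> P k \<Longrightarrow> dm B \<in> P (k - 1)"
  and del_plus_primitive: "B \<in> P k \<Longrightarrow> dp B \<in> P (k + 1)"
  using minus_part_primitive plus_part_primitive by (simp_all add: del_minus_eq del_plus_eq)

lemma d_eq_del: "B \<in> P k \<Longrightarrow> d B = dp B + L (dm B)"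
  by (simp add: del_minus_eq del_plus_eq)

text \<open>The equation d (d B) = 0 reads Q + L R + L (L S) = 0 with primitive Q, R, S of degrees k
  + 2, k, k - 2. Applying \<Lambda> twice isolates a positive multiple of S. With S = 0, applying it
  once isolates (n - k) R, and what is left is Q.\<close>

lemma del_square_degree_le:
  assumes B: "B \<in> P k" "0 \<le> k" "k \<le> int n"
  shows "dm (dm B) = 0" and "dp (dp B) = 0"
proof -
  note lin = linear_add[OF L_linear] linear_add[OF Lam_linear] linear_scale[OF Lam_linear] linear_scale[OF L_linear]
  note pm = del_minus_primitive[OF B(1)] and pp = del_plus_primitive[OF B(1)]
  define Q R S where "Q = dp (dp B)" and "R = dm (dp B) + dp (dm B)" and "S = dm (dm B)"
  have Q_in: "Q \<in> P (k + 2)" using del_plus_primitive[OF pp] by (simp add: Q_def algebra_simps)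
  have R_in: "R \<in> P k"
    using form_module_add[OF form_module_primitive] del_plus_primitive[OF pm] del_minus_primitive[OF pp] by (simp add: R_def)
  have S_in: "S \<in> P (k - 2)" using del_minus_primitive[OF pm] by (simp add: S_def)
  have dmB: "dm B \<in> forms A (k - 1)" "dp B \<in> forms A (k + 1)" using pm pp by (auto simp: primitive_iff)
  have "0 = d (d B)" using ext_d_ext_d[of B k] B by (simp add: primitive_iff)
  also have "\<dots> = d (dp B) + L (d (dm B))"
    unfolding d_eq_del[OF B(1)] using ext_d_add[OF dmB(2) L_in_forms[OF dmB(1)]] by (simp add: d_L[OF dmB(1)])
  also have "\<dots> = Q + L R + L (L S)"
    unfolding d_eq_del[OF pp] d_eq_del[OF pm] by (simp add: Q_def R_def S_def lin add_ac)
  finally have sum: "Q + L R + L (L S) = 0" by simp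
  have LamLS: "Lam (L S) = (real n - of_int k + 2) *\<^sub>R S"
    using Lam_L_primitive[OF S_in] by (simp add: algebra_simps)
  have LamQ: "Lam Q = 0" and LamR: "Lam R = 0" using Q_in R_in by (auto simp: primitive_iff)
  have "Lam (L (L S)) = L (Lam (L S)) + (real n - of_int k) *\<^sub>R L S"
    using Lam_L[OF L_in_forms[of S "k - 2"]] S_in by (simp add: primitive_iff)
  then have LamLLS: "Lam (L (L S)) = (2 * (real n - of_int k) + 2) *\<^sub>R L S"
    unfolding LamLS by (simp add: lin scaleR_add_left[symmetric])
  have "Lam (Lam (Q + L R + L (L S))) = ((2 * (real n - of_int k) + 2) * (real n - of_int k + 2)) *\<^sub>R S"
    using LamQ LamR by (simp add: lin Lam_L_primitive[OF R_in] LamLLS LamLS linear_0[OF Lam_linear])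
  then have "((2 * (real n - of_int k) + 2) * (real n - of_int k + 2)) *\<^sub>R S = 0"
    unfolding sum by (simp add: linear_0[OF Lam_linear])
  moreover have "real n - of_int k \<ge> 0" using B by simp
  ultimately have S0: "S = 0" by (auto simp: scaleR_eq_0_iff)
  have sum': "Q + L R = 0" using sum S0 by (simp add: linear_0[OF L_linear])
  have "Lam (Q + L R) = (real n - of_int k) *\<^sub>R R"
    using LamQ by (simp add: lin Lam_L_primitive[OF R_in])
  then have R0: "(real n - of_int k) *\<^sub>R R = 0" unfolding sum' by (simp add: linear_0[OF Lam_linear])
  from S0 show "dm (dm B) = 0" by (simp add: S_def)
  \<comment> \<open>For k = n the factor n - k gives no information on R, but then Q has degree n +
    2 and vanishes.\<close>
  have "Q = 0"
  proof (cases "k = int n")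
    case True
    then show ?thesis using primitive_forms_zero[OF Q_in] by simp
  next
    case False
    then have "real n - of_int k \<noteq> 0" using B by (metis diff_eq_diff_eq eq_iff_diff_eq_0 of_int_eq_iff of_int_of_nat_eq)
    then have "R = 0" using R0 scaleR_eq_0_iff by blast
    then show ?thesis using sum' by (simp add: linear_0[OF L_linear])
  qed
  then show "dp (dp B) = 0" by (simp add: Q_def)
qed

lemma del_square:
  assumes B: "B \<in> P k"
  shows "dm (dm B) = 0" and "dp (dp B) = 0"
proof -
  have "B \<in> P k \<and> (0 \<le> k \<and> k \<le> int n) \<or> B = 0" using primitive_forms_zero[OF B] B by linarith
  then obtain l where "B \<in> P l" "0 \<le> l" "l \<le> int n"
    using form_module_primitive by (metis forms_0 linear_0[OF Lam_linear] of_nat_0_le_iff order_refl primitive_iff)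
  from del_square_degree_le[OF this] show "dm (dm B) = 0" "dp (dp B) = 0" by auto
qed

text \<open>On P k the operator is a constant multiple of \<Lambda>d, and composing d with a map
  linear over functions keeps the commutator identity.\<close>

lemma del_minus_first_order: "first_order_operator (P k) (P (k - 1)) dm"
proof (rule first_order_operator_cong[OF first_order_operator_subset form_module_primitive del_minus_eq])
  show "first_order_operator (forms A k) (forms A (k + 1 - 2)) (\<lambda>\<eta>. minus_part k \<eta>)"
  proof -
    have "linear (\<lambda>\<eta>. (1 / (real n - of_int k + 1)) *\<^sub>R Lam \<eta>)"
      using linear_compose_scale_right[OF Lam_linear] .
    from first_order_operator_compose_left[OF ext_d_first_order this, of k "forms A (k + 1 - 2)"]
    show ?thesis unfolding minus_part_def by (simp only: Lam_scale form_scale_scaleR forms_scaleR Lam_in_forms)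
  qed
qed (auto simp: primitive_iff minus_part_primitive[unfolded primitive_iff])

lemma del_plus_first_order: "first_order_operator (P k) (P (k + 1)) dp"
proof (rule first_order_operator_cong[OF first_order_operator_subset form_module_primitive del_plus_eq])
  have minus: "first_order_operator (P k) (forms A (k - 1)) (\<lambda>\<eta>. minus_part k \<eta>)"
    by (rule first_order_operator_cong[OF first_order_operator_subset[OF del_minus_first_order] form_module_primitive])
      (auto simp: del_minus_eq del_minus_primitive[unfolded primitive_iff] primitive_iff)
  have "first_order_operator (P k) (forms A (k - 1 + 2)) (\<lambda>\<eta>. L (minus_part k \<eta>))"
    by (rule first_order_operator_compose_left[OF minus L_linear L_scale L_in_forms])
  then have L: "first_order_operator (P k) (forms A (k + 1)) (\<lambda>\<eta>. L (minus_part k \<eta>))" by (simp add: algebra_simps)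
  have "first_order_operator (P k) (forms A (k + 1)) d"
    by (rule first_order_operator_subset[OF ext_d_first_order]) (auto simp: primitive_iff ext_d_in_forms)
  from first_order_operator_minus[OF this L form_module_forms]
  show "first_order_operator (P k) (forms A (k + 1)) (\<lambda>\<eta>. d \<eta> - L (minus_part k \<eta>))" .
qed (use plus_part_primitive in auto)

section \<open>The operator \<open>d\<^sup>\<Lambda>\<close>\<close>

lemma d_Lambda_eq: "d_Lambda A \<omega> \<eta> = d (Lam \<eta>) - Lam (d \<eta>)"
  by (simp add: d_Lambda_def form_diff_eq)

lemma d_Lambda_first_order: "first_order_operator (forms A k) (forms A (k - 1)) (d_Lambda A \<omega>)"
proof -
  have "first_order_operator (forms A k) (forms A (k - 2 + 1)) (\<lambda>\<eta>. d (Lam \<eta>))"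
    by (rule first_order_operator_compose_right[OF ext_d_first_order Lam_linear Lam_scale Lam_in_forms])
  moreover have "first_order_operator (forms A k) (forms A (k + 1 - 2)) (\<lambda>\<eta>. Lam (d \<eta>))"
    by (rule first_order_operator_compose_left[OF ext_d_first_order Lam_linear Lam_scale Lam_in_forms])
  ultimately have "first_order_operator (forms A k) (forms A (k - 1)) (\<lambda>\<eta>. d (Lam \<eta>) - Lam (d \<eta>))"
    by (intro first_order_operator_minus form_module_forms) simp_all
  then show ?thesis by (simp add: d_Lambda_eq[abs_def])
qed

text \<open>By the second commutator 2 \<Lambda>d\<Lambda> = \<Lambda>\<Lambda>d +
  d\<Lambda>\<Lambda>. Multiplication by d from either side gives 2 d\<Lambda>d\<Lambda> =
  d\<Lambda>\<Lambda>d = 2 \<Lambda>d\<Lambda>d, and these are the terms of the square that survive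
  d d = 0.\<close>

lemma d_Lambda_square:
  assumes \<eta>: "\<eta> \<in> forms A k"
  shows "d_Lambda A \<omega> (d_Lambda A \<omega> \<eta>) = 0"
proof -
  note in_forms = d_Lam[OF \<eta>] Lam_d[OF \<eta>] Lam_in_forms[OF \<eta>] ext_d_in_forms[OF \<eta>]
  have comm: "2 *\<^sub>R Lam (d (Lam \<zeta>)) = Lam (Lam (d \<zeta>)) + d (Lam (Lam \<zeta>))" if "\<zeta> \<in> forms A j" for \<zeta> j
    using second_commutator[OF that] by (simp add: algebra_simps)
  have LLd: "Lam (Lam (d \<eta>)) \<in> forms A (k - 3)" "d (Lam (Lam \<eta>)) \<in> forms A (k - 3)"
    using Lam_in_forms[OF in_forms(2)] d_Lam[OF in_forms(3)] by simp_all
  have dd: "d (d \<zeta>) = 0" if "\<zeta> \<in> forms A j" for \<zeta> j using ext_d_ext_d[OF that] .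
  have d0: "d 0 = 0" using ext_d_scaleR[OF forms_0, of 0] by simp
  have 1: "2 *\<^sub>R d (Lam (d (Lam \<eta>))) = d (Lam (Lam (d \<eta>)))"
  proof -
    have "2 *\<^sub>R d (Lam (d (Lam \<eta>))) = d (2 *\<^sub>R Lam (d (Lam \<eta>)))"
      using ext_d_scaleR[OF Lam_in_forms[OF in_forms(1)]] by simp
    also have "\<dots> = d (Lam (Lam (d \<eta>))) + d (d (Lam (Lam \<eta>)))"
      unfolding comm[OF \<eta>] by (rule ext_d_add[OF LLd])
    finally show ?thesis using dd[OF Lam_in_forms[OF in_forms(3)]] by simp
  qed
  have 2: "2 *\<^sub>R Lam (d (Lam (d \<eta>))) = d (Lam (Lam (d \<eta>)))"
    using comm[OF in_forms(4)] dd[OF \<eta>] by (simp add: linear_0[OF Lam_linear])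
  have "d_Lambda A \<omega> (d_Lambda A \<omega> \<eta>) = d (Lam (d (Lam \<eta>))) - d (Lam (Lam (d \<eta>))) + Lam (d (Lam (d \<eta>)))"
    unfolding d_Lambda_eq linear_diff[OF Lam_linear] ext_d_diff[OF in_forms(1,2)]
      ext_d_diff[OF Lam_in_forms[OF in_forms(1)] Lam_in_forms[OF in_forms(2)]]
    using dd[OF in_forms(3)] by (simp add: linear_0[OF Lam_linear])
  then have "2 *\<^sub>R d_Lambda A \<omega> (d_Lambda A \<omega> \<eta>) =
      2 *\<^sub>R d (Lam (d (Lam \<eta>))) - 2 *\<^sub>R d (Lam (Lam (d \<eta>))) + 2 *\<^sub>R Lam (d (Lam (d \<eta>)))"
    by (simp only: scaleR_add_right scaleR_diff_right)
  also have "\<dots> = 0" unfolding 1 2 by (intro ext) simp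
  finally have "2 *\<^sub>R d_Lambda A \<omega> (d_Lambda A \<omega> \<eta>) = 0" .
  then show ?thesis by simp
qed

end

section \<open>The inner product of forms\<close>

locale riemannian_bordered_manifold = bordered_manifold X A
  for X :: "'a topology" and A :: "('a, 'm::finite) chart set" +
  fixes g :: "('a, 'm) metric" and \<mu> :: "'a measure"
  assumes metric: "riemannian_metric A g" and measure: "riemannian_measure X A g \<mu>" and compact: "compact_space X"
begin

lemma g_inner_product: "c \<in> A \<Longrightarrow> p \<in> fst c \<Longrightarrow> inner_product (g c p)"
  using metric unfolding riemannian_metric_def inner_product_def by blast

lemma g_smooth: "c \<in> A \<Longrightarrow> smooth_in_chart c (\<lambda>p. g c p u v)"
  using metric unfolding riemannian_metric_def by blast

lemma g_change:
  "c \<in> A \<Longrightarrow> c' \<in> A \<Longrightarrow> p \<in> fst c \<Longrightarrow> p \<in> fst c' \<Longrightarrow>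
    g c' p (chart_deriv c (snd c') p u) (chart_deriv c (snd c') p v) = g c p u v"
  using metric unfolding riemannian_metric_def by (metis IntI)

text \<open>The chart picked by \<open>SOME\<close> can be exchanged for any other, because the
  transition derivative is an isometry between the metrics in the two charts.\<close>

lemma form_inner_chart:
  assumes c: "c \<in> A" "p \<in> fst c" and \<alpha>: "\<alpha> \<in> forms A k" and \<beta>: "\<beta> \<in> forms A l"
  shows "form_inner A g \<alpha> \<beta> p = alt_inner (g c p) (\<alpha> c p) (\<beta> c p)"
proof -
  define c' where "c' = (SOME c. c \<in> A \<and> p \<in> fst c)"
  have "c' \<in> A \<and> p \<in> fst c'" unfolding c'_def by (rule someI[of _ c]) (use c in simp)
  then have c': "c' \<in> A" "p \<in> fst c'" by simp_all
  note cc = c(1) c'(1) c(2) c'(2)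
  have "(\<lambda>vs. \<alpha> c' p (map (chart_deriv c (snd c') p) vs)) = \<alpha> c p"
    "(\<lambda>vs. \<beta> c' p (map (chart_deriv c (snd c') p) vs)) = \<beta> c p"
    using forms_change[OF \<alpha> cc] forms_change[OF \<beta> cc] by auto
  then have "alt_inner (g c' p) (\<alpha> c' p) (\<beta> c' p) = alt_inner (g c p) (\<alpha> c p) (\<beta> c p)"
    using alt_inner_map[OF inner_product_nondegenerate[OF g_inner_product[OF c]]
        inner_product_nondegenerate[OF g_inner_product[OF c']] transition_linear[OF cc] transition_surj[OF cc]
        g_change[OF cc] forms_alternating[OF \<alpha> c'] forms_alternating[OF \<beta> c']] by simp
  then show ?thesis by (simp add: form_inner_def c'_def[symmetric])
qed

lemma form_inner_smooth:
  assumes \<alpha>: "\<alpha> \<in> forms A k" and \<beta>: "\<beta> \<in> forms A l" and c: "c \<in> A"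
  shows "smooth_in_chart c (form_inner A g \<alpha> \<beta>)"
proof -
  have "smooth_components c (\<beta> c)" using forms_smooth[OF \<beta> c] by blast
  note ins = smooth_in_chart_insert_fields[OF this forms_alternating[OF \<beta> c]]
  have dual: "smooth_in_chart c (\<lambda>q. dual_basis (g c q) i $ j)" for i j
    by (rule smooth_in_chart_dual_basis[where B="g c"])
      (simp_all add: inner_product_nondegenerate[OF g_inner_product[OF c]] g_smooth[OF c])
  have "smooth_in_chart c (\<lambda>q. \<beta> c q (map (\<lambda>Y. Y q) (map (\<lambda>i q. dual_basis (g c q) i) is)))" for "is"
    by (rule ins) (use dual in auto)
  then have "smooth_in_chart c (\<lambda>q. \<beta> c q (map (dual_basis (g c q)) is))" for "is"
    by (simp add: o_def)
  then have "smooth_in_chart c (\<lambda>q. alt_inner (g c q) (\<alpha> c q) (\<beta> c q))"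
    unfolding alt_inner_def divide_inverse
    by (intro smooth_in_chart_sum smooth_in_chart_mult smooth_in_chart_const forms_smooth[OF \<alpha> c])
  then show ?thesis by (rule smooth_in_chart_cong) (simp add: form_inner_chart[OF c _ \<alpha> \<beta>])
qed

lemma form_inner_add_left: "form_inner A g (\<alpha> + \<alpha>') \<beta> p = form_inner A g \<alpha> \<beta> p + form_inner A g \<alpha>' \<beta> p"
  and form_inner_add_right: "form_inner A g \<alpha> (\<beta> + \<beta>') p = form_inner A g \<alpha> \<beta> p + form_inner A g \<alpha> \<beta>' p"
  and form_inner_scale_left: "form_inner A g (form_scale f \<alpha>) \<beta> p = f p * form_inner A g \<alpha> \<beta> p"
  and form_inner_scale_right: "form_inner A g \<alpha> (form_scale f \<beta>) p = f p * form_inner A g \<alpha> \<beta> p"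
  and form_inner_zero_left: "form_inner A g 0 \<beta> p = 0"
  by (simp_all add: form_inner_def Let_def alt_inner_def form_scale_def sum.distrib[symmetric] sum_distrib_left
      add_divide_distrib[symmetric] algebra_simps)

section \<open>The Riemannian measure\<close>

lemma sets_\<mu>: "sets \<mu> = sigma_sets (topspace X) {U. openin X U}"
  using measure by (simp add: riemannian_measure_def)

lemma open_in_sets: "openin X U \<Longrightarrow> U \<in> sets \<mu>"
  by (simp add: sets_\<mu>)

lemma space_\<mu>: "space \<mu> = topspace X"
proof
  have "{U. openin X U} \<subseteq> Pow (topspace X)" using openin_subset by auto
  from sigma_sets_into_sp[OF this] show "space \<mu> \<subseteq> topspace X"
    using sets.top[of \<mu>] by (simp add: sets_\<mu>)
  show "topspace X \<subseteq> space \<mu>" using sets.sets_into_space[OF open_in_sets[of "topspace X"]] by simp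
qed

definition density :: "('a, 'm) chart \<Rightarrow> real ^ 'm \<Rightarrow> real" where
  "density c x = sqrt (det (\<chi> i j. coord_rep c (\<lambda>p. g c p (axis i 1) (axis j 1)) x))"

lemma emeasure_eq:
  assumes "c \<in> A" "openin X U" "U \<subseteq> fst c"
  shows "emeasure \<mu> U = (\<integral>\<^sup>+ x. ennreal (density c x) * indicator (snd c ` U) x \<partial>lborel)"
  using measure assms open_in_sets by (simp add: riemannian_measure_def density_def)

lemma density_pos:
  assumes "c \<in> A" "x \<in> coord_image c"
  shows "0 < density c x"
proof -
  obtain p where p: "p \<in> fst c" "x = snd c p" using assms(2) by (rule coord_imageE)
  then show ?thesis
    using det_inner_product_pos[OF g_inner_product[OF assms(1) p(1)]] assms(1) by (simp add: density_def)
qed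

lemma continuous_on_density:
  assumes c: "c \<in> A"
  shows "continuous_on (coord_image c) (density c)"
proof -
  have "smooth_in_chart c (\<lambda>p. det (\<chi> i j. g c p (axis i 1) (axis j 1)))"
    by (rule smooth_in_chart_det) (simp add: g_smooth[OF c])
  then have "continuous_on (coord_image c) (coord_rep c (\<lambda>p. det (\<chi> i j. g c p (axis i 1) (axis j 1))))"
    unfolding smooth_in_chart_def by (rule smooth_on_continuous)
  then have "continuous_on (coord_image c) (\<lambda>x. sqrt (coord_rep c (\<lambda>p. det (\<chi> i j. g c p (axis i 1) (axis j 1))) x))"
    by (rule continuous_on_real_sqrt)
  then show ?thesis by (simp add: density_def[abs_def] coord_rep_def o_def)
qed

lemma locally_finite_measure:
  assumes "p \<in> topspace X"
  shows "\<exists>U. openin X U \<and> p \<in> U \<and> emeasure \<mu> U < \<infinity>"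
proof -
  obtain c where c: "c \<in> A" "p \<in> fst c" using assms topspace_eq by auto
  let ?x = "snd c p"
  obtain r where r: "0 < r" "\<And>y. y \<in> ball ?x r \<Longrightarrow> 0 \<le> y $ bdry_index \<Longrightarrow> y \<in> coord_image c"
    using hs_open_ball[OF chart_image_open[OF c(1)] coord_imageI[OF c(2)]] by blast
  \<comment> \<open>The density is bounded on this compact half-ball, which yields a neighbourhood
    of finite measure.\<close>
  define K where "K = cball ?x (r / 2) \<inter> half_space"
  have K: "compact K" "K \<subseteq> coord_image c"
    unfolding K_def half_space_def
    by (intro compact_Int_closed compact_cball closed_halfspace_component_ge_cart) (use r in auto)
  have "compact (density c ` K)"
    using compact_continuous_image[OF continuous_on_subset[OF continuous_on_density[OF c(1)] K(2)] K(1)] .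
  then have "bdd_above (density c ` K)" by (intro bounded_imp_bdd_above compact_imp_bounded)
  then obtain M where M: "\<And>x. x \<in> K \<Longrightarrow> density c x \<le> M" by (auto simp: bdd_above_def)
  let ?U = "{q \<in> fst c. snd c q \<in> ball ?x (r / 2)}"
  have U: "openin X ?U" "p \<in> ?U" "?U \<subseteq> fst c"
    using preimage_of_open[OF c(1), of "ball ?x (r / 2)"] c(2) r(1) by auto
  have img: "snd c ` ?U \<subseteq> K \<inter> ball ?x (r / 2)"
    using hs_openD[OF chart_image_open[OF c(1)] coord_imageI] by (auto simp: K_def half_space_def)
  have "emeasure \<mu> ?U \<le> (\<integral>\<^sup>+ x. ennreal M * indicator (ball ?x (r / 2)) x \<partial>lborel)"
    unfolding emeasure_eq[OF c(1) U(1,3)]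
  proof (rule nn_integral_mono)
    fix x
    show "ennreal (density c x) * indicator (snd c ` ?U) x \<le> ennreal M * indicator (ball ?x (r / 2)) x"
    proof (cases "x \<in> snd c ` ?U")
      case True
      then have "x \<in> K" "x \<in> ball ?x (r / 2)" using img by blast+
      then show ?thesis using M[of x] True by (simp add: ennreal_leI del: mem_ball)
    qed simp
  qed
  also have "\<dots> = ennreal M * emeasure lborel (ball ?x (r / 2))"
    by (simp add: nn_integral_cmult_indicator)
  also have "\<dots> < \<infinity>"
    using emeasure_bounded_finite[OF bounded_ball, of ?x "r / 2"] by (simp add: ennreal_mult_less_top)
  finally show ?thesis using U by blast
qed

text \<open>Compactness covers the space by finitely many open sets of finite measure. Continuous
  functions, in particular inner products of smooth forms, thereby become integrable.\<close>

lemma finite_measure_\<mu>: "finite_measure \<mu>"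
proof
  let ?C = "{U. openin X U \<and> emeasure \<mu> U < \<infinity>}"
  have "compactin X (topspace X)" using compact by (simp add: compact_space_def)
  moreover have "topspace X \<subseteq> \<Union>?C" using locally_finite_measure by blast
  ultimately obtain F where F: "finite F" "F \<subseteq> ?C" "topspace X \<subseteq> \<Union>F"
    unfolding compactin_def by (metis (no_types, lifting) mem_Collect_eq)
  have "emeasure \<mu> (topspace X) \<le> emeasure \<mu> (\<Union>U\<in>F. U)"
    by (rule emeasure_mono) (use F open_in_sets in \<open>auto intro!: sets.finite_UN\<close>)
  also have "\<dots> \<le> (\<Sum>U\<in>F. emeasure \<mu> U)"
    by (rule emeasure_subadditive_finite) (use F open_in_sets in auto)
  also have "\<dots> < \<infinity>" using F by (auto simp: less_top)
  finally show "emeasure \<mu> (space \<mu>) \<noteq> \<infinity>" by (simp add: space_\<mu>)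
qed

text \<open>The measure has full support: the coordinate image of a nonempty U contains a closed
  ball away from the boundary, on which the density has a positive minimum.\<close>

lemma open_null_empty:
  assumes c: "c \<in> A" and U: "openin X U" "U \<subseteq> fst c" and null: "emeasure \<mu> U = 0"
  shows "U = {}"
proof (rule ccontr)
  assume "U \<noteq> {}"
  then obtain p where p: "p \<in> U" by blast
  let ?x = "snd c p" and ?S = "snd c ` U"
  have S: "hs_open ?S" using image_of_open[OF c U] .
  have x: "?x \<in> ?S" using p by blast
  obtain r where r: "0 < r" "\<And>y. y \<in> ball ?x r \<Longrightarrow> 0 \<le> y $ bdry_index \<Longrightarrow> y \<in> ?S"
    using hs_open_ball[OF S x] by blast
  \<comment> \<open>Moving inwards by r / 2 lets the ball of radius r / 4 around y avoid the
    boundary and stay in \<open>ball ?x r\<close>, since r / 2 + r / 4 < r.\<close>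
  define y where "y = ?x + (r / 2) *\<^sub>R normal_dir"
  have KS: "cball y (r / 4) \<subseteq> ?S"
  proof
    fix z assume z: "z \<in> cball y (r / 4)"
    have "dist ?x z \<le> dist ?x y + dist y z" by (rule dist_triangle)
    also have "dist ?x y = r / 2" using r(1) by (simp add: y_def dist_norm normal_dir_def)
    finally have zb: "z \<in> ball ?x r" using z r(1) by simp
    have "\<bar>(y - z) $ bdry_index\<bar> \<le> r / 4"
      using component_le_norm_cart[of "y - z" bdry_index] z by (simp add: dist_norm)
    then have 1: "y $ bdry_index - z $ bdry_index \<le> r / 4"
      by (simp only: vector_minus_component abs_le_iff)
    have "y $ bdry_index = ?x $ bdry_index + r / 2" by (simp add: y_def normal_dir_def)
    then have "0 \<le> z $ bdry_index"
      using 1 hs_openD[OF S x] r(1) by linarith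
    then show "z \<in> ?S" using r(2) zb by blast
  qed
  have SI: "?S \<subseteq> coord_image c" using U by (auto simp: coord_image_def)
  have "continuous_on (cball y (r / 4)) (density c)"
    using continuous_on_subset[OF continuous_on_density[OF c]] KS SI by blast
  then obtain z where z: "z \<in> cball y (r / 4)" "\<And>w. w \<in> cball y (r / 4) \<Longrightarrow> density c z \<le> density c w"
    using continuous_attains_inf[of "cball y (r / 4)" "density c"] r(1) by auto
  have zpos: "0 < density c z" using density_pos[OF c] KS SI z(1) by blast
  have "ennreal (density c z) * emeasure lborel (cball y (r / 4)) =
      (\<integral>\<^sup>+ x. ennreal (density c z) * indicator (cball y (r / 4)) x \<partial>lborel)"
    by (simp add: nn_integral_cmult_indicator)
  also have "\<dots> \<le> emeasure \<mu> U"
    unfolding emeasure_eq[OF c U]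
  proof (rule nn_integral_mono)
    fix w
    show "ennreal (density c z) * indicator (cball y (r / 4)) w \<le> ennreal (density c w) * indicator ?S w"
    proof (cases "w \<in> cball y (r / 4)")
      case True
      then have "w \<in> ?S" using KS by blast
      then show ?thesis using z(2)[OF True] True by (simp add: ennreal_leI del: mem_cball)
    qed simp
  qed
  finally have "emeasure lborel (cball y (r / 4)) = 0" using null zpos by simp
  moreover have "0 < measure lborel (cball y (r / 4))" using content_cball_pos[of "r / 4" y] r(1) by simp
  ultimately show False by (simp add: measure_def)
qed

lemma continuous_measurable:
  fixes f :: "'a \<Rightarrow> real"
  assumes "continuous_map X euclidean f"
  shows "f \<in> borel_measurable \<mu>"
proof (rule borel_measurableI)
  fix V :: "real set" assume "open V"
  then have "openin X {p \<in> topspace X. f p \<in> V}"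
    using assms by (simp add: continuous_map_def open_openin[symmetric])
  moreover have "f -` V \<inter> space \<mu> = {p \<in> topspace X. f p \<in> V}" by (auto simp: space_\<mu>)
  ultimately show "f -` V \<inter> space \<mu> \<in> sets \<mu>" using open_in_sets by simp
qed

lemma continuous_integrable:
  fixes f :: "'a \<Rightarrow> real"
  assumes f: "continuous_map X euclidean f"
  shows "integrable \<mu> f"
proof -
  interpret finite_measure \<mu> by (rule finite_measure_\<mu>)
  have "compactin euclidean (f ` topspace X)"
    using image_compactin[OF _ f] compact by (simp add: compact_space_def)
  then have "bounded (f ` topspace X)" by (simp add: compact_imp_bounded)
  then obtain M where "\<And>p. p \<in> topspace X \<Longrightarrow> norm (f p) \<le> M" by (auto simp: bounded_iff)
  then show ?thesis
    by (intro integrable_const_bound[of _ M] continuous_measurable[OF f]) (auto simp: space_\<mu>)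
qed

lemma form_inner_integrable:
  assumes "\<alpha> \<in> forms A k" "\<beta> \<in> forms A l"
  shows "integrable \<mu> (form_inner A g \<alpha> \<beta>)"
  by (rule continuous_integrable[OF continuous_map_chartwise[OF form_inner_smooth[OF assms]]])

abbreviation ip where "ip \<equiv> L2_inner A g \<mu>"

lemma L2_add_left: "\<alpha> \<in> forms A k \<Longrightarrow> \<alpha>' \<in> forms A k \<Longrightarrow> \<beta> \<in> forms A l \<Longrightarrow> ip (\<alpha> + \<alpha>') \<beta> = ip \<alpha> \<beta> + ip \<alpha>' \<beta>"
  and L2_add_right: "\<alpha> \<in> forms A k \<Longrightarrow> \<beta> \<in> forms A l \<Longrightarrow> \<beta>' \<in> forms A l \<Longrightarrow> ip \<alpha> (\<beta> + \<beta>') = ip \<alpha> \<beta> + ip \<alpha> \<beta>'"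
  by (simp_all add: L2_inner_def form_inner_add_left form_inner_add_right form_inner_integrable)

lemma L2_scale: "ip (form_scale f \<alpha>) \<beta> = ip \<alpha> (form_scale f \<beta>)"
  by (simp add: L2_inner_def form_inner_scale_left form_inner_scale_right)

lemma L2_zero_left: "ip 0 \<beta> = 0"
  by (simp add: L2_inner_def form_inner_zero_left)

lemma L2_diff_right:
  assumes "\<alpha> \<in> forms A k" "\<beta> \<in> forms A l" "\<beta>' \<in> forms A l"
  shows "ip \<alpha> (\<beta> - \<beta>') = ip \<alpha> \<beta> - ip \<alpha> \<beta>'"
  using L2_add_right[OF assms(1) forms_diff[OF assms(2,3)] assms(3)] by simp

section \<open>Test forms and locality of first-order operators\<close>

definition support :: "('a, 'm) mform \<Rightarrow> 'a set" where
  "support \<alpha> = {p \<in> topspace X. \<exists>c\<in>A. p \<in> fst c \<and> (\<exists>vs. \<alpha> c p vs \<noteq> 0)}"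

abbreviation test_form where "test_form \<equiv> compactly_supported_in_interior X A"

text \<open>Closed subsets of a compact space are compact.\<close>

lemma test_form_iff: "test_form \<alpha> \<longleftrightarrow> X closure_of support \<alpha> \<inter> boundary A = {}"
proof -
  have "compactin X (X closure_of support \<alpha>)"
    by (rule closedin_compact_space[OF compact closedin_closure_of])
  then show ?thesis by (simp add: compactly_supported_in_interior_def support_def)
qed

lemma test_form_subset:
  assumes "test_form \<alpha>" "support \<beta> \<subseteq> X closure_of support \<alpha>"
  shows "test_form \<beta>"
proof -
  have "X closure_of support \<beta> \<subseteq> X closure_of support \<alpha>"
    using closure_of_minimal[OF assms(2) closedin_closure_of] .
  then show ?thesis using assms(1) by (auto simp: test_form_iff)
qed

lemma test_form_scale: "test_form \<alpha> \<Longrightarrow> test_form (form_scale f \<alpha>)"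
proof (erule test_form_subset)
  have "support (form_scale f \<alpha>) \<subseteq> support \<alpha>" by (auto simp: support_def form_scale_def)
  also have "\<dots> \<subseteq> X closure_of support \<alpha>" by (rule closure_of_subset) (auto simp: support_def)
  finally show "support (form_scale f \<alpha>) \<subseteq> X closure_of support \<alpha>" .
qed

lemma interior_open: "openin X (topspace X - boundary A)"
proof -
  have "topspace X - boundary A = (\<Union>c\<in>A. {q \<in> fst c. snd c q \<in> {y. 0 < y $ bdry_index}})"
  proof -
    have "q \<in> boundary A \<longleftrightarrow> \<not> 0 < snd c q $ bdry_index" if "c \<in> A" "q \<in> fst c" for c q
      using boundary_iff[OF that] hs_openD[OF chart_image_open[OF that(1)] coord_imageI[OF that(2)]] by auto
    then show ?thesis by (auto simp: topspace_eq)
  qed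
  moreover have "openin X {q \<in> fst c. snd c q \<in> {y. 0 < y $ bdry_index}}" if "c \<in> A" for c
    by (rule preimage_of_open[OF that open_halfspace_component_gt_cart])
  ultimately show ?thesis by auto
qed

text \<open>A first-order operator is local: if \<open>\<beta>\<close> vanishes near \<open>p\<close>, apply the commutator identity to a
  bump function supported where \<open>\<beta>\<close> vanishes.\<close>

lemma first_order_operator_support:
  assumes T: "first_order_operator E F T" and E: "form_module E" and \<beta>: "\<beta> \<in> E"
  shows "support (T \<beta>) \<subseteq> X closure_of support \<beta>"
proof
  fix p assume p: "p \<in> support (T \<beta>)"
  then obtain c vs where c: "c \<in> A" "p \<in> fst c" "T \<beta> c p vs \<noteq> 0" by (auto simp: support_def)
  show "p \<in> X closure_of support \<beta>"
  proof (rule ccontr)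
    assume "p \<notin> X closure_of support \<beta>"
    then have in_U: "p \<in> topspace X - X closure_of support \<beta>" using in_topspace[OF c(1,2)] by simp
    have "openin X (topspace X - X closure_of support \<beta>)" by (simp add: openin_diff)
    note bump_function_exists[OF c(1,2) this in_U]
    then obtain \<phi> K where "smooth_function A \<phi> \<and> (\<forall>q. 0 \<le> \<phi> q) \<and> 0 < \<phi> p \<and> (\<forall>q. q \<notin> K \<longrightarrow> \<phi> q = 0) \<and>
        K \<subseteq> topspace X - X closure_of support \<beta> \<and> closedin X K"
      by (elim exE) (rule that)
    then have \<phi>: "smooth_function A \<phi>" "\<And>q. 0 \<le> \<phi> q" "0 < \<phi> p" "\<And>q. q \<notin> K \<Longrightarrow> \<phi> q = 0"
        "K \<subseteq> topspace X - X closure_of support \<beta>" "closedin X K"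
      by simp_all
    obtain k where k: "E \<subseteq> forms A k" using E by (auto simp: form_module_def)
    have "form_scale \<phi> \<beta> c' q ws = 0" for c' q ws
    proof (cases "c' \<in> A \<and> q \<in> fst c' \<and> q \<in> K")
      case True
      then have "q \<notin> support \<beta>" using \<phi>(5) closure_of_subset[of "support \<beta>" X] by (auto simp: support_def)
      then show ?thesis using True in_topspace[of c' q] by (auto simp: support_def form_scale_def)
    next
      case False
      then show ?thesis using \<phi>(4)[of q] forms_outside[of \<beta> k c' q ws] \<beta> k by (auto simp: form_scale_def)
    qed
    then have zero: "form_scale \<phi> \<beta> = 0" by (intro ext) simp
    have "0 \<in> E" using form_module_scale[OF E \<beta> \<phi>(1)] zero by simp
    then have "T 0 = 0" using first_order_operator_zero[OF T] by simp
    \<comment> \<open>With both functions equal to \<phi> and \<phi> \<beta> = 0, the other three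
      terms of the commutator identity vanish.\<close>
    then have "form_scale \<phi> (form_scale \<phi> (T \<beta>)) = 0"
      using first_order_operatorD(3)[OF T \<beta> \<phi>(1,1)] zero by (simp add: form_scale_zero)
    then have "form_scale \<phi> (form_scale \<phi> (T \<beta>)) c p vs = 0" by simp
    then show False using \<phi>(3) c(3) by (simp add: form_scale_def)
  qed
qed

lemma test_form_operator:
  "first_order_operator E F T \<Longrightarrow> form_module E \<Longrightarrow> \<alpha> \<in> E \<Longrightarrow> test_form \<alpha> \<Longrightarrow> test_form (T \<alpha>)"
  using test_form_subset[OF _ first_order_operator_support] by blast

text \<open>The test forms are \<phi> \<gamma> with a bump function \<phi> in the interior. They
  stay in \<open>E\<close> because \<open>E\<close> is a module, so the argument also works among
  primitive forms. A vanishing integral of \<phi> times the squared length of \<gamma> forces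
  \<gamma> = 0 where \<phi> is positive, and continuity takes care of the boundary.\<close>

lemma L2_nondegenerate:
  assumes E: "form_module E" and \<gamma>: "\<gamma> \<in> E" and orth: "\<And>\<alpha>. \<alpha> \<in> E \<Longrightarrow> test_form \<alpha> \<Longrightarrow> ip \<alpha> \<gamma> = 0"
  shows "\<gamma> = 0"
proof -
  obtain k where "E \<subseteq> forms A k" using E by (auto simp: form_module_def)
  then have \<gamma>k: "\<gamma> \<in> forms A k" using \<gamma> by blast
  have self: "0 \<le> form_inner A g \<gamma> \<gamma> p" if "c \<in> A" "p \<in> fst c" for c p
    using alt_inner_self(1)[OF g_inner_product[OF that] forms_alternating[OF \<gamma>k that]]
    by (simp add: form_inner_chart[OF that \<gamma>k \<gamma>k])
  have interior: "\<gamma> c p vs = 0" if c: "c \<in> A" "p \<in> fst c" and p: "p \<notin> boundary A" for c p vs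
  proof -
    have "p \<in> topspace X - boundary A" using in_topspace[OF c] p by simp
    note bump_function_exists[OF c interior_open this]
    then obtain \<phi> K where "smooth_function A \<phi> \<and> (\<forall>q. 0 \<le> \<phi> q) \<and> 0 < \<phi> p \<and> (\<forall>q. q \<notin> K \<longrightarrow> \<phi> q = 0) \<and>
        K \<subseteq> topspace X - boundary A \<and> closedin X K"
      by (elim exE) (rule that)
    then have \<phi>: "smooth_function A \<phi>" "\<And>q. 0 \<le> \<phi> q" "0 < \<phi> p" "\<And>q. q \<notin> K \<Longrightarrow> \<phi> q = 0"
        "K \<subseteq> topspace X - boundary A" "closedin X K"
      by simp_all
    let ?f = "\<lambda>q. \<phi> q * form_inner A g \<gamma> \<gamma> q"
    have "support (form_scale \<phi> \<gamma>) \<subseteq> K" using \<phi>(4) by (force simp: support_def form_scale_def)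
    from closure_of_minimal[OF this \<phi>(6)] have "test_form (form_scale \<phi> \<gamma>)"
      using \<phi>(5) by (auto simp: test_form_iff)
    then have "ip (form_scale \<phi> \<gamma>) \<gamma> = 0" using orth form_module_scale[OF E \<gamma> \<phi>(1)] by blast
    then have int0: "integral\<^sup>L \<mu> ?f = 0" by (simp add: L2_inner_def form_inner_scale_left)
    have cont: "continuous_map X euclidean ?f"
      using \<phi>(1) by (intro continuous_map_chartwise smooth_in_chart_mult form_inner_smooth[OF \<gamma>k \<gamma>k])
        (auto simp: smooth_function_def)
    have nonneg: "0 \<le> ?f q" if "q \<in> topspace X" for q
      using that self \<phi>(2) by (auto simp: topspace_eq)
    have "AE q in \<mu>. ?f q = 0"
    proof -
      have "AE q in \<mu>. 0 \<le> ?f q" by (rule AE_I2) (use nonneg in \<open>simp only: space_\<mu>\<close>)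
      then show ?thesis using integral_nonneg_eq_0_iff_AE[OF continuous_integrable[OF cont]] int0 by simp
    qed
    moreover
    have V: "openin X {q \<in> topspace X. ?f q \<in> {0<..}}"
      by (rule openin_continuous_map_preimage[OF cont]) (simp add: open_openin[symmetric] del: greaterThan_iff)
    \<comment> \<open>The intersection with the chart domain makes \<open>open_null_empty\<close>
      applicable to the set where \<open>?f\<close> is positive.\<close>
    let ?V = "fst c \<inter> {q \<in> topspace X. ?f q \<in> {0<..}}"
    have V': "openin X ?V" "?V \<subseteq> fst c" using V chart_open[OF c(1)] by auto
    ultimately have "AE q in \<mu>. \<not> q \<in> ?V" by (elim eventually_mono) (metis (mono_tags, lifting) Int_iff mem_Collect_eq greaterThan_iff less_irrefl)
    from emeasure_eq_0_AE[OF this] have "emeasure \<mu> {q \<in> topspace X. q \<in> ?V} = 0" by (simp only: space_\<mu>)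
    moreover have "{q \<in> topspace X. q \<in> ?V} = ?V" by blast
    ultimately have "emeasure \<mu> ?V = 0" by (simp only:)
    then have "?V = {}" using open_null_empty[OF c(1) V'] by blast
    then have "p \<notin> ?V" by simp
    then have "\<not> 0 < ?f p" using in_topspace[OF c] c(2) by simp
    then have "?f p = 0" using nonneg[OF in_topspace[OF c]] by linarith
    then have "alt_inner (g c p) (\<gamma> c p) (\<gamma> c p) = 0" using \<phi>(3) by (simp add: form_inner_chart[OF c \<gamma>k \<gamma>k])
    then show ?thesis using alt_inner_self(2)[OF g_inner_product[OF c] forms_alternating[OF \<gamma>k c]] by simp
  qed
  have "\<gamma> c p vs = 0" for c p vs
  proof (cases "c \<in> A \<and> p \<in> fst c")
    case True
    then show ?thesis
      using smooth_eq_zero_of_interior[of c p "\<lambda>q. \<gamma> c q vs"] forms_smooth[OF \<gamma>k] interior by blast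
  next
    case False
    then show ?thesis using forms_outside[OF \<gamma>k] by blast
  qed
  then show ?thesis by (intro ext) simp
qed

section \<open>Formal adjoints\<close>

lemma formal_adjointD:
  assumes "formal_adjoint X A g \<mu> E F T T'" "\<beta> \<in> F"
  shows "T' \<beta> \<in> E" and "\<alpha> \<in> E \<Longrightarrow> test_form \<alpha> \<Longrightarrow> ip \<alpha> (T' \<beta>) = ip (T \<alpha>) \<beta>"
  using assms by (auto simp: formal_adjoint_def)

text \<open>Pairing with a test form \<alpha> moves T' and the multiplications onto \<alpha> in
  reverse order, which merely exchanges the two terms on each side of the identity for T.
  Nondegeneracy then removes \<alpha>. Additivity of T' is obtained in the same way.\<close>

lemma adjoint_first_order:
  assumes E: "form_module E" and F: "form_module F" and T: "first_order_operator E F T"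
    and adj: "formal_adjoint X A g \<mu> E F T T'"
  shows "first_order_operator F E T'"
  unfolding first_order_operator_def
proof (intro conjI ballI allI impI)
  obtain k l where "E \<subseteq> forms A k" "F \<subseteq> forms A l" using E F by (auto simp: form_module_def)
  then have Ek: "\<And>\<eta>. \<eta> \<in> E \<Longrightarrow> \<eta> \<in> forms A k" and Fl: "\<And>\<eta>. \<eta> \<in> F \<Longrightarrow> \<eta> \<in> forms A l" by auto
  note TF = first_order_operatorD(1)[OF T] and T'E = formal_adjointD(1)[OF adj] and ip = formal_adjointD(2)[OF adj]
  note addE = form_module_add[OF E] and diffE = form_module_diff[OF E] and scE = form_module_scale[OF E]
  note addF = form_module_add[OF F] and diffF = form_module_diff[OF F] and scF = form_module_scale[OF F]
  show "T' \<eta> \<in> E" if "\<eta> \<in> F" for \<eta> using T'E[OF that] .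
  show "T' (\<eta> + \<zeta>) = T' \<eta> + T' \<zeta>" if \<eta>: "\<eta> \<in> F" and \<zeta>: "\<zeta> \<in> F" for \<eta> \<zeta>
  proof -
    have "T' (\<eta> + \<zeta>) - (T' \<eta> + T' \<zeta>) = 0"
    proof (rule L2_nondegenerate[OF E])
      show "T' (\<eta> + \<zeta>) - (T' \<eta> + T' \<zeta>) \<in> E" by (intro diffE addE T'E addF \<eta> \<zeta>)
      fix \<alpha> assume \<alpha>: "\<alpha> \<in> E" "test_form \<alpha>"
      have "ip \<alpha> (T' (\<eta> + \<zeta>) - (T' \<eta> + T' \<zeta>)) = ip (T \<alpha>) (\<eta> + \<zeta>) - (ip (T \<alpha>) \<eta> + ip (T \<alpha>) \<zeta>)"
        using L2_diff_right[OF Ek[OF \<alpha>(1)] Ek[OF T'E[OF addF[OF \<eta> \<zeta>]]] Ek[OF addE[OF T'E[OF \<eta>] T'E[OF \<zeta>]]]]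
          L2_add_right[OF Ek[OF \<alpha>(1)] Ek[OF T'E[OF \<eta>]] Ek[OF T'E[OF \<zeta>]]]
          ip[OF addF[OF \<eta> \<zeta>] \<alpha>] ip[OF \<eta> \<alpha>] ip[OF \<zeta> \<alpha>] by simp
      then show "ip \<alpha> (T' (\<eta> + \<zeta>) - (T' \<eta> + T' \<zeta>)) = 0"
        using L2_add_right[OF Fl[OF TF[OF \<alpha>(1)]] Fl[OF \<eta>] Fl[OF \<zeta>]] by simp
    qed
    then show ?thesis by simp
  qed
  fix \<eta> f h assume \<eta>: "\<eta> \<in> F" and f: "smooth_function A f" "smooth_function A h"
  let ?l = "T' (form_scale f (form_scale h \<eta>)) + form_scale f (form_scale h (T' \<eta>))"
  let ?r = "form_scale f (T' (form_scale h \<eta>)) + form_scale h (T' (form_scale f \<eta>))"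
  note \<eta>s = scF[OF \<eta> f(1)] scF[OF \<eta> f(2)] scF[OF scF[OF \<eta> f(2)] f(1)]
  have E4: "T' (form_scale f (form_scale h \<eta>)) \<in> E" "form_scale f (form_scale h (T' \<eta>)) \<in> E"
    "form_scale f (T' (form_scale h \<eta>)) \<in> E" "form_scale h (T' (form_scale f \<eta>)) \<in> E"
    by (intro scE T'E f \<eta>s \<eta>)+
  have "?l - ?r = 0"
  proof (rule L2_nondegenerate[OF E])
    show "?l - ?r \<in> E" by (intro diffE addE E4)
    fix \<alpha> assume \<alpha>: "\<alpha> \<in> E" "test_form \<alpha>"
    have \<alpha>s: "form_scale f \<alpha> \<in> E" "form_scale h \<alpha> \<in> E" "form_scale f (form_scale h \<alpha>) \<in> E"
      by (intro scE f \<alpha>)+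
    note test = test_form_scale[OF \<alpha>(2)]
    have F4: "T (form_scale f (form_scale h \<alpha>)) \<in> F" "form_scale f (form_scale h (T \<alpha>)) \<in> F"
      "form_scale f (T (form_scale h \<alpha>)) \<in> F" "form_scale h (T (form_scale f \<alpha>)) \<in> F"
      by (intro scF TF f \<alpha>s \<alpha>)+
    have "ip \<alpha> (?l - ?r) = ip \<alpha> (T' (form_scale f (form_scale h \<eta>))) + ip \<alpha> (form_scale f (form_scale h (T' \<eta>)))
        - (ip \<alpha> (form_scale f (T' (form_scale h \<eta>))) + ip \<alpha> (form_scale h (T' (form_scale f \<eta>))))"
      using L2_diff_right[OF Ek[OF \<alpha>(1)] Ek[OF addE[OF E4(1,2)]] Ek[OF addE[OF E4(3,4)]]]
        L2_add_right[OF Ek[OF \<alpha>(1)] Ek[OF E4(1)] Ek[OF E4(2)]] L2_add_right[OF Ek[OF \<alpha>(1)] Ek[OF E4(3)] Ek[OF E4(4)]]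
      by simp
    also have "ip \<alpha> (T' (form_scale f (form_scale h \<eta>))) = ip (form_scale f (form_scale h (T \<alpha>))) \<eta>"
      using ip[OF \<eta>s(3) \<alpha>] by (simp add: L2_scale form_scale_commute)
    also have "ip \<alpha> (form_scale f (form_scale h (T' \<eta>))) = ip (T (form_scale f (form_scale h \<alpha>))) \<eta>"
      using ip[OF \<eta> \<alpha>s(3) test_form_scale[OF test]] by (simp add: L2_scale form_scale_commute)
    also have "ip \<alpha> (form_scale f (T' (form_scale h \<eta>))) = ip (form_scale h (T (form_scale f \<alpha>))) \<eta>"
      using ip[OF \<eta>s(2) \<alpha>s(1) test] by (simp add: L2_scale)
    also have "ip \<alpha> (form_scale h (T' (form_scale f \<eta>))) = ip (form_scale f (T (form_scale h \<alpha>))) \<eta>"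
      using ip[OF \<eta>s(1) \<alpha>s(2) test] by (simp add: L2_scale)
    finally have eq: "ip \<alpha> (?l - ?r) = ip (form_scale f (form_scale h (T \<alpha>))) \<eta> + ip (T (form_scale f (form_scale h \<alpha>))) \<eta>
        - (ip (form_scale h (T (form_scale f \<alpha>))) \<eta> + ip (form_scale f (T (form_scale h \<alpha>))) \<eta>)" .
    have "ip (form_scale f (form_scale h (T \<alpha>))) \<eta> + ip (T (form_scale f (form_scale h \<alpha>))) \<eta> =
        ip (form_scale h (T (form_scale f \<alpha>))) \<eta> + ip (form_scale f (T (form_scale h \<alpha>))) \<eta>"
      using arg_cong[OF first_order_operatorD(3)[OF T \<alpha>(1) f], of "\<lambda>x. ip x \<eta>"]
        L2_add_left[OF Fl[OF F4(1)] Fl[OF F4(2)] Fl[OF \<eta>]] L2_add_left[OF Fl[OF F4(3)] Fl[OF F4(4)] Fl[OF \<eta>]]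
      by simp
    then show "ip \<alpha> (?l - ?r) = 0" unfolding eq by simp
  qed
  then show "?l = ?r" by simp
qed

text \<open>The relation for S' is used on T \<alpha>, which must therefore again be a test form;
  this is where locality enters. In the application S and T are the same operator in consecutive
  degrees.\<close>

lemma adjoint_square:
  assumes E: "form_module E" and T: "first_order_operator E F T" and adj: "formal_adjoint X A g \<mu> E F T T'"
    and adj': "formal_adjoint X A g \<mu> F G S S'"
    and ST: "\<And>\<alpha>. \<alpha> \<in> E \<Longrightarrow> S (T \<alpha>) = 0" and \<gamma>: "\<gamma> \<in> G"
  shows "T' (S' \<gamma>) = 0"
proof (rule L2_nondegenerate[OF E])
  show "T' (S' \<gamma>) \<in> E" using formal_adjointD(1)[OF adj formal_adjointD(1)[OF adj' \<gamma>]] .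
  fix \<alpha> assume \<alpha>: "\<alpha> \<in> E" "test_form \<alpha>"
  have "ip \<alpha> (T' (S' \<gamma>)) = ip (T \<alpha>) (S' \<gamma>)"
    by (rule formal_adjointD(2)[OF adj formal_adjointD(1)[OF adj' \<gamma>] \<alpha>])
  also have "\<dots> = ip (S (T \<alpha>)) \<gamma>"
    by (rule formal_adjointD(2)[OF adj' \<gamma> first_order_operatorD(1)[OF T \<alpha>(1)] test_form_operator[OF T E \<alpha>]])
  finally show "ip \<alpha> (T' (S' \<gamma>)) = 0" by (simp add: ST[OF \<alpha>(1)] L2_zero_left)
qed

end

section \<open>Boundary conditions\<close>

context riemannian_bordered_manifold
begin

context
  fixes \<rho> :: "'a \<Rightarrow> real"
  assumes \<rho>: "boundary_defining_function X A g \<rho>"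
begin

lemma \<rho>_smooth: "smooth_function A \<rho>"
  and \<rho>_interior: "c \<in> A \<Longrightarrow> p \<in> fst c \<Longrightarrow> p \<notin> boundary A \<Longrightarrow> \<rho> p \<noteq> 0"
  and \<rho>_boundary: "p \<in> boundary A \<Longrightarrow> \<rho> p = 0"
  using \<rho> in_topspace[of c p] by (auto simp: boundary_defining_function_def dest!: bspec[of "topspace X - boundary A" _ p])

text \<open>The gradient has length 1 on the boundary, so the covector dual to it is nonzero
  there.\<close>

lemma \<rho>_deriv_nonzero:
  assumes c: "c \<in> A" "p \<in> fst c" "p \<in> boundary A"
  shows "\<exists>v. chart_deriv c \<rho> p v \<noteq> 0"
proof (rule ccontr)
  assume "\<nexists>v. chart_deriv c \<rho> p v \<noteq> 0"
  then have zero: "chart_deriv c \<rho> p = (\<lambda>v. 0)" by auto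
  have bil: "bilinear (g c p)" using g_inner_product[OF c(1,2)] by (simp add: inner_product_def)
  have "gradient g \<rho> c p = 0"
    unfolding gradient_def zero
    by (rule dual_vec_eqI[OF inner_product_nondegenerate[OF g_inner_product[OF c(1,2)]]]) (rule bilinear_lzero[OF bil])
  then have "g c p (gradient g \<rho> c p) (gradient g \<rho> c p) = 0" using bilinear_lzero[OF bil] by simp
  moreover have "sqrt (g c p (gradient g \<rho> c p) (gradient g \<rho> c p)) = 1"
    using \<rho> c unfolding boundary_defining_function_def by blast
  ultimately show False by simp
qed

text \<open>On the boundary this is the value given by l'Hospital's rule in the normal
  direction.\<close>

definition quotient :: "('a, 'm) chart \<Rightarrow> ('a \<Rightarrow> real) \<Rightarrow> 'a \<Rightarrow> real" where
  "quotient c f p =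
     (if p \<in> boundary A then chart_deriv c f p normal_dir / chart_deriv c \<rho> p normal_dir else f p / \<rho> p)"

lemma \<rho>_quotient:
  assumes "c \<in> A" "p \<in> fst c" "\<And>q. q \<in> fst c \<Longrightarrow> q \<in> boundary A \<Longrightarrow> f q = 0"
  shows "\<rho> p * quotient c f p = f p"
  using assms \<rho>_interior[OF assms(1,2)] \<rho>_boundary by (simp add: quotient_def)

text \<open>Near a boundary point f and \<rho> are the normal coordinate times smooth factors a and
  b, so the quotient is a / b. The factor b has no zero, because d\<rho> is nonzero on the boundary
  and \<rho> is nonzero elsewhere.\<close>

lemma smooth_quotient:
  assumes c: "c \<in> A" and f: "smooth_in_chart c f" "\<And>q. q \<in> fst c \<Longrightarrow> q \<in> boundary A \<Longrightarrow> f q = 0"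
  shows "smooth_in_chart c (quotient c f)"
proof (rule smooth_in_chart_locally[OF good_chart[OF c]])
  fix p assume p: "p \<in> fst c"
  have f0: "\<forall>q\<in>fst c \<inter> boundary A. f q = 0" and \<rho>0: "\<forall>q\<in>fst c \<inter> boundary A. \<rho> q = 0"
    using f(2) \<rho>_boundary by auto
  have \<rho>c: "smooth_in_chart c \<rho>" using \<rho>_smooth c by (simp add: smooth_function_def)
  show "\<exists>U. p \<in> U \<and> U \<subseteq> fst c \<and> hs_open (snd c ` U) \<and> smooth_in_chart (U, snd c) (quotient c f)"
  proof (cases "p \<in> boundary A")
    case True
    obtain U a where U: "openin X U" "p \<in> U" "U \<subseteq> fst c" "smooth_in_chart (U, snd c) a"
      "\<forall>q\<in>U. f q = snd c q $ bdry_index * a q"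
      "\<forall>q\<in>U. \<forall>v. q \<in> boundary A \<longrightarrow> chart_deriv c f q v = v $ bdry_index * a q"
      using boundary_factor[OF c p True f(1) f0] by (elim exE conjE)
    obtain V b where V: "openin X V" "p \<in> V" "V \<subseteq> fst c" "smooth_in_chart (V, snd c) b"
      "\<forall>q\<in>V. \<rho> q = snd c q $ bdry_index * b q"
      "\<forall>q\<in>V. \<forall>v. q \<in> boundary A \<longrightarrow> chart_deriv c \<rho> q v = v $ bdry_index * b q"
      using boundary_factor[OF c p True \<rho>c \<rho>0] by (elim exE conjE)
    let ?W = "U \<inter> V"
    have W: "openin X ?W" "?W \<subseteq> fst c" using U V by auto
    have goodU: "good_chart (U, snd c)" "good_chart (V, snd c)"
      using good_chart_restrict[OF good_chart[OF c]] image_of_open[OF c] U V by auto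
    have b0: "b q \<noteq> 0" if "q \<in> V" for q
    proof (cases "q \<in> boundary A")
      case True
      then show ?thesis using \<rho>_deriv_nonzero[OF c _ True] V(3,6) that by auto
    next
      case False
      then show ?thesis using \<rho>_interior[OF c _ False] V(3,5) that by auto
    qed
    have "smooth_in_chart (?W, snd c) a" "smooth_in_chart (?W, snd c) b"
      using smooth_in_chart_restrict[OF goodU(1) _ U(4), of ?W] smooth_in_chart_restrict[OF goodU(2) _ V(4), of ?W] by auto
    then have "smooth_in_chart (?W, snd c) (\<lambda>q. a q / b q)"
      by (rule smooth_in_chart_divide) (use b0 in auto)
    moreover have "a q / b q = quotient c f q" if q: "q \<in> ?W" for q
    proof (cases "q \<in> boundary A")
      case True
      then show ?thesis using U(6) V(6) q by (simp add: quotient_def normal_dir_def)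
    next
      case False
      then have "snd c q $ bdry_index \<noteq> 0" using boundary_iff[OF c, of q] q U(3) by auto
      then show ?thesis using U(5) V(5) q False by (simp add: quotient_def)
    qed
    ultimately have "smooth_in_chart (?W, snd c) (quotient c f)"
      by (elim smooth_in_chart_cong) simp
    then show ?thesis using image_of_open[OF c W] U(2) V(2) W(2) by (intro exI[of _ ?W]) simp
  next
    case False
    let ?U = "fst c \<inter> (topspace X - boundary A)"
    have U: "openin X ?U" "?U \<subseteq> fst c" using interior_open chart_open[OF c] by auto
    have "smooth_in_chart (?U, snd c) (\<lambda>q. f q / \<rho> q)"
      using smooth_in_chart_restrict[OF good_chart[OF c] U(2) f(1)] smooth_in_chart_restrict[OF good_chart[OF c] U(2) \<rho>c]
      by (rule smooth_in_chart_divide) (use \<rho>_interior[OF c] in auto)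
    then have "smooth_in_chart (?U, snd c) (quotient c f)"
      by (rule smooth_in_chart_cong) (simp add: quotient_def)
    then show ?thesis using image_of_open[OF c U] False p in_topspace[OF c p] U(2) by (intro exI[of _ ?U]) simp
  qed
qed

text \<open>The function \<rho> has no zero in the interior, which is dense, and f is
  continuous.\<close>

lemma \<rho>_cancel:
  fixes f :: "'a \<Rightarrow> real"
  assumes "c \<in> A" "openin X V" "V \<subseteq> fst c" "p \<in> V" "smooth_in_chart (V, snd c) f" "\<And>q. q \<in> V \<Longrightarrow> \<rho> q * f q = 0"
  shows "f p = 0"
  by (rule eq_zero_of_interior[OF assms(1-5)]) (use \<rho>_interior[OF assms(1)] assms(3,6) in fastforce)

lemma \<rho>_cancel_form:
  assumes \<zeta>: "\<zeta> \<in> forms A k" and zero: "form_scale \<rho> \<zeta> = 0"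
  shows "\<zeta> = 0"
proof -
  have "\<zeta> c p vs = 0" for c p vs
  proof (cases "c \<in> A \<and> p \<in> fst c")
    case True
    have "\<rho> q * \<zeta> c q vs = 0" for q using zero by (metis form_scale_apply zero_fun_apply)
    then show ?thesis
      using \<rho>_cancel[of c "fst c" p "\<lambda>q. \<zeta> c q vs"] True chart_open forms_smooth[OF \<zeta>] by auto
  next
    case False
    then show ?thesis using forms_outside[OF \<zeta>] by blast
  qed
  then show ?thesis by (intro ext) simp
qed

text \<open>The quotient is formed for each chart and each argument list separately. Linearity,
  alternation, the degree and the transformation law hold after multiplication by \<rho>, where they
  are those of \<alpha>, and \<rho> can be cancelled from smooth functions.\<close>

lemma form_division:
  assumes \<alpha>: "\<alpha> \<in> forms A k" and vanishing: "vanishes_on_boundary A \<alpha>"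
  shows "\<exists>\<xi>\<in>forms A k. form_scale \<rho> \<xi> = \<alpha>"
proof -
  have zero: "\<alpha> c q vs = 0" if "c \<in> A" "q \<in> fst c" "q \<in> boundary A" for c q vs
    using vanishing that by (auto simp: vanishes_on_boundary_def)
  define \<xi> where "\<xi> = (\<lambda>c p vs. if c \<in> A \<and> p \<in> fst c then quotient c (\<lambda>q. \<alpha> c q vs) p else 0)"
  have \<rho>\<xi>: "\<rho> p * \<xi> c p vs = \<alpha> c p vs" for c p vs
    using \<rho>_quotient[of c p "\<lambda>q. \<alpha> c q vs"] zero forms_outside[OF \<alpha>, of c p vs] by (auto simp: \<xi>_def)
  have smooth: "smooth_in_chart c (\<lambda>p. \<xi> c p vs)" if c: "c \<in> A" for c vs
    by (rule smooth_in_chart_cong[OF smooth_quotient[OF c forms_smooth[OF \<alpha> c] zero[OF c]]]) (simp_all add: \<xi>_def c)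
  have cancel: "f p = 0" if "c \<in> A" "p \<in> fst c" "smooth_in_chart c f" "\<And>q. q \<in> fst c \<Longrightarrow> \<rho> q * f q = 0" for c p and f :: "'a \<Rightarrow> real"
    using \<rho>_cancel[OF that(1) chart_open[OF that(1)] order_refl that(2)] that(3,4) by simp
  have alt: "alternating_multilinear (\<xi> c p)" if c: "c \<in> A" "p \<in> fst c" for c p
    unfolding alternating_multilinear_def
  proof (intro conjI allI impI)
    fix vs :: "(real ^ 'm) list"
    note lin = alternating_linear_nth[OF forms_alternating[OF \<alpha> c(1)]]
    show "linear (\<lambda>v. \<xi> c p (vs[i := v]))" if i: "i < length vs" for i
    proof (rule linearI)
      fix x y :: "real ^ 'm" and a :: real
      have "\<xi> c p (vs[i := x + y]) - (\<xi> c p (vs[i := x]) + \<xi> c p (vs[i := y])) = 0"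
        by (rule cancel[OF c, where f="\<lambda>q. \<xi> c q (vs[i := x + y]) - (\<xi> c q (vs[i := x]) + \<xi> c q (vs[i := y]))"])
          (auto simp: right_diff_distrib distrib_left \<rho>\<xi> linear_add[OF lin[OF _ i]] intro!: smooth_in_chart_diff smooth_in_chart_add smooth c)
      then show "\<xi> c p (vs[i := x + y]) = \<xi> c p (vs[i := x]) + \<xi> c p (vs[i := y])" by simp
      have scale: "\<rho> q * (a * z) = a * (\<rho> q * z)" for q z by simp
      have "\<xi> c p (vs[i := a *\<^sub>R x]) - a * \<xi> c p (vs[i := x]) = 0"
        by (rule cancel[OF c, where f="\<lambda>q. \<xi> c q (vs[i := a *\<^sub>R x]) - a * \<xi> c q (vs[i := x])"])
          (auto simp: right_diff_distrib \<rho>\<xi> scale linear_scale[OF lin[OF _ i]]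
            intro!: smooth_in_chart_diff smooth_in_chart_mult smooth_in_chart_const smooth c simp del: mult_cancel_left)
      then show "\<xi> c p (vs[i := a *\<^sub>R x]) = a *\<^sub>R \<xi> c p (vs[i := x])" by simp
    qed
    show "\<xi> c p vs = 0" if ij: "j < length vs" "i < j" "vs ! i = vs ! j" for i j
    proof -
      have "\<alpha> c q vs = 0" if "q \<in> fst c" for q
        using forms_alternating[OF \<alpha> c(1) that] ij unfolding alternating_multilinear_def by blast
      then show ?thesis
        using cancel[OF c smooth[OF c(1), of vs]] \<rho>\<xi> by simp
    qed
  qed
  have "\<xi> \<in> forms A k"
  proof (rule formsI)
    show "\<xi> c p vs = 0" if out: "c \<notin> A \<or> p \<notin> fst c \<or> int (length vs) \<noteq> k" for c p vs
    proof (cases "c \<in> A \<and> p \<in> fst c")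
      case True
      then have "\<alpha> c q vs = 0" for q using forms_outside[OF \<alpha>, of c q vs] out by blast
      then show ?thesis using cancel[of c p "\<lambda>p. \<xi> c p vs"] smooth[of c vs] \<rho>\<xi> True by simp
    qed (auto simp: \<xi>_def)
    show "alternating_multilinear (\<xi> c p)" if "c \<in> A" "p \<in> fst c" for c p by (rule alt[OF that])
    show "smooth_in_chart c (\<lambda>p. \<xi> c p vs)" if "c \<in> A" for c vs by (rule smooth[OF that])
    show "\<xi> c p vs = \<xi> c' p (map (chart_deriv c (snd c') p) vs)"
      if c: "c \<in> A" "c' \<in> A" "p \<in> fst c" "p \<in> fst c'" for c c' p vs
    proof -
      let ?F = "\<lambda>q. chart_deriv c (snd c') q" and ?V = "fst c \<inter> fst c'"
      let ?Ys = "map (\<lambda>w q. ?F q w) vs"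
      have sm': "smooth_components (overlap c c') (\<xi> c')"
        using smooth_overlap[OF c(1,2) smooth[OF c(2)]] by blast
      have "smooth_in_chart (overlap c c') (\<lambda>q. \<xi> c' q (map (\<lambda>Y. Y q) ?Ys))"
        by (rule smooth_in_chart_insert_fields[OF sm']) (use alt[OF c(2)] smooth_transition_deriv[OF c(1,2)] in auto)
      then have "smooth_in_chart (overlap c c') (\<lambda>q. \<xi> c q vs - \<xi> c' q (map (?F q) vs))"
        using smooth_in_chart_restrict[OF good_chart[OF c(1)] _ smooth[OF c(1)], of ?V vs]
        by (intro smooth_in_chart_diff) (auto simp: o_def)
      moreover have "\<rho> q * (\<xi> c q vs - \<xi> c' q (map (?F q) vs)) = 0" if "q \<in> ?V" for q
        using forms_change[OF \<alpha> c(1,2), of q vs] that by (simp add: right_diff_distrib \<rho>\<xi> del: mult_eq_0_iff)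
      ultimately have "\<xi> c p vs - \<xi> c' p (map (?F p) vs) = 0"
        using \<rho>_cancel[OF c(1), of ?V p "\<lambda>q. \<xi> c q vs - \<xi> c' q (map (?F q) vs)"]
          c openin_Int[OF chart_open[OF c(1)] chart_open[OF c(2)]] by auto
      then show ?thesis by simp
    qed
  qed
  moreover have "form_scale \<rho> \<xi> = \<alpha>" by (intro ext) (simp add: form_scale_apply \<rho>\<xi>)
  ultimately show ?thesis by blast
qed

text \<open>Division by \<rho> must not lead out of \<open>E\<close>: the quotient has to be
  primitive again when the operators are \<open>\<partial>\<^sub>+\<close> and
  \<open>\<partial>\<^sub>-\<close>.\<close>

definition divisible_module :: "('a, 'm) mform set \<Rightarrow> bool" where
  "divisible_module E \<longleftrightarrow> form_module E \<and>
     (\<forall>\<alpha>\<in>E. vanishes_on_boundary A \<alpha> \<longrightarrow> (\<exists>\<xi>\<in>E. form_scale \<rho> \<xi> = \<alpha>))"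

lemma divisible_forms: "divisible_module (forms A k)"
  by (simp add: divisible_module_def form_module_forms form_division)

text \<open>Here \<open>\<sigma> = [T, \<rho>] \<eta>\<close>. Applying \<open>T\<close> to \<open>T (\<rho>\<^sup>2 \<eta>) = \<rho>\<^sup>2 T \<eta> + 2 \<rho>\<^sup>2 \<xi>\<close> gives \<open>[T, \<rho>] \<xi> = 0\<close>, and
  applying it to \<open>T (\<rho> \<eta>) = \<rho> T \<eta> + \<rho> \<xi>\<close> gives \<open>T (\<rho> T \<eta>) = - T (\<rho> \<xi>) = - \<rho> T \<xi>\<close>.\<close>

lemma boundary_condition_preserved:
  assumes E: "form_module E" "divisible_module F" "form_module G"
    and T: "first_order_operator E F T" "first_order_operator F G T"
    and square: "\<And>\<eta>. \<eta> \<in> E \<Longrightarrow> T (T \<eta>) = 0"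
    and \<eta>: "\<eta> \<in> E" "\<eta> \<in> bdry_cond A \<rho> T"
  shows "T \<eta> \<in> bdry_cond A \<rho> T"
proof -
  let ?s = "form_scale \<rho>"
  have F: "form_module F" using E(2) by (simp add: divisible_module_def)
  note s = form_module_scale[OF _ _ \<rho>_smooth]
  note sE = s[OF E(1)] and sF = s[OF F] and sG = s[OF E(3)]
  note TF = first_order_operatorD(1)[OF T(1)] and TG = first_order_operatorD(1)[OF T(2)]
  have comm: "T (?s (?s \<zeta>)) = 2 *\<^sub>R ?s (T (?s \<zeta>)) - ?s (?s (T \<zeta>))" if "first_order_operator E' F' T" "\<zeta> \<in> E'" for E' F' \<zeta>
    using first_order_operatorD(3)[OF that \<rho>_smooth \<rho>_smooth] by (simp add: scaleR_2 algebra_simps)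
  have vb: "vanishes_on_boundary A (?s \<zeta>)" for \<zeta>
    using \<rho>_boundary by (simp add: vanishes_on_boundary_def form_scale_apply)
  define \<sigma> where "\<sigma> = T (?s \<eta>) - ?s (T \<eta>)"
  have \<sigma>F: "\<sigma> \<in> F" unfolding \<sigma>_def by (intro form_module_diff[OF F] TF sE sF \<eta>(1))
  have "vanishes_on_boundary A \<sigma>"
    using vb[of "T \<eta>"] \<eta>(2) by (simp add: \<sigma>_def bdry_cond_def vanishes_on_boundary_def)
  then obtain \<xi> where \<xi>: "\<xi> \<in> F" "?s \<xi> = \<sigma>" using E(2) \<sigma>F by (auto simp: divisible_module_def)
  have T\<rho>\<eta>: "T (?s \<eta>) = ?s (T \<eta>) + ?s \<xi>" by (simp add: \<xi>(2) \<sigma>_def)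
  have "T (?s (T \<eta>) + ?s \<xi>) = 0" unfolding T\<rho>\<eta>[symmetric] by (rule square[OF sE[OF \<eta>(1)]])
  then have T\<rho>T\<eta>: "T (?s (T \<eta>)) + T (?s \<xi>) = 0"
    using first_order_operatorD(2)[OF T(2) sF[OF TF[OF \<eta>(1)]] sF[OF \<xi>(1)]] by simp
  have two: "2 *\<^sub>R \<zeta> \<in> F" if "\<zeta> \<in> F" for \<zeta> by (rule form_module_scaleR[OF F that])
  have "T (?s (?s \<eta>)) = ?s (?s (T \<eta>)) + (?s (?s \<xi>) + ?s (?s \<xi>))"
    unfolding comm[OF T(1) \<eta>(1)] T\<rho>\<eta> form_scale_add by (simp add: scaleR_2)
  then have "0 = T (?s (?s (T \<eta>)) + (?s (?s \<xi>) + ?s (?s \<xi>)))"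
    using square[OF sE[OF sE[OF \<eta>(1)]]] by simp
  also have "\<dots> = T (?s (?s (T \<eta>))) + (T (?s (?s \<xi>)) + T (?s (?s \<xi>)))"
    using first_order_operatorD(2)[OF T(2)] form_module_add[OF F] sF TF \<eta>(1) \<xi>(1) by metis
  also have "\<dots> = 2 *\<^sub>R ?s (T (?s (T \<eta>))) - ?s (?s (T (T \<eta>))) + 2 *\<^sub>R (2 *\<^sub>R ?s (T (?s \<xi>)) - ?s (?s (T \<xi>)))"
    unfolding comm[OF T(2) \<xi>(1)] comm[OF T(2) TF[OF \<eta>(1)]] by (simp only: scaleR_2)
  also have "T (T \<eta>) = 0" by (rule square[OF \<eta>(1)])
  also have "T (?s (T \<eta>)) = - T (?s \<xi>)" using T\<rho>T\<eta> by (simp add: eq_neg_iff_add_eq_0)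
  \<comment> \<open>Here \<beta> stands for T (\<rho> \<xi>) and \<gamma> for \<rho> T \<xi>. What
    remains is 2 \<rho> [T, \<rho>] \<xi> = 0, from which \<rho> is cancelled.\<close>
  also have "2 *\<^sub>R ?s (- \<beta>) - ?s (?s 0) + 2 *\<^sub>R (2 *\<^sub>R ?s \<beta> - ?s \<gamma>) = ?s (2 *\<^sub>R (\<beta> - \<gamma>))" for \<beta> \<gamma>
    by (intro ext) (simp add: form_scale_apply algebra_simps)
  finally have "?s (2 *\<^sub>R (T (?s \<xi>) - ?s (T \<xi>))) = 0" by (rule sym)
  moreover obtain k where "G \<subseteq> forms A k" using E(3) by (auto simp: form_module_def)
  then have "2 *\<^sub>R (T (?s \<xi>) - ?s (T \<xi>)) \<in> forms A k"
    using form_module_scaleR[OF E(3) form_module_diff[OF E(3) TG[OF sF[OF \<xi>(1)]] sG[OF TG[OF \<xi>(1)]]]] by blast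
  ultimately have "2 *\<^sub>R (T (?s \<xi>) - ?s (T \<xi>)) = 0" using \<rho>_cancel_form by blast
  then have "T (?s \<xi>) = ?s (T \<xi>)" by (simp add: scaleR_eq_0_iff)
  then have "T (?s (T \<eta>)) = - ?s (T \<xi>)" using T\<rho>T\<eta> by (simp only: eq_neg_iff_add_eq_0)
  then show ?thesis using vb[of "T \<xi>"] by (simp add: bdry_cond_def vanishes_on_boundary_def)
qed

text \<open>The shift \<open>s\<close> is 1 for d and \<open>\<partial>\<^sub>+\<close>, and -1 for
  \<open>d\<^sup>\<Lambda>\<close> and \<open>\<partial>\<^sub>-\<close>. Since the adjoint relation
  holds in every degree, T' is again a complex of first-order operators, so
  \<open>boundary_condition_preserved\<close> serves both T and T'.\<close>

lemma complex_boundary_conditions: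
  fixes E :: "int \<Rightarrow> ('a, 'm) mform set" and s :: int
  assumes E: "\<And>j. divisible_module (E j)" and T: "\<And>j. first_order_operator (E j) (E (j + s)) T"
    and square: "\<And>j. \<forall>\<eta>\<in>E j. T (T \<eta>) = 0"
    and adj: "\<And>j. formal_adjoint X A g \<mu> (E j) (E (j + s)) T T'"
    and \<eta>: "\<eta> \<in> E k"
  shows "\<eta> \<in> bdry_cond A \<rho> T \<Longrightarrow> T \<eta> \<in> bdry_cond A \<rho> T"
    and "\<eta> \<in> bdry_cond A \<rho> T' \<Longrightarrow> T' \<eta> \<in> bdry_cond A \<rho> T'"
proof -
  have mod: "form_module (E j)" for j using E by (simp add: divisible_module_def)
  show "T \<eta> \<in> bdry_cond A \<rho> T" if "\<eta> \<in> bdry_cond A \<rho> T"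
    by (rule boundary_condition_preserved[OF mod E mod T T square[rule_format] \<eta> that])
  \<comment> \<open>On E j the operator T' is the adjoint of T starting in E (j - s), hence the
    index.\<close>
  have T': "first_order_operator (E j) (E (j - s)) T'" for j
    using adjoint_first_order[OF mod mod T adj, of "j - s"] by simp
  have square': "T' (T' \<gamma>) = 0" if "\<gamma> \<in> E j" for j \<gamma>
    by (rule adjoint_square[OF mod T adj adj square[rule_format], of "j - s - s"]) (use that in simp_all)
  show "T' \<eta> \<in> bdry_cond A \<rho> T'" if "\<eta> \<in> bdry_cond A \<rho> T'"
    by (rule boundary_condition_preserved[OF mod E mod T' T' square' \<eta> that])
qed

end

end

theorem corollary3p10:
  fixes X :: "'a topology" and A :: "('a, 'm::finite) chart set" and n :: nat
    and \<omega> :: "('a, 'm) mform" and J :: "('a, 'm) endomorphism_field" and g :: "('a, 'm) metric"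
    and \<rho> :: "'a \<Rightarrow> real" and \<mu> :: "'a measure"
    and d_adj d_Lambda_adj del_plus_adj del_minus_adj :: "('a, 'm) mform \<Rightarrow> ('a, 'm) mform"
  assumes "smooth_manifold_with_boundary X A" and "compact_space X" and "CARD('m) = 2 * n"
    and "symplectic_form A \<omega>"
    and "compatible_triple A \<omega> J g"
    and "boundary_defining_function X A g \<rho>"
    and "riemannian_measure X A g \<mu>"
    and "\<And>k. formal_adjoint X A g \<mu> (forms A k) (forms A (k + 1)) (ext_d A) d_adj"
    and "\<And>k. formal_adjoint X A g \<mu> (forms A k) (forms A (k - 1)) (d_Lambda A \<omega>) d_Lambda_adj"
    and "\<And>k. formal_adjoint X A g \<mu> (primitive_forms A n \<omega> k) (primitive_forms A n \<omega> (k + 1))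
                (del_plus A n \<omega>) del_plus_adj"
    and "\<And>k. formal_adjoint X A g \<mu> (primitive_forms A n \<omega> k) (primitive_forms A n \<omega> (k - 1))
                (del_minus A n \<omega>) del_minus_adj"
  shows
    "(\<forall>k. \<forall>\<eta>\<in>forms A k.
        (\<eta> \<in> bdry_cond A \<rho> (ext_d A) \<longrightarrow> ext_d A \<eta> \<in> bdry_cond A \<rho> (ext_d A)) \<and>
        (\<eta> \<in> bdry_cond A \<rho> d_adj \<longrightarrow> d_adj \<eta> \<in> bdry_cond A \<rho> d_adj) \<and>
        (\<eta> \<in> bdry_cond A \<rho> d_Lambda_adj \<longrightarrow> d_Lambda_adj \<eta> \<in> bdry_cond A \<rho> d_Lambda_adj) \<and>
        (\<eta> \<in> bdry_cond A \<rho> (d_Lambda A \<omega>) \<longrightarrow> d_Lambda A \<omega> \<eta> \<in> bdry_cond A \<rho> (d_Lambda A \<omega>))) \<and>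
     (\<forall>k. 0 \<le> k \<and> k \<le> int n \<longrightarrow> (\<forall>\<eta>\<in>primitive_forms A n \<omega> k.
        (\<eta> \<in> bdry_cond A \<rho> (del_plus A n \<omega>) \<longrightarrow>
           del_plus A n \<omega> \<eta> \<in> bdry_cond A \<rho> (del_plus A n \<omega>)) \<and>
        (\<eta> \<in> bdry_cond A \<rho> del_plus_adj \<longrightarrow>
           del_plus_adj \<eta> \<in> bdry_cond A \<rho> del_plus_adj) \<and>
        (\<eta> \<in> bdry_cond A \<rho> (del_minus A n \<omega>) \<longrightarrow>
           del_minus A n \<omega> \<eta> \<in> bdry_cond A \<rho> (del_minus A n \<omega>)) \<and>
        (\<eta> \<in> bdry_cond A \<rho> del_minus_adj \<longrightarrow>
           del_minus_adj \<eta> \<in> bdry_cond A \<rho> del_minus_adj)))"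
proof -
  interpret bordered_manifold X A by standard (rule assms(1))
  interpret symplectic_manifold X A \<omega> n by standard (rule assms(4), rule assms(3))
  have metric: "riemannian_metric A g" using assms(5) unfolding compatible_triple_def by blast
  interpret riemannian_bordered_manifold X A g \<mu> by standard (rule metric, rule assms(7), rule assms(2))
  note \<rho> = assms(6)
  \<comment> \<open>As \<Lambda> is linear over functions, \<rho> \<Lambda>\<xi> = \<Lambda>\<alpha>
    = 0, and cancelling \<rho> shows that the quotient is primitive.\<close>
  have divisible_primitive: "divisible_module \<rho> (primitive_forms A n \<omega> k)" for k
    unfolding divisible_module_def[OF \<rho>]
  proof (intro conjI ballI impI form_module_primitive)
    fix \<alpha> assume \<alpha>: "\<alpha> \<in> primitive_forms A n \<omega> k" "vanishes_on_boundary A \<alpha>"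
    obtain \<xi> where \<xi>: "\<xi> \<in> forms A k" "form_scale \<rho> \<xi> = \<alpha>"
      using form_division[OF \<rho> _ \<alpha>(2), of k] \<alpha>(1) by (auto simp: primitive_iff)
    have "form_scale \<rho> (lefschetz_Lambda \<omega> \<xi>) = 0"
      using \<alpha>(1) by (simp add: Lam_scale[symmetric] \<xi>(2) primitive_iff)
    then have "lefschetz_Lambda \<omega> \<xi> = 0" by (rule \<rho>_cancel_form[OF \<rho> Lam_in_forms[OF \<xi>(1)]])
    then show "\<exists>\<xi>\<in>primitive_forms A n \<omega> k. form_scale \<rho> \<xi> = \<alpha>" using \<xi> by (auto simp: primitive_iff)
  qed
  have square: "\<forall>\<eta>\<in>forms A j. ext_d A (ext_d A \<eta>) = 0"
    "\<forall>\<eta>\<in>forms A j. d_Lambda A \<omega> (d_Lambda A \<omega> \<eta>) = 0"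
    "\<forall>\<eta>\<in>primitive_forms A n \<omega> j. del_plus A n \<omega> (del_plus A n \<omega> \<eta>) = 0"
    "\<forall>\<eta>\<in>primitive_forms A n \<omega> j. del_minus A n \<omega> (del_minus A n \<omega> \<eta>) = 0" for j
    by (intro ballI ext_d_ext_d d_Lambda_square del_square; assumption)+
  note preserved = complex_boundary_conditions[OF \<rho>]
  have "(\<eta> \<in> bdry_cond A \<rho> (ext_d A) \<longrightarrow> ext_d A \<eta> \<in> bdry_cond A \<rho> (ext_d A)) \<and>
      (\<eta> \<in> bdry_cond A \<rho> d_adj \<longrightarrow> d_adj \<eta> \<in> bdry_cond A \<rho> d_adj)" if "\<eta> \<in> forms A k" for \<eta> k
    using preserved[where E="forms A" and s=1, OF divisible_forms[OF \<rho>] ext_d_first_order square(1) assms(8) that]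
    by blast
  moreover
  have "(\<eta> \<in> bdry_cond A \<rho> (d_Lambda A \<omega>) \<longrightarrow> d_Lambda A \<omega> \<eta> \<in> bdry_cond A \<rho> (d_Lambda A \<omega>)) \<and>
      (\<eta> \<in> bdry_cond A \<rho> d_Lambda_adj \<longrightarrow> d_Lambda_adj \<eta> \<in> bdry_cond A \<rho> d_Lambda_adj)"
    if "\<eta> \<in> forms A k" for \<eta> k
    \<comment> \<open>The unfolding turns the index j + (-1) into the j - 1 of the adjoint
      hypothesis.\<close>
    using preserved[where E="forms A" and s="-1" and T="d_Lambda A \<omega>" and T'=d_Lambda_adj,
        unfolded add_uminus_conv_diff, OF divisible_forms[OF \<rho>] d_Lambda_first_order square(2) assms(9) that]
    by blast
  moreover
  have "(\<eta> \<in> bdry_cond A \<rho> (del_plus A n \<omega>) \<longrightarrow> del_plus A n \<omega> \<eta> \<in> bdry_cond A \<rho> (del_plus A n \<omega>)) \<and>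
      (\<eta> \<in> bdry_cond A \<rho> del_plus_adj \<longrightarrow> del_plus_adj \<eta> \<in> bdry_cond A \<rho> del_plus_adj)"
    if "\<eta> \<in> primitive_forms A n \<omega> k" for \<eta> k
    using preserved[where E="primitive_forms A n \<omega>" and s=1, OF divisible_primitive del_plus_first_order
        square(3) assms(10) that] by blast
  moreover
  have "(\<eta> \<in> bdry_cond A \<rho> (del_minus A n \<omega>) \<longrightarrow> del_minus A n \<omega> \<eta> \<in> bdry_cond A \<rho> (del_minus A n \<omega>)) \<and>
      (\<eta> \<in> bdry_cond A \<rho> del_minus_adj \<longrightarrow> del_minus_adj \<eta> \<in> bdry_cond A \<rho> del_minus_adj)"
    if "\<eta> \<in> primitive_forms A n \<omega> k" for \<eta> k
    using preserved[where E="primitive_forms A n \<omega>" and s="-1" and T="del_minus A n \<omega>" and T'=del_minus_adj,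
        unfolded add_uminus_conv_diff, OF divisible_primitive del_minus_first_order square(4) assms(11) that]
    by blast
  ultimately show ?thesis by blast
qed

end
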